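(* Let $K$ be a nonzero commutative ring, $n\ge7$, and for each $i=1,\dots,n-1$ let $S'_{i,1}$ be the set of all $2$-element subsets $\alpha\subseteq\{1,\dots,n\}\setminus\{i\}$ such that $\{i+1,\dots,n\}\not\subseteq\alpha$, and let $j_i:S'_{i,1}\to\{i+1,\dots,n\}$ be avoidance functions, i.e. any functions with $j_i(\alpha)\in\{i+1,\dots,n\}\setminus\alpha$ for all $\alpha\in S'_{i,1}$. If either $n$ is odd, or $n$ is even and $\frac12\in K$, then $$\Sigma=\langle \rho_{i,j_i(\alpha);\lambda x^\alpha},\ \sigma_{i',\lambda x_jx_kx_l}\mid \lambda\in K;\ 1\le i\le n-1;\ \alpha\in S'_{i,1};\ 1\le i'\le n;\ j<k<l;\ i'\notin\{j,k,l\}\rangle,$$ and the $1$-dimensional abelian subgroups $\{\rho_{i,j_i(\alpha);\lambda x^\alpha}\}_{\lambda\in K}\simeq K$ and $\{\sigma_{i',\lambda x_jx_kx_l}\}_{\lambda\in K}\simeq K$ of $\Sigma$ form a minimal set of generators for $\Sigma$ in the sense that no subgroup can be dropped.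
   Context: $\Lambda_n=\Lambda_n(K)$ is the Grassmann $K$-algebra generated freely over $K$ by $x_1,\dots,x_n$ subject to $x_i^2=0$, $x_ix_j=-x_jx_i$ ($i\ne j$); it is free over $K$ with basis $x^\alpha=x_{i_1}\cdots x_{i_k}$, $\alpha=\{i_1<\dots<i_k\}\subseteq\{1,\dots,n\}$, and graded by $|\alpha|$, with components $\Lambda_{n,d}$; $\mathfrak m=\bigoplus_{d\ge1}\Lambda_{n,d}$; $\Lambda_n^{od}$ is the sum of the components of odd degree. $\Gamma$ is the group of $K$-algebra automorphisms $\sigma$ of $\Lambda_n$ with $\sigma(x_i)-x_i\in\Lambda_n^{od}\cap\mathfrak m^3$ for all $i$. The left skew derivation $\partial/\partial x_j$ is the $K$-linear map with $\frac{\partial x_k}{\partial x_j}=\delta_{jk}$ and $\frac{\partial (ab)}{\partial x_j}=\frac{\partial a}{\partial x_j}b+(-1)^i a\frac{\partial b}{\partial x_j}$ for $a\in\Lambda_{n,i}$. For $\sigma\in\Gamma$, $\mathcal J(\sigma)=\det(\partial\sigma(x_i)/\partial x_j)$ (entries are even, hence central), and the Jacobian group is $\Sigma=\{\sigma\in\Gamma\mid\mathcal J(\sigma)=1\}$. For $\alpha\in S'_{i,1}$, $j=j_i(\alpha)$ and $\lambda\in K$, $\rho_{i,j;\lambda x^\alpha}\in\Sigma$ is the automorphism $x_i\mapsto x_i(1+\lambda x^\alpha)$, $x_j\mapsto x_j(1-\lambda x^\alpha)$, $x_k\mapsto x_k$ for $k\ne i,j$. For $i'\notin\{j,k,l\}$,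 $\sigma_{i',\lambda x_jx_kx_l}\in\Sigma$ is the automorphism $x_{i'}\mapsto x_{i'}+\lambda x_jx_kx_l$, $x_m\mapsto x_m$ for $m\ne i'$. *)

theory Defs
  imports Complex_Main "HOL-Algebra.Generated_Groups" "HOL-Algebra.Bij" "HOL-Combinatorics.Permutations"
begin

section \<open>The Grassmann algebra\<close>

text \<open>
  An element of the type is a finitely supported family of coefficients, indexed by the finite sets
  of natural numbers; the coefficient at \<open>A = {i\<^sub>1 < \<dots> < i\<^sub>k}\<close> is that of
  \<open>x\<^sup>A = x\<^sub>i\<^sub>1 \<cdots> x\<^sub>i\<^sub>k\<close>.  The type has one generator for every natural number, and
  \<open>\<Lambda>\<^sub>n\<close> is the subalgebra of the elements supported on the subsets of \<open>{1..n}\<close>.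
\<close>

typedef (overloaded) 'k grassmann =
  "{f :: nat set \<Rightarrow> 'k::zero. finite {A. f A \<noteq> 0} \<and> (\<forall>A. f A \<noteq> 0 \<longrightarrow> finite A)}"
  morphisms coeff Abs_grassmann
  by (rule exI[of _ "\<lambda>_. 0"]) simp

setup_lifting type_definition_grassmann

lemma grassmann_eqI: "(\<And>A. coeff a A = coeff b A) \<Longrightarrow> a = b"
  by (simp add: coeff_inject[symmetric] ext)

lemma finite_supp: "finite {A. coeff a A \<noteq> 0}"
  using coeff[of a] unfolding mem_Collect_eq by (rule conjunct1)

lemma coeff_infinite: "infinite A \<Longrightarrow> coeff a A = 0"
  using coeff[of a] unfolding mem_Collect_eq by metis

lemma supportI:
  assumes "finite T" "\<And>A. A \<in> T \<Longrightarrow> finite A" "\<And>A. f A \<noteq> 0 \<Longrightarrow> A \<in> T"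
  shows "finite {A. f A \<noteq> 0} \<and> (\<forall>A. f A \<noteq> 0 \<longrightarrow> finite A)"
proof (intro conjI allI impI)
  have "{A. f A \<noteq> 0} \<subseteq> T" using assms(3) by blast
  then show "finite {A. f A \<noteq> 0}" using assms(1) by (rule finite_subset)
  show "finite A" if "f A \<noteq> 0" for A using assms(2)[OF assms(3)[OF that]] .
qed

instantiation grassmann :: (ab_group_add) ab_group_add
begin

lift_definition zero_grassmann :: "'a grassmann" is "\<lambda>_. 0" by simp

lift_definition plus_grassmann :: "'a grassmann \<Rightarrow> 'a grassmann \<Rightarrow> 'a grassmann"
  is "\<lambda>f g A. f A + g A"
proof -
  fix f g :: "nat set \<Rightarrow> 'a"
  assume f: "finite {A. f A \<noteq> 0} \<and> (\<forall>A. f A \<noteq> 0 \<longrightarrow> finite A)"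
    and g: "finite {A. g A \<noteq> 0} \<and> (\<forall>A. g A \<noteq> 0 \<longrightarrow> finite A)"
  show "finite {A. f A + g A \<noteq> 0} \<and> (\<forall>A. f A + g A \<noteq> 0 \<longrightarrow> finite A)"
  proof (rule supportI)
    show "finite ({A. f A \<noteq> 0} \<union> {A. g A \<noteq> 0})"
      using conjunct1[OF f] conjunct1[OF g] by (rule finite_UnI)
    show "finite A" if "A \<in> {A. f A \<noteq> 0} \<union> {A. g A \<noteq> 0}" for A
      using that conjunct2[OF f] conjunct2[OF g] by blast
    show "A \<in> {A. f A \<noteq> 0} \<union> {A. g A \<noteq> 0}" if "f A + g A \<noteq> 0" for A
      using that by (cases "f A = 0") simp_all
  qed
qed

lift_definition uminus_grassmann :: "'a grassmann \<Rightarrow> 'a grassmann" is "\<lambda>f A. - f A"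
  by (simp only: neg_equal_0_iff_equal) blast

definition minus_grassmann :: "'a grassmann \<Rightarrow> 'a grassmann \<Rightarrow> 'a grassmann"
  where "minus_grassmann a b = a + - b"

instance
proof
  fix a b c :: "'a grassmann"
  show "a + b + c = a + (b + c)" by transfer (simp add: add.assoc)
  show "a + b = b + a" by transfer (simp add: add.commute)
  show "0 + a = a" by transfer simp
  show "- a + a = 0" by transfer simp
  show "a - b = a + - b" by (rule minus_grassmann_def)
qed

end

lemma coeff_0 [simp]: "coeff 0 A = 0" by transfer simp
lemma coeff_add [simp]: "coeff (a + b) A = coeff a A + coeff b A" by transfer simp
lemma coeff_uminus [simp]: "coeff (- a) A = - coeff a A" by transfer simp
lemma coeff_diff [simp]: "coeff (a - b) A = coeff a A - coeff b A"
  by (simp only: minus_grassmann_def coeff_add coeff_uminus) simp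
lemma coeff_sum: "coeff (sum f S) A = (\<Sum>s\<in>S. coeff (f s) A)"
  by (induction S rule: infinite_finite_induct) auto

lift_definition gmono :: "'k::zero \<Rightarrow> nat set \<Rightarrow> 'k grassmann"
  is "\<lambda>c A B. if B = A \<and> finite A then c else 0"
proof -
  fix c :: 'k and A :: "nat set"
  show "finite {B. (if B = A \<and> finite A then c else 0) \<noteq> 0}
      \<and> (\<forall>B. (if B = A \<and> finite A then c else 0) \<noteq> 0 \<longrightarrow> finite B)"
    by (rule supportI[where T = "{A} \<inter> {A. finite A}"]) (auto split: if_splits)
qed

lemma coeff_gmono: "coeff (gmono c A) B = (if B = A \<and> finite A then c else 0)"
  by transfer simp

lift_definition gscale :: "'k::comm_ring_1 \<Rightarrow> 'k grassmann \<Rightarrow> 'k grassmann" (infixr "\<cdot>" 75)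
  is "\<lambda>c f A. c * f A"
proof -
  fix c :: 'k and f :: "nat set \<Rightarrow> 'k"
  assume f: "finite {A. f A \<noteq> 0} \<and> (\<forall>A. f A \<noteq> 0 \<longrightarrow> finite A)"
  show "finite {A. c * f A \<noteq> 0} \<and> (\<forall>A. c * f A \<noteq> 0 \<longrightarrow> finite A)"
  proof (rule supportI)
    show "finite {A. f A \<noteq> 0}" using f by (rule conjunct1)
    show "finite A" if "A \<in> {A. f A \<noteq> 0}" for A using that conjunct2[OF f] by blast
    show "A \<in> {A. f A \<noteq> 0}" if "c * f A \<noteq> 0" for A using that by (cases "f A = 0") simp_all
  qed
qed

lemma coeff_gscale [simp]: "coeff (c \<cdot> a) A = c * coeff a A" by transfer simp

text \<open>The sign of the reordering: \<open>x\<^sup>A x\<^sup>B = gsign A B x\<^sup>A\<^sup>\<union>\<^sup>B\<close> for disjoint \<open>A\<close>, \<open>B\<close>.\<close>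

definition gsign :: "nat set \<Rightarrow> nat set \<Rightarrow> 'k::comm_ring_1"
  where "gsign A B = (- 1) ^ card {(a, b) \<in> A \<times> B. b < a}"

instantiation grassmann :: (comm_ring_1) "{one, times}"
begin

definition one_grassmann :: "'a grassmann" where "one_grassmann = gmono 1 {}"

lift_definition times_grassmann :: "'a grassmann \<Rightarrow> 'a grassmann \<Rightarrow> 'a grassmann"
  is "\<lambda>f g C. \<Sum>A\<in>Pow C. gsign A (C - A) * f A * g (C - A)"
proof -
  fix f g :: "nat set \<Rightarrow> 'a"
  assume f: "finite {A. f A \<noteq> 0} \<and> (\<forall>A. f A \<noteq> 0 \<longrightarrow> finite A)"
    and g: "finite {A. g A \<noteq> 0} \<and> (\<forall>A. g A \<noteq> 0 \<longrightarrow> finite A)"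
  let ?h = "\<lambda>C. \<Sum>A\<in>Pow C. gsign A (C - A) * f A * g (C - A)"
  show "finite {C. ?h C \<noteq> 0} \<and> (\<forall>C. ?h C \<noteq> 0 \<longrightarrow> finite C)"
  proof (rule supportI)
    let ?T = "(\<lambda>p. fst p \<union> snd p) ` ({A. f A \<noteq> 0} \<times> {B. g B \<noteq> 0})"
    show "finite ?T" using conjunct1[OF f] conjunct1[OF g] by (intro finite_imageI finite_SigmaI)
    show "finite C" if C: "C \<in> ?T" for C
    proof -
      obtain p where p: "C = fst p \<union> snd p" "p \<in> {A. f A \<noteq> 0} \<times> {B. g B \<noteq> 0}"
        by (rule imageE[OF C])
      then have "f (fst p) \<noteq> 0" "g (snd p) \<noteq> 0" by (simp_all add: mem_Times_iff)
      then have "finite (fst p)" "finite (snd p)" using f g by simp_all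
      then show ?thesis unfolding p(1) by (rule finite_UnI)
    qed
    show "C \<in> ?T" if nz: "?h C \<noteq> 0" for C
    proof -
      obtain A where A: "A \<in> Pow C" "gsign A (C - A) * f A * g (C - A) \<noteq> 0"
        by (rule sum.not_neutral_contains_not_neutral[OF nz])
      from A(2) have "f A \<noteq> 0" by (rule contrapos_nn) simp
      moreover from A(2) have "g (C - A) \<noteq> 0" by (rule contrapos_nn) simp
      moreover have "C = A \<union> (C - A)" using A(1) by blast
      ultimately show ?thesis
        by (intro image_eqI[of C _ "(A, C - A)"]) (simp_all only: mem_Times_iff fst_conv snd_conv mem_Collect_eq simp_thms)
    qed
  qed
qed

instance ..

end

lemma coeff_times:
  "coeff (a * b) C = (\<Sum>A\<in>Pow C. gsign A (C - A) * coeff a A * coeff b (C - A))"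
  by transfer simp

lemma grassmann_expand:
  assumes "finite S" "{A. coeff a A \<noteq> 0} \<subseteq> S"
  shows "a = (\<Sum>A\<in>S. gmono (coeff a A) A)"
proof (rule grassmann_eqI)
  fix B
  have "coeff (\<Sum>A\<in>S. gmono (coeff a A) A) B = (\<Sum>A\<in>S. if A = B then coeff a B else 0)"
    unfolding coeff_sum by (intro sum.cong) (auto simp: coeff_gmono coeff_infinite)
  also have "\<dots> = coeff a B" using assms by (auto simp: sum.delta)
  finally show "coeff a B = coeff (\<Sum>A\<in>S. gmono (coeff a A) A) B" by simp
qed

lemma grassmann_induct:
  assumes "P 0" "\<And>c A. finite A \<Longrightarrow> P (gmono c A)" "\<And>a b. P a \<Longrightarrow> P b \<Longrightarrow> P (a + b)"
  shows "P a"
proof -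
  have "P (\<Sum>A\<in>S. gmono (coeff a A) A)" if "finite S" "\<And>A. A \<in> S \<Longrightarrow> finite A" for S
    using that by (induction S rule: finite_induct) (simp_all add: assms)
  moreover have "finite A" if "A \<in> {A. coeff a A \<noteq> 0}" for A using that coeff_infinite by blast
  ultimately have "P (\<Sum>A\<in>{A. coeff a A \<noteq> 0}. gmono (coeff a A) A)" using finite_supp by blast
  then show ?thesis by (simp only: grassmann_expand[OF finite_supp subset_refl, symmetric])
qed

lemma gmono_0 [simp]: "gmono 0 A = 0" by (rule grassmann_eqI) (simp add: coeff_gmono)

lemma gmono_times:
  assumes "finite A" "finite B"
  shows "gmono c A * gmono d B = (if A \<inter> B = {} then gmono (gsign A B * c * d) (A \<union> B) else 0)"
proof (rule grassmann_eqI)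
  fix C
  have "coeff (gmono c A * gmono d B) C
      = (\<Sum>A'\<in>Pow C. if A' = A then (if C - A = B then gsign A B * c * d else 0) else 0)"
    unfolding coeff_times by (intro sum.cong) (auto simp: coeff_gmono assms)
  also have "\<dots> = (if finite C \<and> A \<subseteq> C \<and> C - A = B then gsign A B * c * d else 0)"
    by (cases "finite C") (auto simp: sum.delta)
  also have "\<dots> = coeff (if A \<inter> B = {} then gmono (gsign A B * c * d) (A \<union> B) else 0) C"
    using assms by (auto simp: coeff_gmono)
  finally show "coeff (gmono c A * gmono d B) C
      = coeff (if A \<inter> B = {} then gmono (gsign A B * c * d) (A \<union> B) else 0) C" .
qed

lemma gsign_empty [simp]: "gsign {} B = 1" "gsign A {} = 1"
  by (simp_all add: gsign_def)

lemma gsign_union_left: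
  assumes "finite A" "finite B" "finite C" "A \<inter> B = {}"
  shows "gsign (A \<union> B) C = gsign A C * gsign B C"
proof -
  have "{(a, b) \<in> (A \<union> B) \<times> C. b < a} = {(a, b) \<in> A \<times> C. b < a} \<union> {(a, b) \<in> B \<times> C. b < a}"
    by auto
  moreover have "finite {(a, b) \<in> A \<times> C. b < a}" "finite {(a, b) \<in> B \<times> C. b < a}"
    using assms by (auto intro: finite_subset[of _ "A \<times> C"] finite_subset[of _ "B \<times> C"])
  moreover have "{(a, b) \<in> A \<times> C. b < a} \<inter> {(a, b) \<in> B \<times> C. b < a} = {}"
    using assms by auto
  ultimately show ?thesis by (simp add: gsign_def card_Un_disjoint power_add)
qed

lemma gsign_union_right:
  assumes "finite A" "finite B" "finite C" "B \<inter> C = {}"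
  shows "gsign A (B \<union> C) = gsign A B * gsign A C"
proof -
  have "{(a, b) \<in> A \<times> (B \<union> C). b < a} = {(a, b) \<in> A \<times> B. b < a} \<union> {(a, b) \<in> A \<times> C. b < a}"
    by auto
  moreover have "finite {(a, b) \<in> A \<times> B. b < a}" "finite {(a, b) \<in> A \<times> C. b < a}"
    using assms by (auto intro: finite_subset[of _ "A \<times> B"] finite_subset[of _ "A \<times> C"])
  moreover have "{(a, b) \<in> A \<times> B. b < a} \<inter> {(a, b) \<in> A \<times> C. b < a} = {}"
    using assms by auto
  ultimately show ?thesis by (simp add: gsign_def card_Un_disjoint power_add)
qed

lemma gsign_commute:
  assumes "finite A" "finite B" "A \<inter> B = {}"
  shows "gsign A B * gsign B A = (- 1) ^ (card A * card B)"
proof -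
  have "card {(b, a) \<in> B \<times> A. a < b} = card (prod.swap ` {(b, a) \<in> B \<times> A. a < b})"
    by (rule card_image[symmetric]) simp
  also have "prod.swap ` {(b, a) \<in> B \<times> A. a < b} = {(a, b) \<in> A \<times> B. a < b}"
    by force
  finally have "card {(b, a) \<in> B \<times> A. a < b} = card {(a, b) \<in> A \<times> B. a < b}" .
  note swap = this
  have un: "A \<times> B = {(a, b) \<in> A \<times> B. b < a} \<union> {(a, b) \<in> A \<times> B. a < b}"
    using assms(3) by (auto simp: set_eq_iff) (metis linorder_neqE_nat)
  have "card A * card B = card (A \<times> B)" by (rule card_cartesian_product[symmetric])
  also have "\<dots> = card ({(a, b) \<in> A \<times> B. b < a} \<union> {(a, b) \<in> A \<times> B. a < b})" by (rule arg_cong[OF un])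
  also have "\<dots> = card {(a, b) \<in> A \<times> B. b < a} + card {(a, b) \<in> A \<times> B. a < b}"
    using assms by (intro card_Un_disjoint) (auto intro: finite_subset[of _ "A \<times> B"])
  finally show ?thesis by (simp only: gsign_def swap power_add)
qed

instance grassmann :: (comm_ring_1) ring_1
proof
  fix a b c :: "'a grassmann"
  have dl: "(a + b) * c = a * c + b * c" for a b c :: "'a grassmann"
    by (rule grassmann_eqI) (simp add: coeff_times algebra_simps sum.distrib)
  have dr: "a * (b + c) = a * b + a * c" for a b c :: "'a grassmann"
    by (rule grassmann_eqI) (simp add: coeff_times algebra_simps sum.distrib)
  have z: "0 * a = 0" "a * 0 = 0" for a :: "'a grassmann"
    by (rule grassmann_eqI, simp add: coeff_times)+
  have m: "gmono p A * gmono q B * gmono r C = gmono p A * (gmono q B * gmono r C)"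
    if "finite A" "finite B" "finite C" for p q r :: 'a and A B C
    using that
    by (auto simp: gmono_times z gsign_union_left gsign_union_right Int_Un_distrib Int_Un_distrib2
        Un_assoc mult_ac)
  have 1: "gmono p A * gmono q B * c = gmono p A * (gmono q B * c)"
    if "finite A" "finite B" for p q :: 'a and A B c
    using that by (induction c rule: grassmann_induct) (auto simp: z dr m)
  have 2: "gmono p A * b * c = gmono p A * (b * c)"
    if "finite A" for p :: 'a and A b c
    using that by (induction b rule: grassmann_induct) (auto simp: z dr dl 1)
  show "a * b * c = a * (b * c)"
    by (induction a rule: grassmann_induct) (auto simp: z dl 2)
  show "(a + b) * c = a * c + b * c" by (rule dl)
  show "a * (b + c) = a * b + a * c" by (rule dr)
  show "1 * a = a"
    by (induction a rule: grassmann_induct) (auto simp: one_grassmann_def z dr gmono_times)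
  show "a * 1 = a"
    by (induction a rule: grassmann_induct) (auto simp: one_grassmann_def z dl gmono_times)
  show "(0::'a grassmann) \<noteq> 1"
    by (metis coeff_0 coeff_gmono finite.emptyI one_grassmann_def zero_neq_one)
qed

lemma gscale_mult_left: "(c \<cdot> a) * b = c \<cdot> (a * b)"
  by (rule grassmann_eqI) (simp add: coeff_times sum_distrib_left mult_ac)

lemma gscale_mult_right: "a * (c \<cdot> b) = c \<cdot> (a * b)"
  by (rule grassmann_eqI) (simp add: coeff_times sum_distrib_left mult_ac)

global_interpretation grassmann: module "gscale :: 'k::comm_ring_1 \<Rightarrow> _"
  by unfold_locales (rule grassmann_eqI, simp add: algebra_simps)+

definition gvar :: "nat \<Rightarrow> 'k::comm_ring_1 grassmann"
  where "gvar i = gmono 1 {i}"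

lemma gvar_square: "gvar i * gvar i = 0"
  by (simp add: gvar_def gmono_times)

lemma gvar_anticommute: "i \<noteq> j \<Longrightarrow> gvar i * gvar j = - (gvar j * gvar i :: 'k::comm_ring_1 grassmann)"
proof (rule grassmann_eqI)
  fix A assume "i \<noteq> j"
  then have "(gsign {i} {j} :: 'k) = - gsign {j} {i}"
    by (cases "i < j") (auto simp: gsign_def Collect_conv_if cong: conj_cong)
  with \<open>i \<noteq> j\<close> show "coeff (gvar i * gvar j) A = coeff (- (gvar j * gvar i) :: 'k grassmann) A"
    by (auto simp: gvar_def gmono_times coeff_gmono)
qed

definition xpow :: "nat set \<Rightarrow> 'k::comm_ring_1 grassmann"
  where "xpow \<alpha> = prod_list (map gvar (sorted_list_of_set \<alpha>))"

lemma xpow_eq: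
  "finite A \<Longrightarrow> xpow A = (gmono 1 A :: 'k::comm_ring_1 grassmann)"
proof -
  have "prod_list (map gvar xs) = gmono (1 :: 'k) (set xs)" if "sorted xs" "distinct xs" for xs
    using that
  proof (induction xs)
    case Nil
    then show ?case by (simp add: one_grassmann_def)
  next
    case (Cons y ys)
    then have "{(a, b) \<in> {y} \<times> set ys. b < a} = {}" by force
    then have "(gsign {y} (set ys) :: 'k) = 1" unfolding gsign_def by (metis card.empty power_0)
    with Cons show ?case by (simp add: gvar_def gmono_times)
  qed
  from this[of "sorted_list_of_set A"] show "finite A \<Longrightarrow> xpow A = (gmono 1 A :: 'k grassmann)"
    by (simp add: xpow_def)
qed

definition Lambda :: "nat \<Rightarrow> 'k::comm_ring_1 grassmann set"
  where "Lambda n = {a. \<forall>A. coeff a A \<noteq> 0 \<longrightarrow> A \<subseteq> {1..n}}"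

definition Lambda_deg :: "nat \<Rightarrow> nat \<Rightarrow> 'k::comm_ring_1 grassmann set"
  where "Lambda_deg n d = {a \<in> Lambda n. \<forall>A. coeff a A \<noteq> 0 \<longrightarrow> card A = d}"

definition Lambda_odd :: "nat \<Rightarrow> 'k::comm_ring_1 grassmann set"
  where "Lambda_odd n = {a \<in> Lambda n. \<forall>A. coeff a A \<noteq> 0 \<longrightarrow> odd (card A)}"

definition Lambda_even :: "nat \<Rightarrow> 'k::comm_ring_1 grassmann set"
  where "Lambda_even n = {a \<in> Lambda n. \<forall>A. coeff a A \<noteq> 0 \<longrightarrow> even (card A)}"

definition aug_ideal :: "nat \<Rightarrow> 'k::comm_ring_1 grassmann set"
  where "aug_ideal n = {a \<in> Lambda n. \<forall>A. coeff a A \<noteq> 0 \<longrightarrow> card A \<ge> 1}"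

definition aug_ideal_cubed :: "nat \<Rightarrow> 'k::comm_ring_1 grassmann set"
  where "aug_ideal_cubed n =
    grassmann.span {a * b * c | a b c. a \<in> aug_ideal n \<and> b \<in> aug_ideal n \<and> c \<in> aug_ideal n}"

lemma Lambda_expand:
  assumes "a \<in> Lambda n"
  shows "a = (\<Sum>A\<in>Pow {1..n}. coeff a A \<cdot> xpow A)"
proof -
  have "a = (\<Sum>A\<in>Pow {1..n}. gmono (coeff a A) A)"
    using assms by (intro grassmann_expand) (auto simp: Lambda_def)
  also have "\<dots> = (\<Sum>A\<in>Pow {1..n}. coeff a A \<cdot> xpow A)"
    by (intro sum.cong refl grassmann_eqI)
      (auto simp: xpow_eq coeff_gmono finite_subset[of _ "{1..n}"])
  finally show ?thesis .
qed

lemma Lambda_even_central: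
  assumes "a \<in> Lambda_even n"
  shows "a * b = b * a"
proof -
  have m: "gmono c A * gmono d B = gmono d B * gmono c A"
    if "finite A" "finite B" "even (card A)" for c d :: 'a and A B
  proof (cases "A \<inter> B = {}")
    case True
    have sq: "gsign A B * gsign A B = (1::'a)" by (simp add: gsign_def flip: power_add)
    have "gsign A B * gsign B A = (1::'a)" using gsign_commute[OF that(1,2) True] that(3) by simp
    then have "(gsign A B :: 'a) = gsign B A" using sq by (metis mult.assoc mult.right_neutral mult.left_neutral)
    with True that show ?thesis by (simp add: gmono_times Int_commute Un_commute mult_ac)
  qed (use that in \<open>simp add: gmono_times Int_commute\<close>)
  have "gmono c A * b = b * gmono c A" if "finite A" "even (card A)" for c and A
    using that by (induction b rule: grassmann_induct) (auto simp: m algebra_simps)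
  then have "gmono (coeff a A) A * b = b * gmono (coeff a A) A" for A
    using assms by (cases "coeff a A = 0") (auto simp: Lambda_even_def dest: coeff_infinite)
  then have "(\<Sum>A\<in>{A. coeff a A \<noteq> 0}. gmono (coeff a A) A) * b
      = b * (\<Sum>A\<in>{A. coeff a A \<noteq> 0}. gmono (coeff a A) A)"
    by (simp add: sum_distrib_left sum_distrib_right)
  then show ?thesis
    using grassmann_expand[OF finite_supp subset_refl, of a] by simp
qed

section \<open>Left skew derivations\<close>

definition left_skew_derivation ::
    "nat \<Rightarrow> nat \<Rightarrow> ('k::comm_ring_1 grassmann \<Rightarrow> 'k grassmann) \<Rightarrow> bool"
  where "left_skew_derivation n j d \<longleftrightarrow>
    d \<in> Lambda n \<rightarrow>\<^sub>E Lambda n \<and>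
    (\<forall>a\<in>Lambda n. \<forall>b\<in>Lambda n. d (a + b) = d a + d b) \<and>
    (\<forall>c. \<forall>a\<in>Lambda n. d (c \<cdot> a) = c \<cdot> d a) \<and>
    (\<forall>k\<in>{1..n}. d (gvar k) = (if k = j then 1 else 0)) \<and>
    (\<forall>i. \<forall>a\<in>Lambda_deg n i. \<forall>b\<in>Lambda n. d (a * b) = d a * b + (- 1) ^ i * (a * d b))"

text \<open>Existence and uniqueness are shown in \<open>partial_unique\<close> below.\<close>

definition partial :: "nat \<Rightarrow> nat \<Rightarrow> 'k::comm_ring_1 grassmann \<Rightarrow> 'k grassmann"
  where "partial n j = (THE d. left_skew_derivation n j d)"

lemma Lambda_add: "a \<in> Lambda n \<Longrightarrow> b \<in> Lambda n \<Longrightarrow> a + b \<in> Lambda n"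
  unfolding Lambda_def mem_Collect_eq coeff_add by (metis add.right_neutral)

lemma Lambda_scale: "a \<in> Lambda n \<Longrightarrow> c \<cdot> a \<in> Lambda n"
  by (force simp: Lambda_def)

lemma Lambda_mult: 
  assumes "a \<in> Lambda n" "b \<in> Lambda n" shows "a * b \<in> Lambda n"
proof -
  have "C \<subseteq> {1..n}" if nz: "coeff (a * b) C \<noteq> 0" for C
  proof -
    obtain A where "A \<in> Pow C" "gsign A (C - A) * coeff a A * coeff b (C - A) \<noteq> 0"
      by (rule sum.not_neutral_contains_not_neutral[OF nz[unfolded coeff_times]])
    then have "coeff a A \<noteq> 0" "coeff b (C - A) \<noteq> 0" by auto
    then have "A \<subseteq> {1..n}" "C - A \<subseteq> {1..n}"
      using assms unfolding Lambda_def by simp_all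
    then show ?thesis by blast
  qed
  then show ?thesis by (simp add: Lambda_def)
qed

lemma Lambda_0: "0 \<in> Lambda n" by (simp add: Lambda_def)

lemma Lambda_gmono: "A \<subseteq> {1..n} \<Longrightarrow> gmono c A \<in> Lambda n"
  by (auto simp: Lambda_def coeff_gmono split: if_splits)

lemma Lambda_1: "1 \<in> Lambda n" by (simp add: one_grassmann_def Lambda_gmono)

lemma Lambda_gvar: "k \<in> {1..n} \<Longrightarrow> gvar k \<in> Lambda n" by (simp add: gvar_def Lambda_gmono)

lemma Lambda_induct [consumes 1, case_names zero mono add]:
  assumes "a \<in> Lambda n" "P 0" "\<And>c A. A \<subseteq> {1..n} \<Longrightarrow> coeff a A = c \<Longrightarrow> c \<noteq> 0 \<Longrightarrow> P (gmono c A)"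
    "\<And>a b. a \<in> Lambda n \<Longrightarrow> b \<in> Lambda n \<Longrightarrow> P a \<Longrightarrow> P b \<Longrightarrow> P (a + b)"
  shows "P a"
proof -
  let ?f = "\<lambda>A. gmono (coeff a A) A"
  have "P (sum ?f S) \<and> sum ?f S \<in> Lambda n" if "finite S" "S \<subseteq> {A. coeff a A \<noteq> 0}" for S
    using that
  proof (induction S rule: finite_induct)
    case empty
    then show ?case using assms(2) by (simp add: Lambda_0)
  next
    case (insert A S)
    then have A: "A \<subseteq> {1..n}" using assms(1) by (auto simp: Lambda_def)
    then have "P (?f A)" using insert.prems by (intro assms(3)) auto
    then show ?case using insert A by (simp add: assms(4) Lambda_add Lambda_gmono)
  qed
  then have "P (sum ?f {A. coeff a A \<noteq> 0})" using finite_supp by blast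
  then show ?thesis by (simp only: grassmann_expand[OF finite_supp subset_refl, symmetric])
qed

lift_definition pd :: "nat \<Rightarrow> 'k::comm_ring_1 grassmann \<Rightarrow> 'k grassmann"
  is "\<lambda>j f B. if j \<in> B then 0 else gsign {j} B * f (insert j B)"
proof -
  fix j and f :: "nat set \<Rightarrow> 'k"
  assume f: "finite {A. f A \<noteq> 0} \<and> (\<forall>A. f A \<noteq> 0 \<longrightarrow> finite A)"
  let ?h = "\<lambda>B. if j \<in> B then 0 else gsign {j} B * f (insert j B)"
  show "finite {B. ?h B \<noteq> 0} \<and> (\<forall>B. ?h B \<noteq> 0 \<longrightarrow> finite B)"
  proof (rule supportI)
    let ?T = "(\<lambda>A. A - {j}) ` {A. f A \<noteq> 0}"
    show "finite ?T" using conjunct1[OF f] by (rule finite_imageI)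
    show "finite B" if B: "B \<in> ?T" for B
    proof -
      obtain A where A: "B = A - {j}" "A \<in> {A. f A \<noteq> 0}" by (rule imageE[OF B])
      then have "finite A" using f by simp
      then show ?thesis unfolding A(1) by (rule finite_Diff)
    qed
    show "B \<in> ?T" if nz: "?h B \<noteq> 0" for B
    proof -
      have "j \<notin> B" using nz by (rule contrapos_nn) simp
      have "f (insert j B) \<noteq> 0" using nz by (rule contrapos_nn) simp
      with \<open>j \<notin> B\<close> show ?thesis by (intro image_eqI[of _ _ "insert j B"]) simp_all
    qed
  qed
qed

lemma coeff_pd: "coeff (pd j a) B = (if j \<in> B then 0 else gsign {j} B * coeff a (insert j B))"
  by transfer simp

lemma pd_add: "pd j (a + b) = pd j a + pd j b"
  by (rule grassmann_eqI) (simp add: coeff_pd algebra_simps)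

lemma pd_scale: "pd j (c \<cdot> a) = c \<cdot> pd j a"
  by (rule grassmann_eqI) (simp add: coeff_pd algebra_simps)

lemma pd_0: "pd j 0 = 0"
  by (rule grassmann_eqI) (simp add: coeff_pd)

lemma pd_Lambda:
  assumes "a \<in> Lambda n"
  shows "pd j a \<in> Lambda n"
proof -
  have "B \<subseteq> {1..n}" if nz: "coeff (pd j a) B \<noteq> 0" for B
  proof -
    have "coeff a (insert j B) \<noteq> 0" using nz by (rule contrapos_nn) (simp add: coeff_pd)
    then have "insert j B \<subseteq> {1..n}" using assms unfolding Lambda_def by blast
    then show ?thesis by simp
  qed
  then show ?thesis by (simp add: Lambda_def)
qed

lemma pd_gmono:
  "finite A \<Longrightarrow> pd j (gmono c A) = (if j \<in> A then gmono (gsign {j} (A - {j}) * c) (A - {j}) else 0)"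
proof (rule grassmann_eqI)
  fix B assume A: "finite A"
  show "coeff (pd j (gmono c A)) B
      = coeff (if j \<in> A then gmono (gsign {j} (A - {j}) * c) (A - {j}) else 0) B"
  proof (cases "j \<in> B")
    case True
    then have "B \<noteq> A - {j}" by blast
    with True show ?thesis by (simp add: coeff_pd coeff_gmono)
  next
    case False
    then have "insert j B = A \<longleftrightarrow> j \<in> A \<and> B = A - {j}" by blast
    with False A show ?thesis by (simp add: coeff_pd coeff_gmono)
  qed
qed

lemma gmono_add: "gmono (c + d) A = gmono c A + gmono d A"
  by (rule grassmann_eqI) (simp add: coeff_gmono)

lemma sgn_gmono: "(- 1) ^ i * gmono c A = gmono ((- 1) ^ i * c) A"
proof -
  have "- gmono c A = gmono (- c) A" by (rule grassmann_eqI) (simp add: coeff_gmono)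
  then show ?thesis by (cases "even i") simp_all
qed

lemma pd_gmono_times:
  fixes c d :: "'k::comm_ring_1"
  assumes "finite A" "finite B"
  shows "pd j (gmono c A * gmono d B)
    = pd j (gmono c A) * gmono d B + (- 1) ^ card A * (gmono c A * pd j (gmono d B))"
proof -
  define A' where "A' = A - {j}"
  define B' where "B' = B - {j}"
  have fin: "finite A'" "finite B'" and nin: "j \<notin> A'" "j \<notin> B'"
    using assms by (auto simp: A'_def B'_def)
  define a :: 'k where "a = gsign {j} A'"
  define b :: 'k where "b = gsign {j} B'"
  define g :: 'k where "g = gsign A' B'"
  define m :: 'k where "m = (- 1) ^ card A'"
  have sq: "a * a = 1" "b * b = 1" by (simp_all add: a_def b_def gsign_def flip: power_add)
  have sq': "a * (a * z) = z" "b * (b * z) = z" for z using sq by (simp_all flip: mult.assoc)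
  have "gsign A' {j} * a = m"
    unfolding a_def m_def using gsign_commute[of A' "{j}"] fin nin by simp
  then have h: "gsign A' {j} = m * a" using sq(1) by (metis mult.assoc mult.right_neutral)
  have l: "gsign (insert j A') B' = b * g"
    unfolding b_def g_def using gsign_union_left[of "{j}" A' B'] fin nin by simp
  have r: "gsign A' (insert j B') = m * a * g"
    unfolding g_def h[symmetric] using gsign_union_right[of A' "{j}" B'] fin nin by simp
  have u: "gsign {j} (A' \<union> B') = a * b" if "A' \<inter> B' = {}"
    unfolding a_def b_def using gsign_union_right[of "{j}" A' B'] fin that by simp
  have A: "A = (if j \<in> A then insert j A' else A')" and B: "B = (if j \<in> B then insert j B' else B')"
    by (auto simp: A'_def B'_def)
  have m: "(- 1) ^ card A' * gmono z C = gmono (m * z) C" for z C by (simp add: m_def sgn_gmono)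
  have pA: "pd j (gmono z (insert j A')) = gmono (a * z) A'" "pd j (gmono z A') = 0" for z
    using fin nin by (simp_all add: pd_gmono a_def)
  have pB: "pd j (gmono z (insert j B')) = gmono (b * z) B'" "pd j (gmono z B') = 0" for z
    using fin nin by (simp_all add: pd_gmono b_def)
  have pU: "pd j (gmono z (insert j (A' \<union> B'))) = gmono (a * b * z) (A' \<union> B')"
      "pd j (gmono z (A' \<union> B')) = 0" if "A' \<inter> B' = {}" for z
    using fin nin u[OF that] by (simp_all add: pd_gmono)
  have g: "gsign A' B' = g" by (simp add: g_def)
  show ?thesis
  proof (cases "A' \<inter> B' = {}")
    case True
    note pU = pU[OF True]
    show ?thesis
      by (subst (1 2 3 4) A, subst (1 2 3) B)
        (simp add: fin nin True gmono_times pA pB pU pd_0 l r m g sq' mult_ac flip: gmono_add)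
  next
    case False
    then show ?thesis
      by (subst (1 2 3 4) A, subst (1 2 3) B) (simp add: fin nin gmono_times pA pB pd_0)
  qed
qed

lemma left_skew_derivation_pd:
  "left_skew_derivation n j (\<lambda>a\<in>Lambda n. pd j a :: 'k::comm_ring_1 grassmann)"
proof -
  have 1: "pd j (gmono c A * b) = pd j (gmono c A) * b + (- 1) ^ card A * (gmono c A * pd j b)"
    if "finite A" for c :: 'k and A b
    using that by (induction b rule: grassmann_induct) (auto simp: pd_0 pd_add pd_gmono_times algebra_simps)
  have 2: "pd j (a * b) = pd j a * b + (- 1) ^ i * (a * pd j b)" if "a \<in> Lambda_deg n i"
    for i and a b :: "'k grassmann"
  proof -
    have a: "a \<in> Lambda n" and deg: "\<And>A. coeff a A \<noteq> 0 \<Longrightarrow> card A = i"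
      using that by (auto simp: Lambda_deg_def)
    from a show ?thesis
    proof (induction rule: Lambda_induct)
      case (mono c A)
      then have "finite A" "card A = i" using deg by (auto intro: finite_subset)
      then show ?case using 1[of A] by simp
    qed (auto simp: pd_0 pd_add algebra_simps)
  qed
  show ?thesis
    unfolding left_skew_derivation_def
    by (auto simp: pd_Lambda Lambda_add Lambda_scale Lambda_gvar Lambda_mult Lambda_deg_def pd_add pd_scale
        2[unfolded Lambda_deg_def]) (auto simp: gvar_def pd_gmono one_grassmann_def)
qed

lemma left_skew_derivation_unique:
  fixes d e :: "'k::comm_ring_1 grassmann \<Rightarrow> 'k grassmann"
  assumes "left_skew_derivation n j d" "left_skew_derivation n j e"
  shows "d = e"
proof (rule ext)
  fix a :: "'k grassmann"
  note D = assms[unfolded left_skew_derivation_def]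
  have one: "1 \<in> Lambda_deg n 0" 
    using Lambda_1 by (auto simp: Lambda_deg_def one_grassmann_def coeff_gmono)
  have lin1: "d (1 * 1) = d 1 * 1 + (- 1) ^ 0 * (1 * d 1)" "e (1 * 1) = e 1 * 1 + (- 1) ^ 0 * (1 * e 1)"
    using D one Lambda_1 by blast+
  then have d1: "d 1 = 0" "e 1 = 0" by simp_all
  have gd: "gvar k \<in> Lambda_deg n 1" if "k \<in> {1..n}" for k
    using that by (auto simp: Lambda_deg_def Lambda_gvar) (auto simp: gvar_def coeff_gmono split: if_splits)
  have mon: "(prod_list (map gvar xs) :: 'k grassmann) \<in> Lambda n \<and> d (prod_list (map gvar xs)) = e (prod_list (map gvar xs))"
    if "set xs \<subseteq> {1..n}" for xs
    using that
  proof (induction xs)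
    case Nil
    then show ?case by (simp add: d1 Lambda_1)
  next
    case (Cons k xs)
    then have k: "k \<in> {1..n}" and L: "(prod_list (map gvar xs) :: 'k grassmann) \<in> Lambda n" by auto
    have "d (gvar k * b) = d (gvar k) * b + (- 1) ^ 1 * (gvar k * d b)"
      "e (gvar k * b) = e (gvar k) * b + (- 1) ^ 1 * (gvar k * e b)"
      "d (gvar k) = e (gvar k)" if "b \<in> Lambda n" for b
      using that D gd[OF k] k by metis+
    then show ?case using Cons k L by (simp add: Lambda_mult Lambda_gvar)
  qed
  show "d a = e a"
  proof (cases "a \<in> Lambda n")
    case True
    then show ?thesis
    proof (induction rule: Lambda_induct)
      case zero
      have "d (0 \<cdot> 0) = 0 \<cdot> d 0" "e (0 \<cdot> 0) = 0 \<cdot> e 0" using D Lambda_0 by blast+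
      then show ?case by simp
    next
      case (mono c A)
      then have fA: "finite A" using finite_subset by blast
      have "gmono c A = c \<cdot> xpow A" 
        by (rule grassmann_eqI) (simp add: xpow_eq[OF fA] coeff_gmono)
      moreover have "d (xpow A) = e (xpow A)" "(xpow A :: 'k grassmann) \<in> Lambda n"
        using mon[of "sorted_list_of_set A"] mono fA by (auto simp: xpow_def)
      ultimately show ?case using D by metis
    next
      case (add a b)
      then show ?case using D by metis
    qed
  next
    case False
    then show ?thesis using D by (metis PiE_arb)
  qed
qed

lemma partial_unique: "left_skew_derivation n j d \<longleftrightarrow> d = partial n j"
  using theI'[of "left_skew_derivation n j"] left_skew_derivation_pd left_skew_derivation_unique
  unfolding partial_def by metis

lemma partial_eq: "a \<in> Lambda n \<Longrightarrow> partial n j a = pd j a"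
  using partial_unique[of n j "\<lambda>a\<in>Lambda n. pd j a"] left_skew_derivation_pd[of n j]
  by (metis restrict_apply')

section \<open>The Jacobian group\<close>

text \<open>
  Group elements are bijections of \<open>\<Lambda>\<^sub>n\<close> that are \<open>undefined\<close> off \<open>\<Lambda>\<^sub>n\<close>, so that they form
  the group \<open>BijGroup (Lambda n)\<close> under composition.
\<close>

type_synonym 'k gmap = "'k grassmann \<Rightarrow> 'k grassmann"

definition algebra_aut :: "nat \<Rightarrow> 'k::comm_ring_1 gmap set"
  where "algebra_aut n = {s \<in> Bij (Lambda n).
    s 1 = 1 \<and>
    (\<forall>a\<in>Lambda n. \<forall>b\<in>Lambda n. s (a + b) = s a + s b \<and> s (a * b) = s a * s b) \<and>
    (\<forall>c. \<forall>a\<in>Lambda n. s (c \<cdot> a) = c \<cdot> s a)}"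

definition Gamma_group :: "nat \<Rightarrow> 'k::comm_ring_1 gmap set"
  where "Gamma_group n = {s \<in> algebra_aut n.
    \<forall>i\<in>{1..n}. s (gvar i) - gvar i \<in> Lambda_odd n \<inter> aug_ideal_cubed n}"

text \<open>
  The Leibniz formula, with the factors of each summand in the order of the rows.  It is applied
  only to matrices with even entries, which commute by \<open>Lambda_even_central\<close>.
\<close>

definition gdet :: "nat \<Rightarrow> (nat \<Rightarrow> nat \<Rightarrow> 'k::comm_ring_1 grassmann) \<Rightarrow> 'k grassmann"
  where "gdet n M =
    (\<Sum>p | p permutes {1..n}. of_int (sign p) * prod_list (map (\<lambda>i. M i (p i)) [1..<Suc n]))"

definition jacobian :: "nat \<Rightarrow> 'k::comm_ring_1 gmap \<Rightarrow> 'k grassmann"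
  where "jacobian n s = gdet n (\<lambda>i j. partial n j (s (gvar i)))"

definition Sigma_group :: "nat \<Rightarrow> 'k::comm_ring_1 gmap set"
  where "Sigma_group n = {s \<in> Gamma_group n. jacobian n s = 1}"

definition aut_of :: "nat \<Rightarrow> (nat \<Rightarrow> 'k::comm_ring_1 grassmann) \<Rightarrow> 'k gmap"
  where "aut_of n y = (THE s. s \<in> algebra_aut n \<and> (\<forall>k\<in>{1..n}. s (gvar k) = y k))"

lemma aut_of_eq:
  fixes s :: "'k::comm_ring_1 gmap"
  assumes "s \<in> algebra_aut n" "\<And>k. k \<in> {1..n} \<Longrightarrow> s (gvar k) = y k"
  shows "aut_of n y = s"
  unfolding aut_of_def
proof (rule the_equality)
  fix t :: "'k gmap" assume t: "t \<in> algebra_aut n \<and> (\<forall>k\<in>{1..n}. t (gvar k) = y k)"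
  note S = assms(1)[unfolded algebra_aut_def] and T = conjunct1[OF t, unfolded algebra_aut_def]
  have mon: "(prod_list (map gvar xs) :: 'k grassmann) \<in> Lambda n \<and> s (prod_list (map gvar xs)) = t (prod_list (map gvar xs))"
    if "set xs \<subseteq> {1..n}" for xs
    using that
  proof (induction xs)
    case Nil
    then show ?case using S T by (simp add: Lambda_1)
  next
    case (Cons k xs)
    then have "(gvar k :: 'k grassmann) \<in> Lambda n" "s (gvar k) = t (gvar k)"
      using t assms(2) by (simp_all add: Lambda_gvar)
    moreover have "(prod_list (map gvar xs) :: 'k grassmann) \<in> Lambda n"
        "s (prod_list (map gvar xs)) = t (prod_list (map gvar xs))"
      using Cons by simp_all
    moreover have "s (a * b) = s a * s b" "t (a * b) = t a * t b" if "a \<in> Lambda n" "b \<in> Lambda n" for a b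
      using S T that by blast+
    ultimately show ?case by (simp add: Lambda_mult)
  qed
  show "t = s"
  proof (rule ext)
    fix a
    show "t a = s a"
    proof (cases "a \<in> Lambda n")
      case True
      then show ?thesis
      proof (induction rule: Lambda_induct)
        case zero
        have "s (0 \<cdot> 0) = 0 \<cdot> s 0" "t (0 \<cdot> 0) = 0 \<cdot> t 0" using S T Lambda_0 by blast+
        then show ?case by simp
      next
        case (mono c A)
        then have fA: "finite A" using finite_subset by blast
        have "gmono c A = c \<cdot> xpow A"
          by (rule grassmann_eqI) (simp add: xpow_eq[OF fA] coeff_gmono)
        moreover have "s (xpow A) = t (xpow A)" "(xpow A :: 'k grassmann) \<in> Lambda n"
          using mon[of "sorted_list_of_set A"] mono fA by (auto simp: xpow_def)
        ultimately show ?case using S T by auto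
      next
        case (add a b)
        then show ?case using S T by auto
      qed
    next
      case False
      then show ?thesis using S T by (auto simp: Bij_def extensional_def)
    qed
  qed
qed (use assms in auto)

definition rho :: "nat \<Rightarrow> nat \<Rightarrow> nat \<Rightarrow> 'k::comm_ring_1 grassmann \<Rightarrow> 'k gmap"
  where "rho n i j u = aut_of n
    (\<lambda>k. if k = i then gvar i * (1 + u) else if k = j then gvar j * (1 - u) else gvar k)"

definition sigma :: "nat \<Rightarrow> nat \<Rightarrow> 'k::comm_ring_1 grassmann \<Rightarrow> 'k gmap"
  where "sigma n i u = aut_of n (\<lambda>k. if k = i then gvar i + u else gvar k)"

definition S1' :: "nat \<Rightarrow> nat \<Rightarrow> nat set set"
  where "S1' n i = {\<alpha>. \<alpha> \<subseteq> {1..n} - {i} \<and> card \<alpha> = 2 \<and> \<not> {i + 1..n} \<subseteq> \<alpha>}"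

definition avoidance :: "nat \<Rightarrow> (nat \<Rightarrow> nat set \<Rightarrow> nat) \<Rightarrow> bool"
  where "avoidance n jf \<longleftrightarrow> (\<forall>i\<in>{1..n - 1}. \<forall>\<alpha>\<in>S1' n i. jf i \<alpha> \<in> {i + 1..n} - \<alpha>)"

definition rho_index :: "nat \<Rightarrow> (nat \<times> nat set) set"
  where "rho_index n = {(i, \<alpha>). i \<in> {1..n - 1} \<and> \<alpha> \<in> S1' n i}"

definition sigma_index :: "nat \<Rightarrow> (nat \<times> nat \<times> nat \<times> nat) set"
  where "sigma_index n = {(i, j, k, l). {i, j, k, l} \<subseteq> {1..n} \<and> j < k \<and> k < l \<and> i \<notin> {j, k, l}}"

fun rho_family :: "nat \<Rightarrow> (nat \<Rightarrow> nat set \<Rightarrow> nat) \<Rightarrow> nat \<times> nat set \<Rightarrow> 'k::comm_ring_1 \<Rightarrow> 'k gmap"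
  where "rho_family n jf (i, \<alpha>) c = rho n i (jf i \<alpha>) (c \<cdot> xpow \<alpha>)"

fun sigma_family :: "nat \<Rightarrow> nat \<times> nat \<times> nat \<times> nat \<Rightarrow> 'k::comm_ring_1 \<Rightarrow> 'k gmap"
  where "sigma_family n (i, j, k, l) c = sigma n i (c \<cdot> (gvar j * gvar k * gvar l))"

abbreviation rho_subgroup :: "nat \<Rightarrow> (nat \<Rightarrow> nat set \<Rightarrow> nat) \<Rightarrow> nat \<times> nat set \<Rightarrow> 'k::comm_ring_1 gmap set"
  where "rho_subgroup n jf p \<equiv> range (rho_family n jf p)"

abbreviation sigma_subgroup :: "nat \<Rightarrow> nat \<times> nat \<times> nat \<times> nat \<Rightarrow> 'k::comm_ring_1 gmap set"
  where "sigma_subgroup n q \<equiv> range (sigma_family n q)"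

definition additive_group :: "'k::ab_group_add monoid"
  where "additive_group = \<lparr>carrier = UNIV, monoid.mult = (+), one = 0\<rparr>"

definition one_parameter_subgroup :: "nat \<Rightarrow> ('k::comm_ring_1 \<Rightarrow> 'k gmap) \<Rightarrow> bool"
  where "one_parameter_subgroup n \<phi> \<longleftrightarrow>
    range \<phi> \<subseteq> Sigma_group n \<and> subgroup (range \<phi>) (BijGroup (Lambda n)) \<and>
    \<phi> \<in> iso additive_group (BijGroup (Lambda n)\<lparr>carrier := range \<phi>\<rparr>)"

end

theory Submission
  imports Defs
begin

text \<open>
  Filter \<open>\<Gamma>\<close> by the lowest degree \<open>d\<close> occurring in the \<open>\<sigma>(x\<^sub>i) - x\<^sub>i\<close>.  The coefficients of degree
  \<open>d\<close> are additive under composition, and to leading order \<open>\<J>(\<sigma>)\<close> is one plus their divergence; so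
  for \<open>\<sigma> \<in> \<Sigma>\<close> they are combinations of the leading terms of the \<open>x\<^sub>i \<mapsto> x\<^sub>i + \<lambda>x\<^sup>\<beta>\<close> with \<open>i \<notin> \<beta>\<close> and
  of the \<open>x\<^sub>p \<mapsto> x\<^sub>p(1 + \<lambda>x\<^sup>\<beta>)\<close>, \<open>x\<^sub>q \<mapsto> x\<^sub>q(1 - \<lambda>x\<^sup>\<beta>)\<close> with \<open>p, q \<notin> \<beta>\<close>.  These automorphisms are
  exact commutators of ones of lower degree, down to degree three: a spare index \<open>k \<notin> \<beta> \<union> {i}\<close> gives
  the first kind, and when there is none, \<open>n\<close> is even and the commutator carries the factor two that has to
  be inverted.  Multiplying by them clears the coefficients degree by degree.  In degree three the
  generators form a basis, triangular along the avoidance functions, so none can be dropped.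
\<close>

text \<open>The factor two arises because \<open>rho n p i u\<close> scales \<open>gvar p\<close> by
  \<open>1 + u\<close> and \<open>gvar i\<close> by \<open>1 - u\<close>: relative to
  \<open>gvar i\<close>, a term \<open>gvar p * w\<close> is scaled by
  \<open>(1 + u) / (1 - u) = 1 + 2 * u\<close>. It is met only if \<open>A = {1..n} - {i}\<close>,
  and \<open>odd (card A)\<close> then forces \<open>n\<close> even. The second kind never meets
  this obstacle, since \<open>p\<close> and \<open>q\<close> serve each other as spare index.
  Monomials of positive degree square to zero, so the commutators have no error terms. Clearing uses
  no division: coefficients are cancelled one at a time, and the vanishing divergence only has to
  produce a partner index, so zero divisors are harmless. For fixed \<open>\<alpha>\<close> the
  families \<open>rho\<close> form a graph: each index outside \<open>\<alpha>\<close> below the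
  largest one has a single edge, upwards to \<open>jf i \<alpha>\<close>. This is a tree.
  Differences along its edges generate all differences; deleting the edge at \<open>i\<close>
  separates the indices leading to \<open>i\<close> from the rest, and the signed sum of the
  coefficients over that side is an additive function that sees only the deleted family.\<close>

declare One_nat_def [simp del]

section \<open>Elements with prescribed support\<close>

text \<open>Degree, parity and the variables that occur are all conditions on the support, so
  \<open>Lambda\<close>, \<open>gfilt\<close> and the subalgebras \<open>span_on S\<close> share one
  set of closure rules.\<close>

definition supported :: "(nat set \<Rightarrow> bool) \<Rightarrow> 'k::comm_ring_1 grassmann set"
  where "supported P = {a. \<forall>A. coeff a A \<noteq> 0 \<longrightarrow> P A}"

abbreviation span_on :: "nat set \<Rightarrow> 'k::comm_ring_1 grassmann set"
  where "span_on S \<equiv> supported (\<lambda>A. A \<subseteq> S)"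

lemma Lambda_supported: "Lambda n = span_on {1..n}"
  by (simp add: Lambda_def supported_def)

lemma supportedD: "a \<in> supported P \<Longrightarrow> coeff a A \<noteq> 0 \<Longrightarrow> P A"
  by (auto simp: supported_def)

lemma supported_0 [simp]: "0 \<in> supported P"
  by (simp add: supported_def)

lemma supported_add: "a \<in> supported P \<Longrightarrow> b \<in> supported P \<Longrightarrow> a + b \<in> supported P"
  unfolding supported_def mem_Collect_eq coeff_add by (metis add.right_neutral)

lemma supported_uminus: "a \<in> supported P \<Longrightarrow> - a \<in> supported P"
  by (auto simp: supported_def)

lemma supported_diff: "a \<in> supported P \<Longrightarrow> b \<in> supported P \<Longrightarrow> a - b \<in> supported P"
  using supported_add[of a P "- b"] supported_uminus[of b P] by simp

lemma supported_scale: "a \<in> supported P \<Longrightarrow> c \<cdot> a \<in> supported P"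
  by (force simp: supported_def)

lemma supported_sum: "(\<And>i. i \<in> I \<Longrightarrow> f i \<in> supported P) \<Longrightarrow> sum f I \<in> supported P"
  by (induction I rule: infinite_finite_induct) (auto simp: supported_add)

lemma supported_gmono: "P A \<Longrightarrow> gmono c A \<in> supported P"
  by (auto simp: supported_def coeff_gmono split: if_splits)

lemma supported_mono: "a \<in> supported P \<Longrightarrow> (\<And>A. finite A \<Longrightarrow> P A \<Longrightarrow> Q A) \<Longrightarrow> a \<in> supported Q"
  unfolding supported_def mem_Collect_eq by (metis coeff_infinite)

text \<open>Monomials with a common variable multiply to zero, so \<open>R\<close> is only required
  for disjoint unions; this is what lets cardinalities add.\<close>

lemma supported_mult:
  assumes "a \<in> supported P" "b \<in> supported Q"
    and "\<And>A B. P A \<Longrightarrow> Q B \<Longrightarrow> finite A \<Longrightarrow> finite B \<Longrightarrow> A \<inter> B = {} \<Longrightarrow> R (A \<union> B)"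
  shows "a * b \<in> supported R"
proof -
  have "R C" if nz: "coeff (a * b) C \<noteq> 0" for C
  proof -
    obtain A where A: "A \<in> Pow C" "gsign A (C - A) * coeff a A * coeff b (C - A) \<noteq> 0"
      by (rule sum.not_neutral_contains_not_neutral[OF nz[unfolded coeff_times]])
    then have nz: "coeff a A \<noteq> 0" "coeff b (C - A) \<noteq> 0" by auto
    then have "finite A" "finite (C - A)" using coeff_infinite by blast+
    moreover have "P A" "Q (C - A)" using assms(1,2) nz by (auto dest: supportedD)
    moreover have "A \<union> (C - A) = C" using A(1) by blast
    ultimately show ?thesis using assms(3)[of A "C - A"] by auto
  qed
  then show ?thesis by (simp add: supported_def)
qed

lemma supported_induct [consumes 1, case_names zero mono add]:
  assumes "a \<in> supported P" "Q 0" "\<And>c A. finite A \<Longrightarrow> P A \<Longrightarrow> Q (gmono c A)"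
    "\<And>a b. a \<in> supported P \<Longrightarrow> b \<in> supported P \<Longrightarrow> Q a \<Longrightarrow> Q b \<Longrightarrow> Q (a + b)"
  shows "Q a"
proof -
  let ?f = "\<lambda>A. gmono (coeff a A) A"
  have "Q (sum ?f S) \<and> sum ?f S \<in> supported P" if "finite S" "S \<subseteq> {A. coeff a A \<noteq> 0}" for S
    using that
  proof (induction S rule: finite_induct)
    case empty
    then show ?case using assms(2) by simp
  next
    case (insert A S)
    then have A: "P A" "finite A" using supportedD[OF assms(1), of A] coeff_infinite[of A a] by auto
    then have "Q (?f A)" using assms(3) by simp
    then show ?case using insert A by (simp add: assms(4) supported_add supported_gmono)
  qed
  then have "Q (sum ?f {A. coeff a A \<noteq> 0})" using finite_supp by blast
  then show ?thesis by (simp only: grassmann_expand[OF finite_supp subset_refl, symmetric])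
qed

lemma gscale_gmono [simp]: "c \<cdot> gmono d A = gmono (c * d) A"
  by (rule grassmann_eqI) (simp add: coeff_gmono)

lemma gscale_mult_right: "a * (c \<cdot> b) = c \<cdot> (a * b)"
  by (rule grassmann_eqI) (simp add: coeff_times sum_distrib_left mult_ac)

lemma gsign_square [simp]: "gsign A B * gsign A B = 1"
  by (simp add: gsign_def flip: power_add)

lemma gsign_square' [simp]: "gsign A B * (gsign A B * c) = c"
  by (simp flip: mult.assoc)

lemma gvar_times_gmono:
  "finite A \<Longrightarrow> gvar k * gmono c A = (if k \<in> A then 0 else gmono (gsign {k} A * c) (insert k A))"
  by (simp add: gvar_def gmono_times)

text \<open>Elements are built from \<open>1\<close> by left multiplication with generators, so
  multiplicativity and the chain rule are checked against a single odd factor at a time.\<close>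

lemma span_on_induct [consumes 1, case_names one mult scale add]:
  assumes "a \<in> span_on S" "P 1"
    and mult: "\<And>k b. k \<in> S \<Longrightarrow> b \<in> span_on S \<Longrightarrow> P b \<Longrightarrow> P (gvar k * b)"
    and scale: "\<And>c b. b \<in> span_on S \<Longrightarrow> P b \<Longrightarrow> P (c \<cdot> b)"
    and "\<And>a b. a \<in> span_on S \<Longrightarrow> b \<in> span_on S \<Longrightarrow> P a \<Longrightarrow> P b \<Longrightarrow> P (a + b)"
  shows "P a"
  using assms(1)
proof (induction rule: supported_induct)
  case zero
  have "P (0 \<cdot> 1)" by (rule scale) (use assms(2) in \<open>simp_all add: one_grassmann_def supported_gmono\<close>)
  then show ?case by simp
next
  case (mono c A)
  have "P (gmono 1 A) \<and> gmono 1 A \<in> (span_on S :: 'a grassmann set)"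
    using mono
  proof (induction A rule: finite_induct)
    case empty
    then show ?case using assms(2) by (simp add: one_grassmann_def supported_gmono)
  next
    case (insert k A)
    \<comment> \<open>Sorting \<open>k\<close> into the monomial costs \<open>gsign {k} A\<close>;
      the extra scalar cancels it, since signs square to one.\<close>
    then have "P (gsign {k} A \<cdot> (gvar k * gmono 1 A))"
      by (intro scale mult supported_mult[of _ "\<lambda>A. A \<subseteq> S" _ "\<lambda>A. A \<subseteq> S"])
        (auto simp: gvar_def supported_gmono)
    then show ?case using insert by (simp add: gvar_times_gmono supported_gmono)
  qed
  then have "P (c \<cdot> gmono 1 A)" by (intro scale) auto
  then show ?case by simp
next
  case (add a b)
  then show ?case using assms(5) by blast
qed

lemma Lambda_diff: "a \<in> Lambda n \<Longrightarrow> b \<in> Lambda n \<Longrightarrow> a - b \<in> Lambda n"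
  unfolding Lambda_supported by (rule supported_diff)

lemma Lambda_uminus: "a \<in> Lambda n \<Longrightarrow> - a \<in> Lambda n"
  unfolding Lambda_supported by (rule supported_uminus)

lemma Lambda_sum: "(\<And>i. i \<in> I \<Longrightarrow> f i \<in> Lambda n) \<Longrightarrow> sum f I \<in> Lambda n"
  unfolding Lambda_supported by (rule supported_sum)

lemma span_on_Lambda: "a \<in> span_on S \<Longrightarrow> S \<subseteq> {1..n} \<Longrightarrow> a \<in> Lambda n"
  unfolding Lambda_supported by (erule supported_mono) auto

section \<open>The filtration by degree and parity\<close>

text \<open>Degree and parity are filtered together: only degrees of the parity of \<open>d\<close>
  occur. Thus \<open>gfilt n 0\<close> is the even part, \<open>gfilt n 1\<close> the odd part, and
  \<open>gfilt n 3\<close> contains the corrections allowed in \<open>Gamma_group n\<close>. With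
  the parity kept, every gain in degree is a gain of at least two.\<close>

definition gfilt :: "nat \<Rightarrow> nat \<Rightarrow> 'k::comm_ring_1 grassmann set"
  where "gfilt n d = supported (\<lambda>A. A \<subseteq> {1..n} \<and> d \<le> card A \<and> even (card A + d))"

lemma gfilt_Lambda: "a \<in> gfilt n d \<Longrightarrow> a \<in> Lambda n"
  unfolding gfilt_def Lambda_supported by (erule supported_mono) simp

lemma gfilt_0 [simp]: "0 \<in> gfilt n d"
  by (simp add: gfilt_def)

lemma gfilt_1 [simp]: "1 \<in> gfilt n 0"
  by (simp add: gfilt_def one_grassmann_def supported_gmono)

lemma gfilt_gvar: "k \<in> {1..n} \<Longrightarrow> gvar k \<in> gfilt n 1"
  by (simp add: gfilt_def gvar_def supported_gmono)

lemma gfilt_gmono: "A \<subseteq> {1..n} \<Longrightarrow> d \<le> card A \<Longrightarrow> even (card A + d) \<Longrightarrow> gmono c A \<in> gfilt n d"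
  by (simp add: gfilt_def supported_gmono)

lemma gfilt_add: "a \<in> gfilt n d \<Longrightarrow> b \<in> gfilt n d \<Longrightarrow> a + b \<in> gfilt n d"
  unfolding gfilt_def by (rule supported_add)

lemma gfilt_diff: "a \<in> gfilt n d \<Longrightarrow> b \<in> gfilt n d \<Longrightarrow> a - b \<in> gfilt n d"
  unfolding gfilt_def by (rule supported_diff)

lemma gfilt_uminus: "a \<in> gfilt n d \<Longrightarrow> - a \<in> gfilt n d"
  unfolding gfilt_def by (rule supported_uminus)

lemma gfilt_scale: "a \<in> gfilt n d \<Longrightarrow> c \<cdot> a \<in> gfilt n d"
  unfolding gfilt_def by (rule supported_scale)

lemma gfilt_mult: "a \<in> gfilt n d \<Longrightarrow> b \<in> gfilt n e \<Longrightarrow> a * b \<in> gfilt n (d + e)"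
  unfolding gfilt_def by (erule supported_mult, assumption) (auto simp: card_Un_disjoint)

lemma gfilt_antimono: "a \<in> gfilt n d \<Longrightarrow> e \<le> d \<Longrightarrow> even (d + e) \<Longrightarrow> a \<in> gfilt n e"
  unfolding gfilt_def by (erule supported_mono) auto

lemma gfilt_coeff: "a \<in> gfilt n d \<Longrightarrow> card A < d \<Longrightarrow> coeff a A = 0"
  unfolding gfilt_def by (auto dest!: supportedD)

lemma gfilt_trivial: "n < d \<Longrightarrow> a \<in> gfilt n d \<Longrightarrow> a = 0"
proof (rule grassmann_eqI)
  fix A assume "n < d" "a \<in> gfilt n d"
  moreover have "card A \<le> n" if "A \<subseteq> {1..n}" using card_mono[OF _ that] by simp
  ultimately show "coeff a A = coeff 0 A" unfolding gfilt_def using supportedD by fastforce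
qed

lemma Lambda_even_gfilt: "Lambda_even n = gfilt n 0"
  by (auto simp: Lambda_even_def gfilt_def Lambda_def supported_def)

lemma gfilt_even_commute: "a \<in> gfilt n 0 \<Longrightarrow> a * b = b * a"
  by (rule Lambda_even_central) (simp add: Lambda_even_gfilt)

lemma pd_gfilt: "a \<in> gfilt n (Suc d) \<Longrightarrow> pd j a \<in> gfilt n d"
  unfolding gfilt_def
proof (induction rule: supported_induct)
  case (mono c A)
  then show ?case
    by (cases "j \<in> A") (auto simp: pd_gmono intro!: supported_gmono)
qed (auto simp: pd_0 pd_add supported_add)

section \<open>Commutation, squares and derivatives of odd elements\<close>

lemma gmono_commute:
  assumes "finite A" "finite B"
  shows "gmono c A * gmono d B = (- 1) ^ (card A * card B) * (gmono d B * gmono c A)"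
proof (cases "A \<inter> B = {}")
  case True
  have "gsign A B = gsign A B * gsign B A * (gsign B A :: 'a)"
    by (simp add: mult.assoc)
  also have "\<dots> = (- 1) ^ (card A * card B) * gsign B A" by (simp only: gsign_commute[OF assms True])
  finally have s: "gsign A B = (- 1) ^ (card A * card B) * (gsign B A :: 'a)" .
  show ?thesis using True assms
    by (simp add: gmono_times Int_commute Un_commute sgn_gmono s mult_ac)
qed (use assms in \<open>simp add: gmono_times Int_commute\<close>)

lemma odd_anticommute:
  assumes "a \<in> gfilt n 1" "b \<in> gfilt n 1"
  shows "a * b = - (b * a)"
  using assms(1) unfolding gfilt_def
proof (induction rule: supported_induct)
  case (mono c A)
  show ?case using assms(2) unfolding gfilt_def
  proof (induction rule: supported_induct)
    case (mono d B)
    then show ?case using \<open>finite A\<close> \<open>A \<subseteq> {1..n} \<and> _\<close> by (simp add: gmono_commute[of A B])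
  qed (auto simp: algebra_simps)
qed (auto simp: algebra_simps)

text \<open>Anticommutativity alone gives only \<open>2 * (a * a) = 0\<close>. The square itself
  vanishes because a nonempty monomial squares to zero and the cross terms cancel in pairs.\<close>

lemma odd_square:
  assumes "a \<in> gfilt n 1"
  shows "a * a = 0"
  using assms unfolding gfilt_def
proof (induction rule: supported_induct)
  case (mono c A)
  then have "A \<noteq> {}" by auto
  then show ?case using mono by (simp add: gmono_times)
next
  case (add a b)
  then have "a * b = - (b * a)" by (intro odd_anticommute[of _ n]) (auto simp: gfilt_def)
  then show ?case using add by (simp add: algebra_simps)
qed simp

lemma pd_odd_times:
  assumes "a \<in> gfilt n 1"
  shows "pd j (a * b) = pd j a * b - a * pd j b"
  using assms unfolding gfilt_def
proof (induction rule: supported_induct)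
  case (mono c A)
  show ?case
    using mono by (induction b rule: grassmann_induct) (auto simp: pd_0 pd_add pd_gmono_times algebra_simps)
qed (auto simp: pd_0 pd_add algebra_simps)

lemma pd_gvar: "pd j (gvar k) = (if k = j then 1 else 0)"
  by (auto simp: gvar_def pd_gmono one_grassmann_def)

lemma pd_1: "pd j 1 = 0"
  by (simp add: one_grassmann_def pd_gmono)

lemma pd_diff: "pd j (a - b) = pd j a - pd j b"
  by (rule grassmann_eqI) (simp add: coeff_pd algebra_simps)

lemma pd_span_on: "a \<in> span_on S \<Longrightarrow> j \<notin> S \<Longrightarrow> pd j a = 0"
proof (rule grassmann_eqI)
  fix A assume "a \<in> span_on S" "j \<notin> S"
  then have "coeff a (insert j A) = 0" using supportedD[of a "\<lambda>A. A \<subseteq> S" "insert j A"] by blast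
  then show "coeff (pd j a) A = coeff 0 A" by (simp add: coeff_pd)
qed

lemma aug_ideal_cubed_eq: "aug_ideal_cubed n = (supported (\<lambda>A. A \<subseteq> {1..n} \<and> 3 \<le> card A) :: 'k::comm_ring_1 grassmann set)"
proof (rule Set.set_eqI, rule iffI)
  fix a :: "'k grassmann"
  have aug: "aug_ideal n = (supported (\<lambda>A. A \<subseteq> {1..n} \<and> 1 \<le> card A) :: 'k grassmann set)"
    by (auto simp: aug_ideal_def supported_def Lambda_def)
  {
    assume "a \<in> aug_ideal_cubed n"
    then show "a \<in> supported (\<lambda>A. A \<subseteq> {1..n} \<and> 3 \<le> card A)"
      unfolding aug_ideal_cubed_def
    proof (induction rule: grassmann.span_induct_alt)
      case (step c x y)
      then obtain a1 b1 c1 where x: "x = a1 * b1 * c1" "a1 \<in> aug_ideal n" "b1 \<in> aug_ideal n" "c1 \<in> aug_ideal n"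
        by blast
      have "a1 * b1 \<in> supported (\<lambda>A. A \<subseteq> {1..n} \<and> 2 \<le> card A)"
        using x(2,3) unfolding aug by (rule supported_mult) (auto simp: card_Un_disjoint)
      then have "x \<in> supported (\<lambda>A. A \<subseteq> {1..n} \<and> 3 \<le> card A)"
        using x(4) unfolding aug x(1) by (rule supported_mult) (auto simp: card_Un_disjoint)
      then show ?case using step by (auto intro: supported_add supported_scale)
    qed simp
  }
  {
    assume "a \<in> supported (\<lambda>A. A \<subseteq> {1..n} \<and> 3 \<le> card A)"
    then show "a \<in> aug_ideal_cubed n"
    proof (induction rule: supported_induct)
      case zero
      show ?case unfolding aug_ideal_cubed_def by (rule grassmann.span_zero)
    next
      case (add a b)
      then show ?case unfolding aug_ideal_cubed_def by (auto intro: grassmann.span_add)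
    next
      case (mono c A)
      then obtain B where "B \<subseteq> A" "card B = 3" "finite B" using obtain_subset_with_card_n by metis
      then obtain p q r where B: "B = {p, q, r}" "p \<noteq> q" "p \<noteq> r" "q \<noteq> r" by (auto simp: card_3_iff)
      \<comment> \<open>Two single variables and the remaining monomial are the three factors;
        \<open>r\<close> ensures that the last one has positive degree.\<close>
      define D where "D = A - {p, q}"
      have A: "A = insert p (insert q D)" "p \<notin> D" "q \<notin> D" "r \<in> D" "finite D" using B \<open>B \<subseteq> A\<close> mono by (auto simp: D_def)
      have sc: "gmono c A = (c * gsign {p} (insert q D) * gsign {q} D) \<cdot> (gvar p * gvar q * gmono 1 D)"
        using A B by (simp add: mult.assoc gvar_times_gmono insert_commute) (simp add: mult_ac)
      have "1 \<le> card D" using A card_gt_0_iff[of D] by auto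
      then have in3: "gvar p * gvar q * gmono 1 D \<in> {a * b * c | a b c. a \<in> aug_ideal n \<and> b \<in> aug_ideal n \<and> c \<in> (aug_ideal n :: 'k grassmann set)}"
        unfolding aug using mono A by (auto simp: gvar_def intro!: exI supported_gmono)
      show ?case unfolding sc aug_ideal_cubed_def
        by (rule grassmann.span_scale, rule grassmann.span_base, rule in3)
    qed
  }
qed

lemma Lambda_odd_cubed: "Lambda_odd n \<inter> aug_ideal_cubed n = gfilt n 3"
  unfolding aug_ideal_cubed_eq by (auto simp: Lambda_odd_def gfilt_def supported_def Lambda_def)

section \<open>Homomorphisms\<close>

text \<open>The algebra maps behind \<open>algebra_aut\<close> without bijectivity: substitutions
  have to be compared on generators before an inverse is known.\<close>

definition ghom :: "nat \<Rightarrow> 'k::comm_ring_1 gmap \<Rightarrow> bool"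
  where "ghom n s \<longleftrightarrow> s \<in> Lambda n \<rightarrow>\<^sub>E Lambda n \<and> s 1 = 1 \<and>
    (\<forall>a\<in>Lambda n. \<forall>b\<in>Lambda n. s (a + b) = s a + s b \<and> s (a * b) = s a * s b) \<and>
    (\<forall>c. \<forall>a\<in>Lambda n. s (c \<cdot> a) = c \<cdot> s a)"

lemma algebra_aut_iff: "s \<in> algebra_aut n \<longleftrightarrow> ghom n s \<and> bij_betw s (Lambda n) (Lambda n)"
  unfolding algebra_aut_def ghom_def Bij_def by (auto simp: PiE_def bij_betw_def)

lemma ghom_Lambda: "ghom n s \<Longrightarrow> a \<in> Lambda n \<Longrightarrow> s a \<in> Lambda n"
  by (auto simp: ghom_def)

lemma ghom_1: "ghom n s \<Longrightarrow> s 1 = 1"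
  by (simp add: ghom_def)

lemma ghom_add: "ghom n s \<Longrightarrow> a \<in> Lambda n \<Longrightarrow> b \<in> Lambda n \<Longrightarrow> s (a + b) = s a + s b"
  by (simp add: ghom_def)

lemma ghom_mult: "ghom n s \<Longrightarrow> a \<in> Lambda n \<Longrightarrow> b \<in> Lambda n \<Longrightarrow> s (a * b) = s a * s b"
  by (simp add: ghom_def)

lemma ghom_scale: "ghom n s \<Longrightarrow> a \<in> Lambda n \<Longrightarrow> s (c \<cdot> a) = c \<cdot> s a"
  by (simp add: ghom_def)

lemma ghom_0: "ghom n s \<Longrightarrow> s 0 = 0"
  using ghom_scale[of n s 0 0] Lambda_0 by auto

lemma ghom_uminus: "ghom n s \<Longrightarrow> a \<in> Lambda n \<Longrightarrow> s (- a) = - s a"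
  using ghom_add[of n s a "- a"] by (simp add: Lambda_uminus ghom_0 eq_neg_iff_add_eq_0 add.commute)

lemma ghom_diff: "ghom n s \<Longrightarrow> a \<in> Lambda n \<Longrightarrow> b \<in> Lambda n \<Longrightarrow> s (a - b) = s a - s b"
  using ghom_add[of n s a "- b"] ghom_uminus[of n s b] Lambda_uminus[of b n] by simp

lemma ghom_sum:
  "ghom n s \<Longrightarrow> (\<And>i. i \<in> I \<Longrightarrow> f i \<in> Lambda n) \<Longrightarrow> s (sum f I) = (\<Sum>i\<in>I. s (f i))"
  by (induction I rule: infinite_finite_induct) (auto simp: ghom_0 ghom_add Lambda_sum)

lemma ghom_eqI:
  assumes "ghom n s" "ghom n t" "\<And>k. k \<in> {1..n} \<Longrightarrow> s (gvar k) = t (gvar k)"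
  shows "s = t"
proof (rule ext)
  fix a
  show "s a = t a"
  proof (cases "a \<in> Lambda n")
    case True
    note hom = ghom_1 ghom_add ghom_mult ghom_scale
    from True show ?thesis unfolding Lambda_supported
      by (induction rule: span_on_induct, unfold Lambda_supported[symmetric])
        (simp_all add: hom[OF assms(1)] hom[OF assms(2)] Lambda_gvar assms(3))
  next
    case False
    then show ?thesis using assms(1,2) unfolding ghom_def by (metis PiE_arb)
  qed
qed

text \<open>This evaluates an elementary automorphism on its own parameter, which avoids the
  variables that are moved.\<close>

lemma ghom_fix:
  assumes "ghom n s" "S \<subseteq> {1..n}" "\<And>k. k \<in> S \<Longrightarrow> s (gvar k) = gvar k" "a \<in> span_on S"
  shows "s a = a"
  using assms(4)
proof (induction rule: span_on_induct)
  case (mult k b)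
  then have "gvar k \<in> (Lambda n :: 'a grassmann set)" "b \<in> Lambda n"
    using assms(2) span_on_Lambda by (blast intro: Lambda_gvar)+
  then show ?case using mult assms(3) by (simp add: ghom_mult[OF assms(1)])
next
  case (scale c b)
  then have "b \<in> Lambda n" using assms(2) span_on_Lambda by blast
  then show ?case using scale by (simp add: ghom_scale[OF assms(1)])
next
  case (add a b)
  then have "a \<in> Lambda n" "b \<in> Lambda n" using assms(2) span_on_Lambda by blast+
  then show ?case using add by (simp add: ghom_add[OF assms(1)])
qed (simp add: ghom_1[OF assms(1)])

lemma ghom_compose:
  assumes "ghom n s" "ghom n t"
  shows "ghom n (compose (Lambda n) s t)"
  using assms ghom_Lambda[OF assms(2)]
  by (auto simp: ghom_def compose_def Lambda_1 Lambda_add Lambda_mult Lambda_scale)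

lemma ghom_gfilt:
  assumes "ghom n s" "\<And>k. k \<in> {1..n} \<Longrightarrow> s (gvar k) \<in> gfilt n 1" "a \<in> gfilt n d"
  shows "s a \<in> gfilt n d"
  using assms(3) unfolding gfilt_def[of n d]
proof (induction rule: supported_induct)
  case zero
  then show ?case by (simp add: ghom_0[OF assms(1)])
next
  case (mono c A)
  have "A \<subseteq> {1..n} \<Longrightarrow> s (gmono 1 A) \<in> gfilt n (card A)"
    using mono(1)
  proof (induction A rule: finite_induct)
    case empty
    then show ?case using ghom_1[OF assms(1)] by (simp flip: one_grassmann_def)
  next
    case (insert k A)
    have e: "gmono 1 (insert k A) = gsign {k} A \<cdot> (gvar k * gmono 1 A :: 'a grassmann)"
      using insert by (simp add: gvar_times_gmono)
    have "s (gmono 1 (insert k A)) = gsign {k} A \<cdot> (s (gvar k) * s (gmono 1 A))"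
      unfolding e using insert
      by (simp add: ghom_scale[OF assms(1)] ghom_mult[OF assms(1)] Lambda_mult Lambda_gvar Lambda_gmono)
    then show ?case using gfilt_mult[of "s (gvar k)" n 1 "s (gmono 1 A)" "card A"] insert assms(2)
      by (auto intro!: gfilt_scale simp: plus_1_eq_Suc)
  qed
  then have "s (gmono 1 A) \<in> gfilt n d" using mono gfilt_antimono by blast
  then have "c \<cdot> s (gmono 1 A) \<in> gfilt n d" by (rule gfilt_scale)
  then show ?case using ghom_scale[OF assms(1), of "gmono 1 A" c] mono
    by (simp add: Lambda_gmono gfilt_def)
next
  case (add a b)
  then have "a \<in> Lambda n" "b \<in> Lambda n" by (auto intro: gfilt_Lambda simp: gfilt_def)
  then show ?case using add by (simp add: ghom_add[OF assms(1)] supported_add)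
qed

text \<open>For a generator \<open>x\<close>, the defect \<open>s (x * b) - x * b\<close> is
  \<open>s x * (s b - b) + (s x - x) * b\<close>, and each summand gains two degrees. This makes
  leading coefficients additive under composition.\<close>

lemma ghom_diff_gfilt:
  assumes "ghom n s" "\<And>k. k \<in> {1..n} \<Longrightarrow> s (gvar k) - gvar k \<in> gfilt n 3" "a \<in> gfilt n d"
  shows "s a - a \<in> gfilt n (d + 2)"
proof -
  have odd: "s (gvar k) \<in> gfilt n 1" if "k \<in> {1..n}" for k
    using gfilt_add[OF gfilt_antimono[OF assms(2)[OF that], of 1] gfilt_gvar[OF that]] by simp
  show ?thesis
    using assms(3) unfolding gfilt_def[of n d]
  proof (induction rule: supported_induct)
    case zero
    then show ?case by (simp add: ghom_0[OF assms(1)])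
  next
    case (mono c A)
    have "A \<subseteq> {1..n} \<Longrightarrow> s (gmono 1 A) - gmono 1 A \<in> gfilt n (card A + 2)"
      using mono(1)
    proof (induction A rule: finite_induct)
      case empty
      then show ?case using ghom_1[OF assms(1)] by (simp flip: one_grassmann_def)
    next
      case (insert k A)
      have e: "gmono 1 (insert k A) = gsign {k} A \<cdot> (gvar k * gmono 1 A :: 'a grassmann)"
        using insert by (simp add: gvar_times_gmono)
      have "s (gmono 1 (insert k A)) = gsign {k} A \<cdot> (s (gvar k) * s (gmono 1 A))"
        unfolding e using insert
        by (simp add: ghom_scale[OF assms(1)] ghom_mult[OF assms(1)] Lambda_mult Lambda_gvar Lambda_gmono)
      then have "s (gmono 1 (insert k A)) - gmono 1 (insert k A) =
          gsign {k} A \<cdot> (s (gvar k) * (s (gmono 1 A) - gmono 1 A) + (s (gvar k) - gvar k) * gmono 1 A)"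
        unfolding e by (simp add: algebra_simps grassmann.scale_right_diff_distrib)
      moreover have "s (gvar k) * (s (gmono 1 A) - gmono 1 A) \<in> gfilt n (1 + (card A + 2))"
        using insert odd by (intro gfilt_mult) auto
      moreover have "(s (gvar k) - gvar k) * gmono 1 A \<in> gfilt n (3 + card A)"
        using insert assms(2) by (intro gfilt_mult gfilt_gmono) auto
      ultimately show ?case using insert(1,2)
        by (auto intro!: gfilt_scale gfilt_add simp: numeral_3_eq_3 plus_1_eq_Suc)
    qed
    then have "s (gmono 1 A) - gmono 1 A \<in> gfilt n (d + 2)" using mono by (auto intro: gfilt_antimono)
    then have "c \<cdot> (s (gmono 1 A) - gmono 1 A) \<in> gfilt n (d + 2)" by (rule gfilt_scale)
    then show ?case using ghom_scale[OF assms(1), of "gmono 1 A" c] mono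
      by (simp add: Lambda_gmono grassmann.scale_right_diff_distrib)
  next
    case (add a b)
    then have "a \<in> Lambda n" "b \<in> Lambda n" by (auto intro: gfilt_Lambda simp: gfilt_def)
    moreover have "a + b \<in> Lambda n" using calculation by (rule Lambda_add)
    ultimately show ?case using gfilt_add[OF add(3,4)] by (simp add: ghom_add[OF assms(1)] algebra_simps)
  qed
qed

section \<open>Substitution\<close>

definition ypow :: "(nat \<Rightarrow> 'k::comm_ring_1 grassmann) \<Rightarrow> nat set \<Rightarrow> 'k grassmann"
  where "ypow y A = prod_list (map y (sorted_list_of_set A))"

definition gsubst :: "nat \<Rightarrow> (nat \<Rightarrow> 'k::comm_ring_1 grassmann) \<Rightarrow> 'k gmap"
  where "gsubst n y = (\<lambda>a\<in>Lambda n. \<Sum>A\<in>Pow {1..n}. coeff a A \<cdot> ypow y A)"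

lemma ypow_insert_min:
  "finite A \<Longrightarrow> (\<And>a. a \<in> A \<Longrightarrow> m < a) \<Longrightarrow> ypow y (insert m A) = y m * ypow y A"
proof -
  assume "finite A" "\<And>a. a \<in> A \<Longrightarrow> m < a"
  moreover from this have "m \<notin> A" by blast
  ultimately have "sorted_list_of_set (insert m A) = m # sorted_list_of_set A"
    by (simp add: insort_is_Cons less_imp_le)
  then show ?thesis by (simp add: ypow_def)
qed

lemma gsign_min: "(\<And>b. b \<in> B \<Longrightarrow> k < b) \<Longrightarrow> gsign {k} B = 1"
proof -
  assume "\<And>b. b \<in> B \<Longrightarrow> k < b"
  then have "{(a, b) \<in> {k} \<times> B. b < a} = {}" by force
  then show ?thesis by (simp only: gsign_def card.empty power_0)
qed

lemma gsign_singletons: "gsign {k} {m} = (if m < k then - 1 else 1)"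
proof -
  have "{(a, b) \<in> {k} \<times> {m}. b < a} = (if m < k then {(k, m)} else {})" by auto
  then show ?thesis by (simp add: gsign_def)
qed

text \<open>Odd elements obey the reordering rule of the variables: passing a smaller factor costs a
  sign, which is the extra factor of \<open>gsign\<close>, and a repeated factor gives zero by
  \<open>odd_square\<close>.\<close>

lemma times_ypow:
  assumes "\<And>k. k \<in> {1..n} \<Longrightarrow> y k \<in> gfilt n 1" "k \<in> {1..n}" "A \<subseteq> {1..n}"
  shows "y k * ypow y A = (if k \<in> A then 0 else gsign {k} A \<cdot> ypow y (insert k A))"
proof -
  have "finite A" using assms(3) finite_subset by blast
  then show ?thesis using assms(3)
  proof (induction A rule: finite_linorder_min_induct)
    case empty
    then show ?case using ypow_insert_min[of "{}" k y] by simp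
  next
    case (insert m A)
    have Y: "ypow y (insert m A) = y m * ypow y A"
      using insert(1,2) by (intro ypow_insert_min) auto
    consider "k < m" | "k = m" | "m < k" by linarith
    then show ?case
    proof cases
      case 1
      then have "\<And>a. a \<in> insert m A \<Longrightarrow> k < a" using insert(2) by force
      moreover from this have "(gsign {k} (insert m A) :: 'a) = 1" by (rule gsign_min)
      ultimately show ?thesis using insert(1) ypow_insert_min[of "insert m A" k y] by auto
    next
      case 2
      have "y m * (y m * ypow y A) = 0"
        using odd_square[OF assms(1)[OF assms(2)]] 2 by (simp flip: mult.assoc)
      then show ?thesis using 2 Y insert(2) by simp
    next
      case 3
      have "y k * ypow y (insert m A) = - (y m * (y k * ypow y A))"
        using odd_anticommute[OF assms(1)[OF assms(2)] assms(1)[of m]] insert(4) Y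
        by (simp add: mult.assoc[symmetric])
      moreover have "gsign {k} (insert m A) = - (gsign {k} A :: 'a)"
        using gsign_union_right[of "{k}" "{m}" A] insert 3 by (auto simp: gsign_singletons)
      moreover have "ypow y (insert k (insert m A)) = y m * ypow y (insert k A)"
        using insert 3 ypow_insert_min[of "insert k A" m y] by (auto simp: insert_commute)
      ultimately show ?thesis using insert 3 by (auto simp: gscale_mult_right)
    qed
  qed
qed

lemma prod_list_Lambda: "(\<And>x. x \<in> set xs \<Longrightarrow> x \<in> Lambda n) \<Longrightarrow> prod_list xs \<in> Lambda n"
  by (induction xs) (auto simp: Lambda_1 Lambda_mult)

text \<open>The universal property of the Grassmann algebra for odd images, which satisfy its
  defining relations.\<close>

lemma ghom_gsubst:
  fixes y :: "nat \<Rightarrow> 'k::comm_ring_1 grassmann"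
  assumes y: "\<And>k. k \<in> {1..n} \<Longrightarrow> y k \<in> gfilt n 1"
  shows "ghom n (gsubst n y)" and "k \<in> {1..n} \<Longrightarrow> gsubst n y (gvar k) = y k"
proof -
  let ?s = "gsubst n y"
  have fin: "finite (Pow {1..n})" by simp
  have L: "?s a \<in> Lambda n" if "a \<in> Lambda n" for a
  proof -
    have "ypow y A \<in> Lambda n" if "A \<subseteq> {1..n}" for A
    proof -
      have "finite A" using that finite_subset by blast
      then show ?thesis unfolding ypow_def using that gfilt_Lambda[OF y] by (intro prod_list_Lambda) auto
    qed
    then show ?thesis using that unfolding gsubst_def by (auto intro!: Lambda_sum Lambda_scale)
  qed
  have add: "?s (a + b) = ?s a + ?s b" if "a \<in> Lambda n" "b \<in> Lambda n" for a b
    using that by (simp add: gsubst_def Lambda_add grassmann.scale_left_distrib sum.distrib)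
  have scale: "?s (c \<cdot> a) = c \<cdot> ?s a" if "a \<in> Lambda n" for a c
    using that by (simp add: gsubst_def Lambda_scale grassmann.scale_sum_right)
  have mono: "?s (gmono c A) = c \<cdot> ypow y A" if A: "A \<subseteq> {1..n}" for c A
  proof -
    have "finite A" using A finite_subset by blast
    then have "?s (gmono c A) = (\<Sum>B\<in>Pow {1..n}. if B = A then c \<cdot> ypow y A else 0)"
      using A unfolding gsubst_def by (simp add: Lambda_gmono coeff_gmono if_distrib[of "\<lambda>x. x \<cdot> _"] cong: if_cong)
    also have "\<dots> = c \<cdot> ypow y A" using A by (simp add: sum.delta)
    finally show ?thesis .
  qed
  have one: "?s 1 = 1" using mono[of "{}" 1] by (simp add: one_grassmann_def[symmetric] ypow_def)
  have zero: "?s 0 = 0" by (simp add: gsubst_def Lambda_0)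
  \<comment> \<open>Compatibility with left multiplication by one generator; full multiplicativity
    follows from it by associativity.\<close>
  have gv: "?s (gvar k * b) = y k * ?s b" if k: "k \<in> {1..n}" and "b \<in> Lambda n" for k b
    using that(2) unfolding Lambda_supported
  proof (induction rule: supported_induct)
    case zero
    then show ?case using \<open>?s 0 = 0\<close> by simp
  next
    case (mono c A)
    have "y k * ypow y A = (if k \<in> A then 0 else gsign {k} A \<cdot> ypow y (insert k A))"
      using y k mono by (intro times_ypow) auto
    then have "?s (gvar k * gmono c A) = c \<cdot> (y k * ypow y A)"
      using mono k \<open>?s 0 = 0\<close> by (simp add: gvar_times_gmono \<open>\<And>c A. A \<subseteq> {1..n} \<Longrightarrow> ?s (gmono c A) = _\<close> mult.commute)
    then show ?case using mono \<open>\<And>c A. A \<subseteq> {1..n} \<Longrightarrow> ?s (gmono c A) = _\<close> by (simp add: gscale_mult_right)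
  next
    case (add a b)
    then have "a \<in> Lambda n" "b \<in> Lambda n" by (simp_all add: Lambda_supported)
    moreover from this have "gvar k * a \<in> Lambda n" "gvar k * b \<in> Lambda n" using k by (simp_all add: Lambda_mult Lambda_gvar)
    ultimately show ?case using add \<open>\<And>a b. a \<in> Lambda n \<Longrightarrow> b \<in> Lambda n \<Longrightarrow> ?s (a + b) = _\<close> by (simp add: distrib_left)
  qed
  have mult: "?s (a * b) = ?s a * ?s b" if "a \<in> Lambda n" and b: "b \<in> Lambda n" for a b
    using that(1) unfolding Lambda_supported
  proof (induction rule: span_on_induct)
    case (mult k a)
    then have a: "a \<in> Lambda n" by (simp add: Lambda_supported)
    have "?s (gvar k * a * b) = y k * ?s (a * b)" 
      using gv[OF mult(1) Lambda_mult[OF a b]] by (simp add: mult.assoc)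
    then show ?case using gv[OF mult(1) a] mult by (simp add: mult.assoc)
  next
    case (scale c a)
    then show ?case using b \<open>\<And>a c. a \<in> Lambda n \<Longrightarrow> ?s (c \<cdot> a) = _\<close>
      by (simp flip: Lambda_supported add: gscale_mult_left Lambda_mult)
  next
    case (add a a')
    then show ?case using b \<open>\<And>a b. a \<in> Lambda n \<Longrightarrow> b \<in> Lambda n \<Longrightarrow> ?s (a + b) = _\<close>
      by (simp flip: Lambda_supported add: distrib_right Lambda_mult)
  qed (simp add: one)
  show "ghom n ?s"
    unfolding ghom_def using L add mult scale one by (auto simp: gsubst_def)
  show "?s (gvar k) = y k" if "k \<in> {1..n}"
    using gv[OF that Lambda_1] one by simp
qed

text \<open>Both composites fix the generators, hence are the identity by \<open>ghom_eqI\<close>.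
  For the elementary automorphisms \<open>z\<close> is explicit: the same substitution with the
  parameter negated.\<close>

lemma algebra_aut_gsubst:
  fixes y :: "nat \<Rightarrow> 'k::comm_ring_1 grassmann"
  assumes y: "\<And>k. k \<in> {1..n} \<Longrightarrow> y k \<in> gfilt n 1" and z: "\<And>k. k \<in> {1..n} \<Longrightarrow> z k \<in> gfilt n 1"
    and yz: "\<And>k. k \<in> {1..n} \<Longrightarrow> gsubst n y (z k) = gvar k" "\<And>k. k \<in> {1..n} \<Longrightarrow> gsubst n z (y k) = gvar k"
  shows "gsubst n y \<in> algebra_aut n"
proof -
  note hy = ghom_gsubst[of n y, OF y] and hz = ghom_gsubst[of n z, OF z]
  have id: "ghom n (\<lambda>a\<in>Lambda n. a :: 'k grassmann)"
    by (auto simp: ghom_def Lambda_1 Lambda_add Lambda_mult Lambda_scale)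
  have "compose (Lambda n) (gsubst n y) (gsubst n z) = (\<lambda>a\<in>Lambda n. a)"
    by (rule ghom_eqI[OF ghom_compose[OF hy(1) hz(1)] id])
      (simp_all only: compose_eq Lambda_gvar yz hz(2) restrict_apply')
  then have 1: "gsubst n y (gsubst n z a) = a" if "a \<in> Lambda n" for a
    using that by (metis compose_eq restrict_apply')
  have "compose (Lambda n) (gsubst n z) (gsubst n y) = (\<lambda>a\<in>Lambda n. a)"
    by (rule ghom_eqI[OF ghom_compose[OF hz(1) hy(1)] id])
      (simp_all only: compose_eq Lambda_gvar yz hy(2) restrict_apply')
  then have 2: "gsubst n z (gsubst n y a) = a" if "a \<in> Lambda n" for a
    using that by (metis compose_eq restrict_apply')
  have "bij_betw (gsubst n y) (Lambda n) (Lambda n)"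
    by (rule bij_betw_byWitness[where f' = "gsubst n z"]) (use 1 2 ghom_Lambda[OF hy(1)] ghom_Lambda[OF hz(1)] in auto)
  then show ?thesis using hy(1) by (simp add: algebra_aut_iff)
qed

section \<open>The Jacobian\<close>

lemma Gamma_group_iff:
  "s \<in> Gamma_group n \<longleftrightarrow> s \<in> algebra_aut n \<and> (\<forall>i\<in>{1..n}. s (gvar i) - gvar i \<in> gfilt n 3)"
  by (simp add: Gamma_group_def Lambda_odd_cubed)

lemma Gamma_ghom: "s \<in> Gamma_group n \<Longrightarrow> ghom n s"
  by (simp add: Gamma_group_iff algebra_aut_iff)

lemma Gamma_gvar_diff: "s \<in> Gamma_group n \<Longrightarrow> k \<in> {1..n} \<Longrightarrow> s (gvar k) - gvar k \<in> gfilt n 3"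
  by (simp add: Gamma_group_iff)

lemma Gamma_gvar: "s \<in> Gamma_group n \<Longrightarrow> k \<in> {1..n} \<Longrightarrow> s (gvar k) \<in> gfilt n 1"
  using gfilt_add[OF gfilt_antimono[OF Gamma_gvar_diff, of s n k 1] gfilt_gvar[of k n]] by simp

lemma Gamma_gfilt: "s \<in> Gamma_group n \<Longrightarrow> a \<in> gfilt n d \<Longrightarrow> s a \<in> gfilt n d"
  using ghom_gfilt[of n s a d] Gamma_ghom[of s n] Gamma_gvar[of s n] by blast

lemma Gamma_diff_gfilt: "s \<in> Gamma_group n \<Longrightarrow> a \<in> gfilt n d \<Longrightarrow> s a - a \<in> gfilt n (d + 2)"
  using ghom_diff_gfilt[of n s a d] Gamma_ghom[of s n] Gamma_gvar_diff[of s n] by blast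

lemma algebra_aut_compose:
  "s \<in> algebra_aut n \<Longrightarrow> t \<in> algebra_aut n \<Longrightarrow> compose (Lambda n) s t \<in> algebra_aut n"
  unfolding algebra_aut_iff by (auto intro: ghom_compose bij_betw_compose)

lemma Gamma_compose:
  assumes "s \<in> Gamma_group n" "t \<in> Gamma_group n"
  shows "compose (Lambda n) s t \<in> Gamma_group n"
  unfolding Gamma_group_iff
proof (intro conjI ballI)
  show "compose (Lambda n) s t \<in> algebra_aut n"
    using assms by (intro algebra_aut_compose) (simp_all add: Gamma_group_iff)
  fix i assume i: "i \<in> {1..n}"
  have "s (t (gvar i)) - t (gvar i) \<in> gfilt n (1 + 2)"
    by (rule Gamma_diff_gfilt[OF assms(1) Gamma_gvar[OF assms(2) i]])
  then have "(s (t (gvar i)) - t (gvar i)) + (t (gvar i) - gvar i) \<in> gfilt n 3"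
    using Gamma_gvar_diff[OF assms(2) i] by (intro gfilt_add) simp_all
  then show "compose (Lambda n) s t (gvar i) - gvar i \<in> gfilt n 3"
    using i by (simp add: compose_eq Lambda_gvar)
qed

text \<open>Both sides obey the same skew Leibniz rule under left multiplication by a generator,
  because \<open>s (gvar k)\<close> is again odd.\<close>

lemma pd_chain:
  assumes "ghom n s" and s: "\<And>k. k \<in> {1..n} \<Longrightarrow> s (gvar k) \<in> gfilt n 1" and "a \<in> Lambda n"
  shows "pd j (s a) = (\<Sum>k=1..n. s (pd k a) * pd j (s (gvar k)))"
  using assms(3) unfolding Lambda_supported
proof (induction rule: span_on_induct)
  case one
  then show ?case by (simp add: ghom_1[OF assms(1)] ghom_0[OF assms(1)] pd_1)
next
  case (mult k b)
  then have k: "k \<in> {1..n}" and b: "b \<in> Lambda n" by (simp_all only: Lambda_supported)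
  note g = Lambda_gvar[OF k]
  have s1: "s (pd l (gvar k * b)) = (if l = k then s b else 0) - s (gvar k) * s (pd l b)" for l
    using b unfolding pd_odd_times[OF gfilt_gvar[OF k]]
    by (simp add: g pd_gvar ghom_diff[OF assms(1)] ghom_mult[OF assms(1)] pd_Lambda Lambda_mult Lambda_uminus ghom_uminus[OF assms(1)])
  have "(\<Sum>l=1..n. s (pd l (gvar k * b)) * pd j (s (gvar l))) =
      (\<Sum>l=1..n. (if l = k then s b * pd j (s (gvar k)) else 0)) - s (gvar k) * (\<Sum>l=1..n. s (pd l b) * pd j (s (gvar l)))"
    unfolding s1 sum_distrib_left sum_subtractf[symmetric] by (intro sum.cong) (auto simp: algebra_simps)
  also have "\<dots> = s b * pd j (s (gvar k)) - s (gvar k) * pd j (s b)"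
    using k mult by simp
  \<comment> \<open>The derivative of the odd element \<open>s (gvar k)\<close> is even, hence
    central.\<close>
  also have "s b * pd j (s (gvar k)) = pd j (s (gvar k)) * s b"
    using gfilt_even_commute[OF pd_gfilt[of "s (gvar k)" n 0 j]] s[OF k] by (simp add: One_nat_def)
  also have "\<dots> - s (gvar k) * pd j (s b) = pd j (s (gvar k * b))"
    using pd_odd_times[OF s[OF k], of j "s b"] b by (simp add: g ghom_mult[OF assms(1)])
  finally show ?case ..
next
  case (scale c b)
  then show ?case
    by (simp add: ghom_scale[OF assms(1)] pd_scale pd_Lambda gscale_mult_left grassmann.scale_sum_right
        flip: Lambda_supported)
next
  case (add a b)
  then show ?case
    by (simp add: ghom_add[OF assms(1)] pd_add pd_Lambda distrib_right sum.distrib flip: Lambda_supported)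
qed

text \<open>The even elements get a type of their own so that the determinant can be computed over a
  commutative ring.\<close>

typedef (overloaded) ('k::comm_ring_1) geven = "supported (\<lambda>A. even (card A)) :: 'k grassmann set"
  by (rule exI[of _ 0]) simp

setup_lifting type_definition_geven

instantiation geven :: (comm_ring_1) comm_ring_1
begin

lift_definition zero_geven :: "'a geven" is 0 by simp
lift_definition one_geven :: "'a geven" is 1 by (simp add: one_grassmann_def supported_gmono)
lift_definition plus_geven :: "'a geven \<Rightarrow> 'a geven \<Rightarrow> 'a geven" is "(+)" by (rule supported_add)
lift_definition minus_geven :: "'a geven \<Rightarrow> 'a geven \<Rightarrow> 'a geven" is "(-)" by (rule supported_diff)
lift_definition uminus_geven :: "'a geven \<Rightarrow> 'a geven" is uminus by (rule supported_uminus)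
lift_definition times_geven :: "'a geven \<Rightarrow> 'a geven \<Rightarrow> 'a geven" is "(*)"
  by (erule supported_mult, assumption) (simp add: card_Un_disjoint)

instance
proof
  fix a b c :: "'a geven"
  show "a * b = b * a"
  proof transfer
    fix a b :: "'a grassmann"
    assume "a \<in> supported (\<lambda>A. even (card A))"
    then show "a * b = b * a"
    proof (induction rule: supported_induct)
      case (mono c A)
      show ?case
        using mono by (induction b rule: grassmann_induct) (auto simp: gmono_commute[of A] algebra_simps)
    qed (auto simp: algebra_simps)
  qed
qed (transfer; simp add: algebra_simps)+

end

lemma Rep_geven_sum: "Rep_geven (sum f I) = (\<Sum>i\<in>I. Rep_geven (f i))"
  by (induction I rule: infinite_finite_induct) (auto simp: zero_geven.rep_eq plus_geven.rep_eq)

lemma Rep_geven_of_int_sign: "Rep_geven (of_int (sign p) * a) = of_int (sign p) * Rep_geven a"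
  by (simp add: sign_def uminus_geven.rep_eq)

lemma Rep_geven_prod_list: "Rep_geven (prod_list (map f xs)) = prod_list (map (\<lambda>i. Rep_geven (f i)) xs)"
  by (induction xs) (auto simp: one_geven.rep_eq times_geven.rep_eq)

section \<open>The Leibniz determinant over a commutative ring\<close>

definition edet :: "nat \<Rightarrow> (nat \<Rightarrow> nat \<Rightarrow> 'r::comm_ring_1) \<Rightarrow> 'r"
  where "edet n M = (\<Sum>p | p permutes {1..n}. of_int (sign p) * (\<Prod>i=1..n. M i (p i)))"

lemma gdet_edet:
  assumes "\<And>i j. i \<in> {1..n} \<Longrightarrow> j \<in> {1..n} \<Longrightarrow> M i j = Rep_geven (E i j)"
  shows "gdet n M = Rep_geven (edet n E)"
proof -
  have "prod_list (map (\<lambda>i. M i (p i)) [1..<Suc n]) = Rep_geven (\<Prod>i=1..n. E i (p i))"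
    if p: "p permutes {1..n}" for p
  proof -
    have "map (\<lambda>i. M i (p i)) [1..<Suc n] = map (\<lambda>i. Rep_geven (E i (p i))) [1..<Suc n]"
      using assms permutes_in_image[OF p] by (intro map_cong) auto
    moreover have "(\<Prod>i=1..n. E i (p i)) = prod_list (map (\<lambda>i. E i (p i)) [1..<Suc n])"
      by (subst prod.distinct_set_conv_list[symmetric]) (auto intro: prod.cong)
    ultimately show ?thesis by (simp only: Rep_geven_prod_list)
  qed
  then show ?thesis unfolding gdet_def edet_def Rep_geven_sum Rep_geven_of_int_sign
    by (intro sum.cong) auto
qed

lemma edet_rows:
  fixes B :: "nat \<Rightarrow> nat \<Rightarrow> 'r::comm_ring_1"
  assumes "q permutes {1..n}"
  shows "(\<Sum>p | p permutes {1..n}. of_int (sign p) * (\<Prod>i=1..n. B (q i) (p i))) = of_int (sign q) * edet n B"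
proof -
  have "(\<Sum>p | p permutes {1..n}. of_int (sign p) * (\<Prod>i=1..n. B (q i) (p i))) =
      (\<Sum>p | p permutes {1..n}. of_int (sign (p \<circ> q)) * (\<Prod>i=1..n. B (q i) ((p \<circ> q) i)))"
    by (rule sum_permutations_compose_right[OF assms])
  also have "\<dots> = (\<Sum>p | p permutes {1..n}. of_int (sign q) * (of_int (sign p) * (\<Prod>i=1..n. B i (p i))))"
  proof (intro sum.cong refl)
    fix p assume "p \<in> {p. p permutes {1..n}}"
    then have "sign (p \<circ> q) = sign p * sign q"
      using assms by (intro sign_compose) (auto intro: permutation_permutes[THEN iffD2])
    moreover have "(\<Prod>i=1..n. B (q i) ((p \<circ> q) i)) = (\<Prod>i=1..n. B i (p i))"
      using prod.permute[OF assms, of "\<lambda>i. B i (p i)"] by (simp add: o_def)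
    ultimately show "of_int (sign (p \<circ> q)) * (\<Prod>i=1..n. B (q i) ((p \<circ> q) i)) =
        of_int (sign q) * (of_int (sign p) * (\<Prod>i=1..n. B i (p i)))" by (simp add: mult_ac)
  qed
  finally show ?thesis by (simp add: edet_def sum_distrib_left)
qed

text \<open>The transposition of \<open>a\<close> and \<open>b\<close> pairs permutations with
  opposite terms. The comparison of \<open>p a\<close> with \<open>p b\<close> selects one member of
  each pair, so the sum cancels even where two is a zero divisor.\<close>

lemma edet_equal_rows:
  fixes B :: "nat \<Rightarrow> nat \<Rightarrow> 'r::comm_ring_1"
  assumes "a \<in> {1..n}" "b \<in> {1..n}" "a \<noteq> b" "f a = f b"
  shows "(\<Sum>p | p permutes {1..n}. of_int (sign p) * (\<Prod>i=1..n. B (f i) (p i))) = 0"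
proof -
  let ?g = "\<lambda>p. of_int (sign p) * (\<Prod>i=1..n. B (f i) (p i)) :: 'r"
  let ?t = "transpose a b"
  let ?L = "{p. p permutes {1..n} \<and> p a < p b}" and ?R = "{p. p permutes {1..n} \<and> p b < p a}"
  have t: "?t permutes {1..n}" using assms by (intro permutes_swap_id)
  have g: "?g (p \<circ> ?t) = - ?g p" if p: "p permutes {1..n}" for p
  proof -
    have "sign (p \<circ> ?t) = - sign p"
      using p t assms(3) by (subst sign_compose) (auto intro: permutation_permutes[THEN iffD2] simp: sign_swap_id)
    moreover have "(\<Prod>i=1..n. B (f i) ((p \<circ> ?t) i)) = (\<Prod>i=1..n. B (f (?t i)) ((p \<circ> ?t) i))"
      using assms(4) by (intro prod.cong) (auto simp: transpose_def)
    then have "(\<Prod>i=1..n. B (f i) ((p \<circ> ?t) i)) = (\<Prod>i=1..n. B (f i) (p i))"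
      using prod.permute[OF t, of "\<lambda>i. B (f i) (p i)"] by (simp add: o_def)
    ultimately show ?thesis by simp
  qed
  have "p a \<noteq> p b" if "p permutes {1..n}" for p
    using assms(3) permutes_inj[OF that] by (auto dest: injD)
  then have "{p. p permutes {1..n}} = ?L \<union> ?R" by (auto simp: neq_iff)
  moreover have "finite ?L" "finite ?R"
    using finite_permutations[of "{1..n}"] by simp_all
  moreover have "?L \<inter> ?R = {}" by auto
  ultimately have "sum ?g {p. p permutes {1..n}} = sum ?g ?L + sum ?g ?R"
    by (simp only: sum.union_disjoint)
  also have "sum ?g ?R = sum (\<lambda>p. ?g (p \<circ> ?t)) ?L"
    by (rule sum.reindex_bij_witness[of _ "\<lambda>p. p \<circ> ?t" "\<lambda>p. p \<circ> ?t"])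
      (use t assms(3) in \<open>auto simp: permutes_compose comp_assoc\<close>)
  also have "\<dots> = - sum ?g ?L" using g by (simp add: sum_negf)
  finally show ?thesis by simp
qed

text \<open>Expanding every row chooses a function \<open>f\<close> of the row index. If
  \<open>f\<close> is not injective, two rows agree and the term vanishes; the remaining
  \<open>f\<close> are the permutations.\<close>

lemma edet_mult:
  fixes A B :: "nat \<Rightarrow> nat \<Rightarrow> 'r::comm_ring_1"
  shows "edet n (\<lambda>i j. \<Sum>k=1..n. A i k * B k j) = edet n A * edet n B"
proof -
  let ?S = "{1..n}" and ?P = "{p. p permutes {1..n}}"
  let ?D = "\<lambda>f. \<Sum>p\<in>?P. of_int (sign p) * (\<Prod>i=1..n. B (f i) (p i)) :: 'r"
  \<comment> \<open>Functions in \<open>?S \<rightarrow>\<^sub>E ?S\<close> are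
    \<open>undefined\<close> off the index set, permutations are the identity there; restriction
    passes between the two conventions.\<close>
  let ?r = "\<lambda>q. restrict q {1..n} :: nat \<Rightarrow> nat"
  have "edet n (\<lambda>i j. \<Sum>k=1..n. A i k * B k j) =
      (\<Sum>p\<in>?P. \<Sum>f\<in>?S \<rightarrow>\<^sub>E ?S. (\<Prod>i=1..n. A i (f i)) * (of_int (sign p) * (\<Prod>i=1..n. B (f i) (p i))))"
    unfolding edet_def
    by (intro sum.cong refl) (subst prod_sum_PiE, auto simp: sum_distrib_left prod.distrib mult_ac)
  also have "\<dots> = (\<Sum>f\<in>?S \<rightarrow>\<^sub>E ?S. (\<Prod>i=1..n. A i (f i)) * ?D f)"
    by (subst sum.swap) (simp add: sum_distrib_left)
  also have "\<dots> = (\<Sum>f\<in>?r ` ?P. (\<Prod>i=1..n. A i (f i)) * ?D f)"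
  proof (rule sum.mono_neutral_right)
    show "finite (?S \<rightarrow>\<^sub>E ?S)" by (simp add: finite_PiE)
    show "?r ` ?P \<subseteq> ?S \<rightarrow>\<^sub>E ?S" using permutes_in_image by fastforce
    show "\<forall>f\<in>(?S \<rightarrow>\<^sub>E ?S) - ?r ` ?P. (\<Prod>i=1..n. A i (f i)) * ?D f = 0"
    proof
      fix f assume f: "f \<in> (?S \<rightarrow>\<^sub>E ?S) - ?r ` ?P"
      have "\<not> inj_on f ?S"
      proof
        assume inj: "inj_on f ?S"
        let ?q = "\<lambda>i. if i \<in> ?S then f i else i"
        have "f ` ?S = ?S" using inj f by (intro endo_inj_surj) auto
        then have "bij_betw f ?S ?S" using inj by (simp only: bij_betw_def simp_thms)
        moreover have "bij_betw ?q ?S ?S = bij_betw f ?S ?S" by (rule bij_betw_cong) simp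
        ultimately have "bij_betw ?q ?S ?S" by blast
        then have "?q permutes ?S" by (rule bij_imp_permutes) (simp only: if_False)
        moreover have "f = ?r ?q" using f by (auto simp: fun_eq_iff PiE_def extensional_def)
        ultimately show False using f by blast
      qed
      then obtain a b where "a \<in> ?S" "b \<in> ?S" "a \<noteq> b" "f a = f b" by (auto simp: inj_on_def)
      then show "(\<Prod>i=1..n. A i (f i)) * ?D f = 0" by (simp only: edet_equal_rows mult_zero_right)
    qed
  qed
  also have "\<dots> = (\<Sum>q\<in>?P. (\<Prod>i=1..n. A i (?r q i)) * ?D (?r q))"
  proof (rule sum.reindex_cong[OF _ refl refl])
    show "inj_on ?r ?P"
    proof (rule inj_onI)
      fix p q assume "p \<in> ?P" "q \<in> ?P" and e: "?r p = ?r q"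
      then have "p i = i" "q i = i" if "i \<notin> ?S" for i using that by (auto dest: permutes_not_in)
      moreover have "p i = q i" if "i \<in> ?S" for i using fun_cong[OF e, of i] that by simp
      ultimately show "p = q" by (metis ext)
    qed
  qed
  also have "\<dots> = (\<Sum>q\<in>?P. (\<Prod>i=1..n. A i (q i)) * (of_int (sign q) * edet n B))"
  proof (intro sum.cong refl)
    fix q assume "q \<in> ?P"
    then have "?D q = of_int (sign q) * edet n B" by (intro edet_rows) simp
    moreover have "?D (?r q) = ?D q" by (intro sum.cong arg_cong2[of _ _ _ _ "(*)"] prod.cong) auto
    moreover have "(\<Prod>i=1..n. A i (?r q i)) = (\<Prod>i=1..n. A i (q i))" by (intro prod.cong) auto
    ultimately show "(\<Prod>i=1..n. A i (?r q i)) * ?D (?r q) = (\<Prod>i=1..n. A i (q i)) * (of_int (sign q) * edet n B)"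
      by simp
  qed
  also have "\<dots> = edet n A * edet n B"
    unfolding edet_def[of n A] sum_distrib_right by (intro sum.cong) (simp_all add: mult_ac)
  finally show ?thesis .
qed

lemma gdet_mult:
  assumes "\<And>i j. i \<in> {1..n} \<Longrightarrow> j \<in> {1..n} \<Longrightarrow> A i j \<in> gfilt n 0"
    and "\<And>i j. i \<in> {1..n} \<Longrightarrow> j \<in> {1..n} \<Longrightarrow> B i j \<in> gfilt n 0"
  shows "gdet n (\<lambda>i j. \<Sum>k=1..n. A i k * B k j) = gdet n A * gdet n B"
proof -
  have sub: "a \<in> supported (\<lambda>A. even (card A))" if "a \<in> gfilt n 0" for a :: "'a grassmann"
    using that unfolding gfilt_def by (rule supported_mono) simp
  let ?A = "\<lambda>i j. Abs_geven (A i j)" and ?B = "\<lambda>i j. Abs_geven (B i j)"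
  have A: "A i j = Rep_geven (?A i j)" if "i \<in> {1..n}" "j \<in> {1..n}" for i j
    using assms(1)[OF that] sub by (simp add: Abs_geven_inverse)
  have B: "B i j = Rep_geven (?B i j)" if "i \<in> {1..n}" "j \<in> {1..n}" for i j
    using assms(2)[OF that] sub by (simp add: Abs_geven_inverse)
  have "gdet n (\<lambda>i j. \<Sum>k=1..n. A i k * B k j) = Rep_geven (edet n (\<lambda>i j. \<Sum>k=1..n. ?A i k * ?B k j))"
    by (rule gdet_edet) (auto simp: Rep_geven_sum times_geven.rep_eq simp flip: A B intro!: sum.cong)
  also have "\<dots> = Rep_geven (edet n ?A) * Rep_geven (edet n ?B)"
    by (simp add: edet_mult times_geven.rep_eq)
  finally show ?thesis by (simp only: gdet_edet[of n A ?A, OF A] gdet_edet[of n B ?B, OF B])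
qed

lemma gdet_cong:
  assumes "\<And>i j. i \<in> {1..n} \<Longrightarrow> j \<in> {1..n} \<Longrightarrow> A i j = B i j"
  shows "gdet n A = gdet n B"
  unfolding gdet_def
proof (intro sum.cong refl)
  fix p assume "p \<in> {p. p permutes {1..n}}"
  then have "p i \<in> {1..n}" if "i \<in> {1..n}" for i using that permutes_in_image[of p "{1..n}"] by auto
  then have "map (\<lambda>i. A i (p i)) [1..<Suc n] = map (\<lambda>i. B i (p i)) [1..<Suc n]"
    using assms by (intro map_cong) auto
  then show "of_int (sign p) * prod_list (map (\<lambda>i. A i (p i)) [1..<Suc n]) =
      of_int (sign p) * prod_list (map (\<lambda>i. B i (p i)) [1..<Suc n])" by (simp only:)
qed

section \<open>The Jacobian of a composition\<close>

lemma ghom_prod_list: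
  assumes "ghom n s" "\<And>i. i \<in> set xs \<Longrightarrow> f i \<in> Lambda n"
  shows "prod_list (map f xs) \<in> Lambda n" "s (prod_list (map f xs)) = prod_list (map (\<lambda>i. s (f i)) xs)"
  using assms(2) by (induction xs) (auto simp: Lambda_1 Lambda_mult ghom_1[OF assms(1)] ghom_mult[OF assms(1)])

lemma ghom_gdet:
  assumes "ghom n s" "\<And>i j. i \<in> {1..n} \<Longrightarrow> j \<in> {1..n} \<Longrightarrow> M i j \<in> Lambda n"
  shows "s (gdet n M) = gdet n (\<lambda>i j. s (M i j))"
proof -
  have *: "prod_list (map (\<lambda>i. M i (p i)) [1..<Suc n]) \<in> Lambda n"
    "s (prod_list (map (\<lambda>i. M i (p i)) [1..<Suc n])) = prod_list (map (\<lambda>i. s (M i (p i))) [1..<Suc n])"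
    if p: "p permutes {1..n}" for p
    using assms(2) permutes_in_image[OF p] by (intro ghom_prod_list[OF assms(1)]; auto)+
  have **: "of_int (sign p) * a \<in> Lambda n" "s (of_int (sign p) * a) = of_int (sign p) * s a"
    if "a \<in> Lambda n" for p :: "nat \<Rightarrow> nat" and a
    using that by (auto simp: sign_def Lambda_uminus ghom_uminus[OF assms(1)])
  have "s (gdet n M) = (\<Sum>p | p permutes {1..n}. s (of_int (sign p) * prod_list (map (\<lambda>i. M i (p i)) [1..<Suc n])))"
    unfolding gdet_def by (rule ghom_sum[OF assms(1)]) (use * ** in blast)
  also have "\<dots> = gdet n (\<lambda>i j. s (M i j))"
    unfolding gdet_def using * ** by (intro sum.cong) auto
  finally show ?thesis .
qed

lemma jacobian_pd: "ghom n s \<Longrightarrow> jacobian n s = gdet n (\<lambda>i j. pd j (s (gvar i)))"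
  unfolding jacobian_def by (rule gdet_cong) (simp add: partial_eq ghom_Lambda Lambda_gvar)

text \<open>By the chain rule the matrix of the composite is the matrix of \<open>t\<close>
  transported by \<open>s\<close>, times that of \<open>s\<close>. As \<open>s 1 = 1\<close>, this
  cocycle rule makes Jacobian one stable under composition.\<close>

lemma jacobian_compose:
  assumes "s \<in> Gamma_group n" "t \<in> Gamma_group n"
  shows "jacobian n (compose (Lambda n) s t) = s (jacobian n t) * jacobian n s"
proof -
  note hs = Gamma_ghom[OF assms(1)] and ht = Gamma_ghom[OF assms(2)]
  have ev: "pd j (u (gvar i)) \<in> gfilt n 0" if "u \<in> Gamma_group n" "i \<in> {1..n}" for u i j
    using pd_gfilt[of "u (gvar i)" n 0 j] Gamma_gvar[OF that] by (simp add: One_nat_def)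
  have chain: "pd j (s (t (gvar i))) = (\<Sum>k=1..n. s (pd k (t (gvar i))) * pd j (s (gvar k)))"
    if "i \<in> {1..n}" for i j
    using that by (intro pd_chain hs Gamma_gvar assms ghom_Lambda[OF ht] Lambda_gvar)
  have "jacobian n (compose (Lambda n) s t) = gdet n (\<lambda>i j. \<Sum>k=1..n. s (pd k (t (gvar i))) * pd j (s (gvar k)))"
    unfolding jacobian_pd[OF ghom_compose[OF hs ht]]
    by (rule gdet_cong)
      (simp only: compose_eq Lambda_gvar chain)
  also have "\<dots> = gdet n (\<lambda>i k. s (pd k (t (gvar i)))) * gdet n (\<lambda>k j. pd j (s (gvar k)))"
    using ev assms Gamma_gfilt by (intro gdet_mult) blast+
  also have "gdet n (\<lambda>i k. s (pd k (t (gvar i)))) = s (gdet n (\<lambda>i k. pd k (t (gvar i))))"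
    using ghom_Lambda[OF ht] by (intro ghom_gdet[OF hs, symmetric]) (simp add: pd_Lambda Lambda_gvar)
  finally show ?thesis by (simp add: jacobian_pd hs ht)
qed

lemma Sigma_compose:
  "s \<in> Sigma_group n \<Longrightarrow> t \<in> Sigma_group n \<Longrightarrow> compose (Lambda n) s t \<in> Sigma_group n"
  using ghom_1[OF Gamma_ghom, of s n] by (simp add: Sigma_group_def Gamma_compose jacobian_compose)

section \<open>Determinants close to the identity matrix\<close>

lemma prod_list_zero: "(0::'a::ring_1) \<in> set xs \<Longrightarrow> prod_list xs = 0"
  by (induction xs) auto

text \<open>Takes the place of triangularity, which for the matrices of the elementary automorphisms
  may require a rearrangement of the indices; the present condition does not depend on their
  order.\<close>

lemma gdet_diagonal:
  assumes "\<And>p. p permutes {1..n} \<Longrightarrow> p \<noteq> id \<Longrightarrow> \<exists>i\<in>{1..n}. M i (p i) = 0"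
  shows "gdet n M = prod_list (map (\<lambda>i. M i i) [1..<Suc n])"
proof -
  have "gdet n M = (\<Sum>p | p permutes {1..n}. if p = id then prod_list (map (\<lambda>i. M i i) [1..<Suc n]) else 0)"
    unfolding gdet_def
  proof (intro sum.cong refl)
    fix p assume p: "p \<in> {p. p permutes {1..n}}"
    show "of_int (sign p) * prod_list (map (\<lambda>i. M i (p i)) [1..<Suc n]) =
        (if p = id then prod_list (map (\<lambda>i. M i i) [1..<Suc n]) else 0)"
    proof (cases "p = id")
      case False
      then obtain i where "i \<in> {1..n}" "M i (p i) = 0" using assms[of p] p by blast
      moreover from this have "M i (p i) \<in> set (map (\<lambda>i. M i (p i)) [1..<Suc n])"
        unfolding set_map by (intro imageI) auto
      ultimately have "0 \<in> set (map (\<lambda>i. M i (p i)) [1..<Suc n])" by (simp only:)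
      from prod_list_zero[OF this] show ?thesis using False by (simp del: upt_Suc)
    qed (simp add: sign_id)
  qed
  also have "\<dots> = prod_list (map (\<lambda>i. M i i) [1..<Suc n])"
    by (simp add: finite_permutations permutes_id)
  finally show ?thesis .
qed

lemma prod_list_one_plus:
  assumes "u * u = (0 :: 'k::comm_ring_1 grassmann)"
  shows "prod_list (map (\<lambda>i. 1 + c i \<cdot> u) xs) = 1 + sum_list (map c xs) \<cdot> u"
  using assms
  by (induction xs) (simp_all add: algebra_simps gscale_mult_left gscale_mult_right grassmann.scale_left_distrib)

lemma prod_list_filtration:
  assumes "even e" "\<And>i. i \<in> set xs \<Longrightarrow> f i \<in> gfilt n (if P i then e else 0)"
  shows "prod_list (map f xs) \<in> gfilt n (e * length (filter P xs))"
  using assms(2)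
proof (induction xs)
  case (Cons i xs)
  then have "f i * prod_list (map f xs) \<in> gfilt n ((if P i then e else 0) + e * length (filter P xs))"
    by (intro gfilt_mult) auto
  then show ?case by (auto split: if_splits)
qed simp

text \<open>Products of two of the \<open>N i\<close> already lie in degree \<open>2 * e\<close>;
  evenness of \<open>e\<close> gives the longer products the parity demanded by
  \<open>gfilt\<close>.\<close>

lemma prod_list_one_plus_filtration:
  assumes "even e" "\<And>i. i \<in> set xs \<Longrightarrow> N i \<in> gfilt n e"
  shows "prod_list (map (\<lambda>i. 1 + N i) xs) - (1 + sum_list (map N xs)) \<in> gfilt n (2 * e)"
  using assms(2)
proof (induction xs)
  case (Cons i xs)
  let ?p = "prod_list (map (\<lambda>i. 1 + N i) xs)" and ?s = "sum_list (map N xs)"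
  have e: "?p - (1 + ?s) \<in> gfilt n (2 * e)" using Cons by simp
  have s: "?s \<in> gfilt n e" using Cons(2) by (induction xs) (auto intro: gfilt_add)
  have "N i * (?p - (1 + ?s)) \<in> gfilt n (e + 2 * e)" using Cons(2) e by (intro gfilt_mult) auto
  then have "N i * (?p - (1 + ?s)) \<in> gfilt n (2 * e)" using assms(1) by (elim gfilt_antimono) auto
  moreover have "N i * ?s \<in> gfilt n (e + e)" using Cons(2) s by (intro gfilt_mult) auto
  ultimately have "(?p - (1 + ?s)) + N i * (?p - (1 + ?s)) + N i * ?s \<in> gfilt n (2 * e)"
    using e by (intro gfilt_add) (simp_all add: mult_2)
  then show ?case by (simp add: algebra_simps)
qed simp

text \<open>A permutation other than the identity picks up at least two off-diagonal factors, so to leading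
  order only the divergence survives.\<close>

lemma coeff_jacobian:
  assumes "ghom n s" "\<And>i. i \<in> {1..n} \<Longrightarrow> s (gvar i) - gvar i \<in> gfilt n (Suc e)"
    and e: "even e" "0 < e" and "card B = e"
  shows "coeff (jacobian n s) B = (\<Sum>i=1..n. coeff (pd i (s (gvar i) - gvar i)) B)"
proof -
  let ?N = "\<lambda>i j. pd j (s (gvar i) - gvar i)"
  let ?M = "\<lambda>i j. pd j (s (gvar i))"
  let ?T = "\<lambda>p. prod_list (map (\<lambda>i. ?M i (p i)) [1..<Suc n])"
  have N: "?N i j \<in> gfilt n e" if "i \<in> {1..n}" for i j using pd_gfilt[OF assms(2)[OF that]] .
  have M: "?M i j = (if i = j then 1 else 0) + ?N i j" for i j by (simp add: pd_diff pd_gvar)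
  have "coeff (of_int (sign p) * ?T p) B = (if p = id then coeff (?T id) B else 0)"
    if p: "p permutes {1..n}" for p
  proof (cases "p = id")
    case False
    then obtain a where a: "p a \<noteq> a" by (auto simp: fun_eq_iff)
    then have a': "a \<in> {1..n}" "p a \<in> {1..n}" "p (p a) \<noteq> p a"
      using permutes_not_in[OF p] permutes_in_image[OF p] permutes_inj[OF p] by (auto dest: injD)
    let ?F = "filter (\<lambda>i. p i \<noteq> i) [1..<Suc n]"
    have "card {a, p a} \<le> card (set ?F)" using a a' by (intro card_mono) (auto simp del: upt_Suc)
    also have "\<dots> = length ?F" by (rule distinct_card) simp
    finally have 2: "2 \<le> length ?F" using a by (simp add: card_insert_if)
    have "?T p \<in> gfilt n (e * length ?F)"
    proof (rule prod_list_filtration[OF e(1)])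
      fix i assume "i \<in> set [1..<Suc n]"
      then have i: "i \<in> {1..n}" by auto
      show "?M i (p i) \<in> gfilt n (if p i \<noteq> i then e else 0)"
        using N[OF i, of "p i"] gfilt_antimono[OF N[OF i, of i], of 0] e
        by (auto simp: M intro: gfilt_add)
    qed
    then have "coeff (?T p) B = 0"
      using assms(5) e 2 mult_le_mono2[OF 2, of e] by (intro gfilt_coeff) auto
    then show ?thesis using False by (auto simp: sign_def)
  qed (simp add: sign_id)
  then have "coeff (jacobian n s) B = (\<Sum>p | p permutes {1..n}. if p = id then coeff (?T id) B else 0)"
    unfolding jacobian_pd[OF assms(1)] gdet_def coeff_sum by (intro sum.cong) auto
  also have "\<dots> = coeff (?T id) B" by (simp add: finite_permutations permutes_id)
  also have "?T id = prod_list (map (\<lambda>i. 1 + ?N i i) [1..<Suc n])" by (simp add: M)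
  also have "coeff \<dots> B = coeff (1 + sum_list (map (\<lambda>i. ?N i i) [1..<Suc n])) B"
  proof -
    have "prod_list (map (\<lambda>i. 1 + ?N i i) [1..<Suc n]) - (1 + sum_list (map (\<lambda>i. ?N i i) [1..<Suc n])) \<in> gfilt n (2 * e)"
      using N by (intro prod_list_one_plus_filtration e) auto
    from gfilt_coeff[OF this, of B] show ?thesis using assms(5) e by simp
  qed
  also have "sum_list (map (\<lambda>i. ?N i i) [1..<Suc n]) = (\<Sum>i=1..n. ?N i i)"
    by (subst sum.distinct_set_conv_list[symmetric]) (auto intro: sum.cong)
  also have "coeff (1 + (\<Sum>i=1..n. ?N i i)) B = (\<Sum>i=1..n. coeff (?N i i) B)"
    using assms(5) e by (auto simp: coeff_sum one_grassmann_def coeff_gmono)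
  finally show ?thesis .
qed

section \<open>The elementary automorphisms\<close>

text \<open>As \<open>u\<close> avoids \<open>gvar i\<close>, the substitution fixes
  \<open>u\<close>, and negating \<open>u\<close> gives the inverse.\<close>

lemma
  assumes "i \<in> {1..n}" "u \<in> gfilt n 3" "u \<in> span_on ({1..n} - {i})"
  shows sigma_Gamma: "sigma n i u \<in> Gamma_group n"
    and sigma_gvar: "k \<in> {1..n} \<Longrightarrow> sigma n i u (gvar k) = (if k = i then gvar i + u else gvar k)"
proof -
  let ?y = "\<lambda>v k. if k = i then gvar i + v else gvar k"
  have y: "?y v k \<in> gfilt n 1" if "k \<in> {1..n}" "v \<in> gfilt n 3" for v :: "'a grassmann" and k
    using that gfilt_gvar[of k n] gfilt_antimono[of v n 3 1] by (auto intro: gfilt_add)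
  have inv: "gsubst n (?y v) (?y (- v) k) = gvar k"
    if "k \<in> {1..n}" "v \<in> gfilt n 3" "v \<in> span_on ({1..n} - {i})" for v :: "'a grassmann" and k
  proof -
    have h: "ghom n (gsubst n (?y v))" and val: "\<And>k. k \<in> {1..n} \<Longrightarrow> gsubst n (?y v) (gvar k) = ?y v k"
      by (rule ghom_gsubst[of n "?y v", OF y[OF _ that(2)]]; assumption)+
    have "gsubst n (?y v) v = v"
      by (rule ghom_fix[OF h _ _ that(3)]) (use val in auto)
    moreover have "v \<in> Lambda n" using gfilt_Lambda that(2) .
    moreover note Lambda_gvar[OF assms(1), where 'a = 'a]
    ultimately show ?thesis
      using that(1) assms(1) val by (simp add: ghom_diff[OF h])
  qed
  note nu = gfilt_uminus[OF assms(2)] supported_uminus[OF assms(3)]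
  have aut: "gsubst n (?y u) \<in> algebra_aut n"
    by (rule algebra_aut_gsubst[of n "?y u" "?y (- u)"])
      (rule y[OF _ assms(2)] y[OF _ nu(1)] inv[OF _ assms(2,3)] inv[OF _ nu, unfolded minus_minus], assumption)+
  have val: "\<And>k. k \<in> {1..n} \<Longrightarrow> gsubst n (?y u) (gvar k) = ?y u k"
    by (rule ghom_gsubst(2)[of n "?y u", OF y[OF _ assms(2)]])
  have e: "sigma n i u = gsubst n (?y u)"
    unfolding sigma_def by (rule aut_of_eq[OF aut val])
  show v: "sigma n i u (gvar k) = (if k = i then gvar i + u else gvar k)" if "k \<in> {1..n}" for k
    unfolding e by (rule val[OF that])
  show "sigma n i u \<in> Gamma_group n"
    using aut assms(2) v unfolding Gamma_group_iff e[symmetric] by auto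
qed

text \<open>If \<open>u\<close> avoids the variables in \<open>I = {i, j}\<close> and squares to
  zero, then \<open>(1 + u) * (1 - u) = 1\<close>. This makes the substitution with
  \<open>- u\<close> the inverse of \<open>rho n i j u\<close> and its Jacobian exactly one.\<close>

definition square_zero_off :: "nat \<Rightarrow> nat set \<Rightarrow> 'k::comm_ring_1 grassmann set"
  where "square_zero_off n I = {u \<in> gfilt n 2. u \<in> span_on ({1..n} - I) \<and> u * u = 0}"

lemma square_zero_off_gmono:
  assumes "A \<subseteq> {1..n} - I" "even (card A)" "2 \<le> card A"
  shows "gmono c A \<in> square_zero_off n I"
proof -
  have "finite A" "A \<noteq> {}" using assms finite_subset[of A "{1..n} - I"] by auto
  then show ?thesis using assms
    by (auto simp: square_zero_off_def gmono_times intro!: gfilt_gmono supported_gmono)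
qed

lemma
  assumes "i \<in> {1..n}" "j \<in> {1..n}" "i \<noteq> j" "u \<in> square_zero_off n {i, j}"
  shows rho_Gamma: "rho n i j u \<in> Gamma_group n"
    and rho_gvar: "k \<in> {1..n} \<Longrightarrow> rho n i j u (gvar k) =
      (if k = i then gvar i * (1 + u) else if k = j then gvar j * (1 - u) else gvar k)"
proof -
  let ?y = "\<lambda>v k. if k = i then gvar i * (1 + v) else if k = j then gvar j * (1 - v) else gvar k"
  have dy: "gvar k * v \<in> gfilt n 3" if "k \<in> {1..n}" "v \<in> gfilt n 2" for v :: "'a grassmann" and k
    using gfilt_mult[OF gfilt_gvar[OF that(1)] that(2)] by simp
  have y: "?y v k \<in> gfilt n 1" if "k \<in> {1..n}" "v \<in> square_zero_off n {i, j}" for v :: "'a grassmann" and k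
    using that gfilt_gvar[of k n] gfilt_antimono[OF dy, of k v 1]
    by (auto intro!: gfilt_add gfilt_diff simp: square_zero_off_def distrib_left right_diff_distrib)
  have inv: "gsubst n (?y v) (?y (- v) k) = gvar k"
    if k: "k \<in> {1..n}" and v: "v \<in> square_zero_off n {i, j}" for v :: "'a grassmann" and k
  proof -
    have h: "ghom n (gsubst n (?y v))" and val: "\<And>k. k \<in> {1..n} \<Longrightarrow> gsubst n (?y v) (gvar k) = ?y v k"
      by (rule ghom_gsubst[of n "?y v", OF y[OF _ v]]; assumption)+
    have f: "gsubst n (?y v) v = v"
      by (rule ghom_fix[OF h, of "{1..n} - {i, j}"]) (use val v in \<open>auto simp: square_zero_off_def\<close>)
    have L: "v \<in> Lambda n" "1 + v \<in> Lambda n" "1 - v \<in> Lambda n" and sq: "v * v = 0"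
      using v gfilt_Lambda[of v n 2] by (auto simp: square_zero_off_def intro: Lambda_add Lambda_diff Lambda_1)
    have "(1 + v) * (1 - v) = 1" "(1 - v) * (1 + v) = 1" using sq by (simp_all add: algebra_simps)
    then show ?thesis
      using k assms(1-3) val f L
      by (auto simp: ghom_mult[OF h] ghom_diff[OF h] ghom_add[OF h] Lambda_gvar Lambda_1 ghom_1[OF h] mult.assoc)
  qed
  have nu: "- u \<in> square_zero_off n {i, j}"
    using assms(4) by (auto simp: square_zero_off_def gfilt_uminus supported_uminus)
  have aut: "gsubst n (?y u) \<in> algebra_aut n"
    by (rule algebra_aut_gsubst[of n "?y u" "?y (- u)"])
      (rule y[OF _ assms(4)] y[OF _ nu] inv[OF _ assms(4)] inv[OF _ nu, unfolded minus_minus], assumption)+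
  have val: "\<And>k. k \<in> {1..n} \<Longrightarrow> gsubst n (?y u) (gvar k) = ?y u k"
    by (rule ghom_gsubst(2)[of n "?y u", OF y[OF _ assms(4)]])
  have e: "rho n i j u = gsubst n (?y u)"
    unfolding rho_def by (rule aut_of_eq[OF aut val])
  show v: "rho n i j u (gvar k) =
      (if k = i then gvar i * (1 + u) else if k = j then gvar j * (1 - u) else gvar k)" if "k \<in> {1..n}" for k
    unfolding e by (rule val[OF that])
  show "rho n i j u \<in> Gamma_group n"
    using aut dy assms unfolding Gamma_group_iff e[symmetric]
    by (auto simp: v square_zero_off_def distrib_left right_diff_distrib gfilt_uminus)
qed

lemma sigma_fix:
  assumes "i \<in> {1..n}" "u \<in> gfilt n 3" "u \<in> span_on ({1..n} - {i})" "a \<in> span_on ({1..n} - {i})"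
  shows "sigma n i u a = a"
  by (rule ghom_fix[OF Gamma_ghom[OF sigma_Gamma[OF assms(1-3)]] _ _ assms(4)])
    (use sigma_gvar[OF assms(1-3)] in auto)

lemma rho_fix:
  assumes "i \<in> {1..n}" "j \<in> {1..n}" "i \<noteq> j" "u \<in> square_zero_off n {i, j}" "a \<in> span_on ({1..n} - {i, j})"
  shows "rho n i j u a = a"
  by (rule ghom_fix[OF Gamma_ghom[OF rho_Gamma[OF assms(1-4)]] _ _ assms(5)])
    (use rho_gvar[OF assms(1-4)] in auto)

section \<open>Composition rules for the elementary automorphisms\<close>

lemma sigma_add:
  assumes "i \<in> {1..n}" "u \<in> gfilt n 3" "u \<in> span_on ({1..n} - {i})" "v \<in> gfilt n 3" "v \<in> span_on ({1..n} - {i})"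
  shows "compose (Lambda n) (sigma n i u) (sigma n i v) = sigma n i (u + v)"
proof -
  note uv = gfilt_add[OF assms(2,4)] supported_add[OF assms(3,5)]
  have h: "ghom n (sigma n i u)" by (rule Gamma_ghom[OF sigma_Gamma[OF assms(1-3)]])
  have L: "v \<in> Lambda n" using gfilt_Lambda assms(4) .
  show ?thesis
    by (rule ghom_eqI[OF Gamma_ghom[OF Gamma_compose[OF sigma_Gamma[OF assms(1-3)] sigma_Gamma[OF assms(1,4,5)]]]
          Gamma_ghom[OF sigma_Gamma[OF assms(1) uv]]])
      (use assms(1) L in \<open>auto simp: compose_eq Lambda_gvar sigma_gvar[OF assms(1) uv] sigma_gvar[OF assms(1,4,5)]
          sigma_gvar[OF assms(1-3)] ghom_add[OF h] sigma_fix[OF assms(1-3,5)] add.assoc\<close>)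
qed

text \<open>The factor at \<open>gvar q\<close> is \<open>(1 - u) * (1 + u) = 1\<close>, so the
  middle index drops out. For fixed \<open>u\<close> the maps \<open>rho n p q u\<close> thus
  compose like differences of unit vectors.\<close>

lemma rho_chain:
  assumes "p \<in> {1..n}" "q \<in> {1..n}" "r \<in> {1..n}" "p \<noteq> q" "q \<noteq> r" "p \<noteq> r" "u \<in> square_zero_off n {p, q, r}"
  shows "compose (Lambda n) (rho n p q u) (rho n q r u) = rho n p r u"
proof -
  have u: "u \<in> square_zero_off n {p, q}" "u \<in> square_zero_off n {q, r}" "u \<in> square_zero_off n {p, r}"
    using assms(7) by (auto simp: square_zero_off_def elim!: supported_mono)
  note pq = assms(1,2,4) u(1) and qr = assms(2,3,5) u(2) and pr = assms(1,3,6) u(3)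
  have h: "ghom n (rho n p q u)" by (rule Gamma_ghom[OF rho_Gamma[OF pq]])
  have f: "rho n p q u u = u" by (rule rho_fix[OF pq]) (use u in \<open>simp add: square_zero_off_def\<close>)
  have L: "u \<in> Lambda n" "1 + u \<in> Lambda n" "1 - u \<in> Lambda n" and sq: "u * u = 0"
    using u gfilt_Lambda[of u n 2] by (auto simp: square_zero_off_def intro: Lambda_add Lambda_diff Lambda_1)
  have sq': "(1 - u) * (1 + u) = 1" using sq by (simp_all add: algebra_simps)
  have "rho n p q u (rho n q r u (gvar k)) = rho n p r u (gvar k)" if "k \<in> {1..n}" for k
    using that assms(1-6) L f sq'
    by (auto simp: rho_gvar[OF pq] rho_gvar[OF qr] rho_gvar[OF pr] ghom_mult[OF h] ghom_diff[OF h] ghom_add[OF h]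
        Lambda_gvar Lambda_1 ghom_1[OF h] mult.assoc)
  then show ?thesis
    by (intro ghom_eqI[OF Gamma_ghom[OF Gamma_compose[OF rho_Gamma[OF pq] rho_Gamma[OF qr]]] Gamma_ghom[OF rho_Gamma[OF pr]]])
      (simp add: compose_eq Lambda_gvar)
qed

text \<open>With \<open>u * v = 0\<close> the mixed term of \<open>(1 + u) * (1 + v)\<close>
  disappears. Multiples of one nonempty monomial satisfy this, which makes the families additive in
  the parameter.\<close>

lemma rho_add:
  assumes "p \<in> {1..n}" "q \<in> {1..n}" "p \<noteq> q" "u \<in> square_zero_off n {p, q}" "v \<in> square_zero_off n {p, q}" "u * v = 0"
  shows "compose (Lambda n) (rho n p q u) (rho n p q v) = rho n p q (u + v)"
proof -
  have "v * u = 0" using gfilt_even_commute[OF gfilt_antimono[of v n 2 0], of u] assms(5,6)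
    by (simp add: square_zero_off_def)
  then have uv: "u + v \<in> square_zero_off n {p, q}"
    using assms(4-6) by (auto simp: square_zero_off_def algebra_simps gfilt_add supported_add)
  note U = assms(1-4) and V = assms(1-3,5) and W = assms(1-3) uv
  have h: "ghom n (rho n p q u)" by (rule Gamma_ghom[OF rho_Gamma[OF U]])
  have f: "rho n p q u v = v" by (rule rho_fix[OF U]) (use V in \<open>simp add: square_zero_off_def\<close>)
  have L: "v \<in> Lambda n" "1 + v \<in> Lambda n" "1 - v \<in> Lambda n"
    using V gfilt_Lambda[of v n 2] by (auto simp: square_zero_off_def intro: Lambda_add Lambda_diff Lambda_1)
  have "(1 + u) * (1 + v) = 1 + (u + v)" "(1 - u) * (1 - v) = 1 - (u + v)"
    using assms(6) by (simp_all add: algebra_simps)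
  then have "rho n p q u (rho n p q v (gvar k)) = rho n p q (u + v) (gvar k)" if "k \<in> {1..n}" for k
    using that assms(1-3) L f
    by (auto simp: rho_gvar[OF U] rho_gvar[OF V] rho_gvar[OF W] ghom_mult[OF h] ghom_diff[OF h] ghom_add[OF h]
        Lambda_gvar Lambda_1 ghom_1[OF h] mult.assoc)
  then show ?thesis
    by (intro ghom_eqI[OF Gamma_ghom[OF Gamma_compose[OF rho_Gamma[OF U] rho_Gamma[OF V]]] Gamma_ghom[OF rho_Gamma[OF W]]])
      (simp add: compose_eq Lambda_gvar)
qed

section \<open>Elementary automorphisms have Jacobian one\<close>

lemma permutes_moves_two:
  assumes "p permutes S" "p \<noteq> id"
  obtains a where "a \<in> S" "p a \<in> S" "p a \<noteq> a" "p (p a) \<noteq> p a"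
proof -
  obtain a where a: "p a \<noteq> a" using assms(2) by (auto simp: fun_eq_iff)
  then have "a \<in> S" "p a \<in> S" "p (p a) \<noteq> p a"
    using permutes_not_in[OF assms(1)] permutes_in_image[OF assms(1)] permutes_inj[OF assms(1)] by (auto dest: injD)
  then show ?thesis using a that by blast
qed

lemma sigma_Sigma:
  assumes "i \<in> {1..n}" "u \<in> gfilt n 3" "u \<in> span_on ({1..n} - {i})"
  shows "sigma n i u \<in> Sigma_group n"
proof -
  note S = sigma_Gamma[OF assms] sigma_gvar[OF assms]
  let ?M = "\<lambda>k l. pd l (sigma n i u (gvar k))"
  have "jacobian n (sigma n i u) = prod_list (map (\<lambda>k. ?M k k) [1..<Suc n])"
    unfolding jacobian_pd[OF Gamma_ghom[OF S(1)]]
  proof (rule gdet_diagonal)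
    fix p assume "p permutes {1..n}" "p \<noteq> id"
    then obtain a where a: "a \<in> {1..n}" "p a \<in> {1..n}" "p a \<noteq> a" "p (p a) \<noteq> p a" by (rule permutes_moves_two)
    \<comment> \<open>Only row \<open>i\<close> differs from the identity matrix. Of the two moved
      points \<open>a\<close> and \<open>p a\<close> one is not \<open>i\<close>, and its row
      contributes a zero.\<close>
    show "\<exists>k\<in>{1..n}. ?M k (p k) = 0"
    proof (cases "a = i")
      case True
      then show ?thesis using a by (intro bexI[of _ "p a"]) (auto simp: S pd_gvar)
    next
      case False
      then show ?thesis using a by (intro bexI[of _ a]) (auto simp: S pd_gvar)
    qed
  qed
  \<comment> \<open>The diagonal entries are all \<open>1\<close>, written in the shape that
    \<open>prod_list_one_plus\<close> expects.\<close>
  also have "map (\<lambda>k. ?M k k) [1..<Suc n] = map (\<lambda>k. 1 + 0 \<cdot> 0) [1..<Suc n]"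
    using pd_span_on[OF assms(3)] by (intro map_cong) (auto simp: S pd_gvar pd_add)
  also have "prod_list \<dots> = 1" by (subst prod_list_one_plus) simp_all
  finally show ?thesis using S(1) by (simp add: Sigma_group_def)
qed

lemma rho_Sigma:
  assumes "i \<in> {1..n}" "j \<in> {1..n}" "i \<noteq> j" "u \<in> square_zero_off n {i, j}"
  shows "rho n i j u \<in> Sigma_group n"
proof -
  note S = rho_Gamma[OF assms] rho_gvar[OF assms]
  let ?M = "\<lambda>k l. pd l (rho n i j u (gvar k))"
  \<comment> \<open>The diagonal entries are \<open>1 + ?c k \<cdot> u\<close>. As
    \<open>u * u = 0\<close>, their product depends only on the sum of the \<open>?c k\<close>,
    which is zero.\<close>
  let ?c = "\<lambda>k. if k = i then 1 else if k = j then - 1 else 0 :: 'a"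
  have u: "u \<in> span_on ({1..n} - {i, j})" "u * u = 0" using assms(4) by (simp_all add: square_zero_off_def)
  have pdu: "pd l u = 0" if "l \<in> {i, j}" for l using pd_span_on[OF u(1)] that by auto
  have pdv: "pd l (gvar k * (1 + u)) = (if k = l then 1 + u else 0)"
      "pd l (gvar k * (1 - u)) = (if k = l then 1 - u else 0)" if "l \<in> {i, j}" "k \<in> {1..n}" for k l
    by (simp_all add: pd_odd_times[OF gfilt_gvar[OF that(2)]] pdu[OF that(1)] pd_gvar pd_add pd_diff pd_1)
  have "jacobian n (rho n i j u) = prod_list (map (\<lambda>k. ?M k k) [1..<Suc n])"
    unfolding jacobian_pd[OF Gamma_ghom[OF S(1)]]
  proof (rule gdet_diagonal)
    fix p assume "p permutes {1..n}" "p \<noteq> id"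
    then obtain a where a: "a \<in> {1..n}" "p a \<in> {1..n}" "p a \<noteq> a" "p (p a) \<noteq> p a" by (rule permutes_moves_two)
    \<comment> \<open>Rows outside \<open>{i, j}\<close> are those of the identity matrix; the block
      on \<open>{i, j}\<close> is diagonal, because \<open>u\<close> involves neither
      variable.\<close>
    consider "a \<notin> {i, j}" | "p a \<notin> {i, j}" | "a \<in> {i, j}" "p a \<in> {i, j}" by blast
    then show "\<exists>k\<in>{1..n}. ?M k (p k) = 0"
    proof cases
      case 1
      then show ?thesis using a by (intro bexI[of _ a]) (auto simp: S pd_gvar)
    next
      case 2
      then show ?thesis using a by (intro bexI[of _ "p a"]) (auto simp: S pd_gvar)
    next
      case 3
      then show ?thesis using a assms(1-3) pdv[OF 3(2) a(1)] by (intro bexI[of _ a]) (auto simp: S)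
    qed
  qed
  also have "map (\<lambda>k. ?M k k) [1..<Suc n] = map (\<lambda>k. 1 + ?c k \<cdot> u) [1..<Suc n]"
    using assms(1-3) pdv[of i i] pdv[of j j] by (intro map_cong) (auto simp: S pd_gvar)
  also have "prod_list \<dots> = 1 + sum_list (map ?c [1..<Suc n]) \<cdot> u" by (rule prod_list_one_plus[OF u(2)])
  also have "sum_list (map ?c [1..<Suc n]) = (\<Sum>k=1..n. ?c k)"
    by (subst sum.distinct_set_conv_list[symmetric]) (auto intro: sum.cong)
  also have "(\<Sum>k=1..n. ?c k) = (\<Sum>k=1..n. if k = i then 1 else 0) - (\<Sum>k=1..n. if k = j then 1 else 0)"
    unfolding sum_subtractf[symmetric] using assms(3) by (intro sum.cong) auto
  also have "\<dots> = 0" using assms(1,2) by simp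
  finally show ?thesis using S(1) by (simp add: Sigma_group_def)
qed

section \<open>Exact commutator identities\<close>

lemma sigma_sigma_commutator:
  assumes "k \<in> {1..n}" "i \<in> {1..n}" "k \<noteq> i"
    and v: "v \<in> gfilt n 3" "v \<in> span_on ({1..n} - {k, i})"
    and w: "w \<in> gfilt n 2" "w \<in> span_on ({1..n} - {k, i})"
  shows "compose (Lambda n) (sigma n k v) (sigma n i (gvar k * w)) =
    compose (Lambda n) (sigma n i (v * w)) (compose (Lambda n) (sigma n i (gvar k * w)) (sigma n k v))"
proof -
  have kw: "gvar k * w \<in> gfilt n 3" using gfilt_mult[OF gfilt_gvar[OF assms(1)] w(1)] by simp
  have vw: "v * w \<in> gfilt n 3" using gfilt_antimono[OF gfilt_mult[OF v(1) w(1)], of 3] by simp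
  have skw: "gvar k * w \<in> span_on ({1..n} - {i})"
    by (rule supported_mult[OF _ w(2), of "gvar k" "\<lambda>A. A \<subseteq> {k}"]) (use assms in \<open>auto simp: gvar_def supported_gmono\<close>)
  have svw: "v * w \<in> span_on ({1..n} - {i})" by (rule supported_mult[OF v(2) w(2)]) auto
  have sv: "v \<in> span_on ({1..n} - {k})" "v \<in> span_on ({1..n} - {i})"
    and sw: "w \<in> span_on ({1..n} - {k})" using v w by (auto elim: supported_mono)
  note s = assms(1) v(1) sv(1) and t = assms(2) kw skw and h = assms(2) vw svw
  note hs = Gamma_ghom[OF sigma_Gamma[OF s]] and ht = Gamma_ghom[OF sigma_Gamma[OF t]] and hh = Gamma_ghom[OF sigma_Gamma[OF h]]
  note L = gfilt_Lambda[OF v(1)] gfilt_Lambda[OF w(1)] gfilt_Lambda[OF kw] gfilt_Lambda[OF vw]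
  \<comment> \<open>The image of \<open>gvar i\<close> decides: inside \<open>gvar k * w\<close> the
    factor \<open>gvar k\<close> becomes \<open>gvar k + v\<close>, and the surplus
    \<open>v * w\<close> is supplied by \<open>sigma n i (v * w)\<close>.\<close>
  have "sigma n k v (sigma n i (gvar k * w) (gvar m)) =
      sigma n i (v * w) (sigma n i (gvar k * w) (sigma n k v (gvar m)))" if "m \<in> {1..n}" for m
    using that assms(1-3) L
    by (auto simp: sigma_gvar[OF s] sigma_gvar[OF t] sigma_gvar[OF h] ghom_add[OF hs] ghom_add[OF ht] ghom_add[OF hh]
        ghom_mult[OF hs] Lambda_gvar Lambda_mult sigma_fix[OF s sw] sigma_fix[OF t sv(2)] sigma_fix[OF h sv(2)]
        sigma_fix[OF h skw] distrib_right algebra_simps)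
  then show ?thesis
    using hs ht hh by (intro ghom_eqI[of n] ghom_compose) (auto simp: compose_eq Lambda_gvar ghom_Lambda)
qed

lemma rho_sigma_commutator:
  assumes "p \<in> {1..n}" "i \<in> {1..n}" "p \<noteq> i"
    and u: "u \<in> square_zero_off n {p, i}"
    and w: "w \<in> gfilt n 2" "w \<in> span_on ({1..n} - {p, i})"
  shows "compose (Lambda n) (rho n p i u) (sigma n i (gvar p * w)) =
    compose (Lambda n) (sigma n i (2 * (gvar p * w * u))) (compose (Lambda n) (sigma n i (gvar p * w)) (rho n p i u))"
proof -
  let ?h = "2 * (gvar p * w * u)"
  have U: "u \<in> gfilt n 2" "u \<in> span_on ({1..n} - {p, i})" "u * u = 0" using u by (simp_all add: square_zero_off_def)
  have pw: "gvar p * w \<in> gfilt n 3" using gfilt_mult[OF gfilt_gvar[OF assms(1)] w(1)] by simp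
  have pwu: "gvar p * w * u \<in> gfilt n 3" using gfilt_antimono[OF gfilt_mult[OF pw U(1)], of 3] by simp
  have spw: "gvar p * w \<in> span_on ({1..n} - {i})"
    by (rule supported_mult[OF _ w(2), of "gvar p" "\<lambda>A. A \<subseteq> {p}"]) (use assms in \<open>auto simp: gvar_def supported_gmono\<close>)
  have spwu: "gvar p * w * u \<in> span_on ({1..n} - {i})" by (rule supported_mult[OF spw U(2)]) auto
  have h2: "?h \<in> gfilt n 3" "?h \<in> span_on ({1..n} - {i})"
    using gfilt_add[OF pwu pwu] supported_add[OF spwu spwu] by (simp_all add: mult_2)
  have su: "u \<in> span_on ({1..n} - {i})" using U by (auto elim: supported_mono)
  note s = assms(1-3) u and t = assms(2) pw spw and h = assms(2) h2
  note hs = Gamma_ghom[OF rho_Gamma[OF s]] and ht = Gamma_ghom[OF sigma_Gamma[OF t]] and hh = Gamma_ghom[OF sigma_Gamma[OF h]]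
  note L = gfilt_Lambda[OF U(1)] gfilt_Lambda[OF w(1)] gfilt_Lambda[OF pw] gfilt_Lambda[OF h2(1)]
  have L1: "1 + u \<in> Lambda n" "1 - u \<in> Lambda n" using L(1) by (auto intro: Lambda_add Lambda_diff Lambda_1)
  have uc: "u * a = a * u" for a using gfilt_even_commute[OF gfilt_antimono[OF U(1), of 0]] by simp
  have S: "rho n p i u u = u" "rho n p i u w = w" "sigma n i (gvar p * w) u = u" "sigma n i ?h u = u"
    "sigma n i ?h (gvar p * w) = gvar p * w"
    by (rule rho_fix[OF s U(2)] rho_fix[OF s w(2)] sigma_fix[OF t su] sigma_fix[OF h su] sigma_fix[OF h spw])+
  have "rho n p i u (sigma n i (gvar p * w) (gvar m)) =
      sigma n i ?h (sigma n i (gvar p * w) (rho n p i u (gvar m)))" if m: "m \<in> {1..n}" for m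
  proof (cases "m = i")
    case True
    \<comment> \<open>On the left \<open>gvar p\<close> grows to \<open>gvar p * (1 + u)\<close>; on
      the right the whole image is multiplied by \<open>1 - u\<close>. The deviations
      \<open>gvar p * w * u\<close> have opposite signs on the two sides and so add up to
      \<open>?h\<close>.\<close>
    have lhs: "rho n p i u (sigma n i (gvar p * w) (gvar i)) = gvar i * (1 - u) + gvar p * (1 + u) * w"
      using assms(1-3) L by (simp add: sigma_gvar[OF t] ghom_add[OF hs] ghom_mult[OF hs] Lambda_gvar rho_gvar[OF s] S)
    have rhs: "sigma n i ?h (sigma n i (gvar p * w) (rho n p i u (gvar i))) =
        (gvar i + ?h + gvar p * w) * (1 - u)"
      using assms(1-3) L L1 by (simp add: rho_gvar[OF s] ghom_mult[OF ht] ghom_mult[OF hh] ghom_diff[OF ht] ghom_diff[OF hh]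
        ghom_1[OF hh] ghom_1[OF ht] sigma_gvar[OF t] sigma_gvar[OF h] ghom_add[OF hh] Lambda_add Lambda_1 Lambda_gvar S)
    have "gvar p * u * w = gvar p * w * u" by (simp add: mult.assoc uc)
    moreover have "?h * u = 0" using U(3) by (simp add: mult.assoc)
    ultimately have "gvar i * (1 - u) + gvar p * (1 + u) * w = (gvar i + ?h + gvar p * w) * (1 - u)"
      by (simp add: algebra_simps mult_2)
    with lhs rhs show ?thesis unfolding True by (simp only:)
  next
    case False
    then show ?thesis using m assms(1-3) L1 L
      by (auto simp: rho_gvar[OF s] sigma_gvar[OF t] sigma_gvar[OF h] ghom_mult[OF ht] ghom_mult[OF hh] ghom_add[OF ht]
        ghom_add[OF hh] ghom_1[OF hh] ghom_1[OF ht] Lambda_1 Lambda_gvar S)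
  qed
  then show ?thesis
    using hs ht hh by (intro ghom_eqI[of n] ghom_compose) (auto simp: compose_eq Lambda_gvar ghom_Lambda)
qed

text \<open>The computation in two-by-two matrices: opposite elementary matrices with entries
  \<open>u\<close> and \<open>w\<close> that square to zero have a diagonal commutator, with entries
  \<open>1 + u * w\<close> and \<open>1 - u * w\<close>.\<close>

lemma sigma_sigma_commutator_rho:
  assumes "p \<in> {1..n}" "q \<in> {1..n}" "p \<noteq> q"
    and u: "u \<in> square_zero_off n {p, q}" and w: "w \<in> square_zero_off n {p, q}"
  shows "compose (Lambda n) (sigma n p (gvar q * u)) (sigma n q (gvar p * w)) =
    compose (Lambda n) (rho n q p (u * w)) (compose (Lambda n) (sigma n q (gvar p * w)) (sigma n p (gvar q * u)))"
proof -
  have U: "u \<in> gfilt n 2" "u \<in> span_on ({1..n} - {p, q})" "u * u = 0" using u by (simp_all add: square_zero_off_def)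
  have W: "w \<in> gfilt n 2" "w \<in> span_on ({1..n} - {p, q})" "w * w = 0" using w by (simp_all add: square_zero_off_def)
  have wu: "w * u = u * w" using gfilt_even_commute[OF gfilt_antimono[OF W(1), of 0]] by simp
  have sq: "u * (u * a) = 0" "w * (w * a) = 0" for a using U(3) W(3) by (simp_all flip: mult.assoc)
  have wuw: "w * (u * w) = 0" using sq(2)[of u] by (simp add: wu)
  have qu: "gvar q * u \<in> gfilt n 3" using gfilt_mult[OF gfilt_gvar[OF assms(2)] U(1)] by simp
  have pw: "gvar p * w \<in> gfilt n 3" using gfilt_mult[OF gfilt_gvar[OF assms(1)] W(1)] by simp
  have squ: "gvar q * u \<in> span_on ({1..n} - {p})"
    by (rule supported_mult[OF _ U(2), of "gvar q" "\<lambda>A. A \<subseteq> {q}"]) (use assms in \<open>auto simp: gvar_def supported_gmono\<close>)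
  have spw: "gvar p * w \<in> span_on ({1..n} - {q})"
    by (rule supported_mult[OF _ W(2), of "gvar p" "\<lambda>A. A \<subseteq> {p}"]) (use assms in \<open>auto simp: gvar_def supported_gmono\<close>)
  have uw: "u * w \<in> square_zero_off n {q, p}"
    using gfilt_antimono[OF gfilt_mult[OF U(1) W(1)], of 2] supported_mult[OF U(2) W(2), of "\<lambda>A. A \<subseteq> {1..n} - {q, p}"]
    by (auto simp: square_zero_off_def mult.assoc wuw)
  note s = assms(1) qu squ and t = assms(2) pw spw and h = assms(2,1) assms(3)[symmetric] uw
  note hs = Gamma_ghom[OF sigma_Gamma[OF s]] and ht = Gamma_ghom[OF sigma_Gamma[OF t]] and hh = Gamma_ghom[OF rho_Gamma[OF h]]
  note L = gfilt_Lambda[OF U(1)] gfilt_Lambda[OF W(1)] gfilt_Lambda[OF qu] gfilt_Lambda[OF pw]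
  have sp: "u \<in> span_on ({1..n} - {p})" "u \<in> span_on ({1..n} - {q})" "w \<in> span_on ({1..n} - {p})" "w \<in> span_on ({1..n} - {q})"
    "u \<in> span_on ({1..n} - {q, p})" "w \<in> span_on ({1..n} - {q, p})"
    using U W by (auto elim: supported_mono)
  have S: "sigma n p (gvar q * u) w = w" "sigma n q (gvar p * w) u = u" "rho n q p (u * w) u = u" "rho n q p (u * w) w = w"
    by (rule sigma_fix[OF s] sigma_fix[OF t] rho_fix[OF h] sp)+
  have "sigma n p (gvar q * u) (sigma n q (gvar p * w) (gvar m)) =
      rho n q p (u * w) (sigma n q (gvar p * w) (sigma n p (gvar q * u) (gvar m)))" if m: "m \<in> {1..n}" for m
  proof -
    consider "m = p" | "m = q" | "m \<noteq> p" "m \<noteq> q" by blast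
    then show ?thesis
    proof cases
      case 1
      have "rho n q p (u * w) (sigma n q (gvar p * w) (sigma n p (gvar q * u) (gvar p))) =
          gvar p * (1 - u * w) + (gvar q * (1 + u * w) + gvar p * (1 - u * w) * w) * u"
        using assms(1-3) L by (simp add: sigma_gvar[OF s] sigma_gvar[OF t] rho_gvar[OF h] ghom_add[OF ht] ghom_mult[OF ht]
          ghom_add[OF hh] ghom_mult[OF hh] Lambda_gvar Lambda_mult Lambda_add S)
      also have "\<dots> = gvar p + gvar q * u"
        by (simp add: distrib_left distrib_right left_diff_distrib right_diff_distrib mult.assoc wu wuw sq)
      finally show ?thesis using 1 assms(1-3) by (simp add: sigma_gvar[OF s] sigma_gvar[OF t])
    next
      case 2
      then show ?thesis using assms(1-3) L
        by (simp add: sigma_gvar[OF s] sigma_gvar[OF t] rho_gvar[OF h] ghom_add[OF hs] ghom_mult[OF hs]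
          ghom_add[OF hh] ghom_mult[OF hh] Lambda_gvar Lambda_mult Lambda_add S W(3) algebra_simps)
    next
      case 3
      then show ?thesis using m by (simp add: sigma_gvar[OF s] sigma_gvar[OF t] rho_gvar[OF h])
    qed
  qed
  then show ?thesis
    using hs ht hh by (intro ghom_eqI[of n] ghom_compose) (auto simp: compose_eq Lambda_gvar ghom_Lambda)
qed

section \<open>Generation\<close>

lemma Gamma_Bij: "s \<in> Gamma_group n \<Longrightarrow> s \<in> Bij (Lambda n)"
  by (simp add: Gamma_group_def algebra_aut_def)

lemma Sigma_Gamma: "s \<in> Sigma_group n \<Longrightarrow> s \<in> Gamma_group n"
  by (simp add: Sigma_group_def)

lemma BijGroup_mult: "s \<in> Bij S \<Longrightarrow> t \<in> Bij S \<Longrightarrow> s \<otimes>\<^bsub>BijGroup S\<^esub> t = compose S s t"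
  by (simp add: BijGroup_def)

lemma subgroup_Bij: "subgroup G (BijGroup S) \<Longrightarrow> s \<in> G \<Longrightarrow> s \<in> Bij S"
  using subgroup.subset by (fastforce simp: BijGroup_def)

lemma subgroup_compose:
  "subgroup G (BijGroup S) \<Longrightarrow> s \<in> G \<Longrightarrow> t \<in> G \<Longrightarrow> compose S s t \<in> G"
  using subgroup.m_closed[of G "BijGroup S" s t] by (simp add: BijGroup_mult subgroup_Bij)

lemma subgroup_cancel:
  assumes G: "subgroup G (BijGroup S)" and s: "s \<in> Bij S" and t: "t \<in> G" and st: "compose S s t \<in> G"
  shows "s \<in> G"
proof -
  interpret group "BijGroup S" by (rule group_BijGroup)
  have c: "s \<in> carrier (BijGroup S)" "t \<in> carrier (BijGroup S)"
    using s subgroup_Bij[OF G t] by (simp_all add: BijGroup_def)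
  have "s = (s \<otimes>\<^bsub>BijGroup S\<^esub> t) \<otimes>\<^bsub>BijGroup S\<^esub> inv\<^bsub>BijGroup S\<^esub> t"
    using c by (simp add: m_assoc)
  also have "\<dots> \<in> G"
    using subgroup.m_closed[OF G st subgroup.m_inv_closed[OF G t]]
    by (simp only: BijGroup_mult s subgroup_Bij[OF G t])
  finally show ?thesis .
qed

text \<open>With the commutator written as \<open>h\<close> times the product in reversed order,
  \<open>h\<close> is isolated by right cancellation and no inverse automorphism has to be
  computed.\<close>

lemma subgroup_commutator:
  assumes "subgroup G (BijGroup S)" "h \<in> Bij S" "s \<in> G" "t \<in> G"
    and "compose S s t = compose S h (compose S t s)"
  shows "h \<in> G"
  by (rule subgroup_cancel[OF assms(1,2) subgroup_compose[OF assms(1,4,3)]])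
    (use subgroup_compose[OF assms(1,3,4)] assms(5) in simp)

section \<open>Generating the elementary automorphisms of higher degree\<close>

lemma sigma_gmono_side:
  assumes "A \<subseteq> {1..n} - {i}" "odd (card A)" "3 \<le> card A"
  shows "gmono c A \<in> gfilt n 3" "gmono c A \<in> span_on ({1..n} - {i})"
  using assms by (auto intro!: gfilt_gmono supported_gmono)

lemma gmono_numeral2: "2 * gmono c A = gmono (2 * c) A"
  by (simp only: mult_2 gmono_add)

lemma sigma_generated:
  fixes G :: "'k::comm_ring_1 gmap set"
  assumes G: "subgroup G (BijGroup (Lambda n))"
    and sig: "\<And>i A c. i \<in> {1..n} \<Longrightarrow> A \<subseteq> {1..n} - {i} \<Longrightarrow> card A = 3 \<Longrightarrow> sigma n i (gmono c A) \<in> G"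
    and rho: "\<And>p q A c. p \<in> {1..n} \<Longrightarrow> q \<in> {1..n} \<Longrightarrow> p \<noteq> q \<Longrightarrow> A \<subseteq> {1..n} - {p, q} \<Longrightarrow> card A = 2
      \<Longrightarrow> rho n p q (gmono c A) \<in> G"
    and half: "odd n \<or> (\<exists>h :: 'k. 2 * h = 1)"
    and "i \<in> {1..n}" "A \<subseteq> {1..n} - {i}" "odd (card A)" "3 \<le> card A"
  shows "sigma n i (gmono c A) \<in> G"
  using assms(6-)
proof (induction "card A" arbitrary: A c rule: less_induct)
  case less
  note i = \<open>i \<in> {1..n}\<close>
  have fin: "finite A" using less.prems(1) by (rule finite_subset) simp
  show ?case
  proof (cases "card A = 3")
    case True
    then show ?thesis using sig i less.prems by blast
  next
    case False
    then have 5: "5 \<le> card A" using less.prems(2,3) by (auto elim!: oddE)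
    have h: "sigma n i (gmono c A) \<in> Bij (Lambda n)"
      using sigma_Gamma[OF i sigma_gmono_side[OF less.prems]] by (rule Gamma_Bij)
    show ?thesis
    proof (cases "\<exists>k\<in>{1..n}. k \<notin> A \<and> k \<noteq> i")
      case True
      then obtain k where k: "k \<in> {1..n}" "k \<notin> A" "k \<noteq> i" by blast
      obtain B where B: "B \<subseteq> A" "card B = 3" "finite B"
        using obtain_subset_with_card_n[of 3 A] less.prems(3) by metis
      \<comment> \<open>With \<open>card B = 3\<close> the map \<open>sigma n k ?v\<close> is of
        lowest degree, and \<open>insert k C\<close> has \<open>card A - 2\<close> elements, so the
        induction hypothesis covers the other factor.\<close>
      define C where "C = A - B"
      have C: "finite C" "card C = card A - 3" "B \<inter> C = {}" "B \<union> C = A" "k \<notin> C" "C \<subseteq> A"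
        using B fin k by (auto simp: C_def card_Diff_subset)
      have cC: "even (card C)" "2 \<le> card C" using C(2) 5 less.prems(2) by auto
      \<comment> \<open>The coefficient \<open>gsign B C * c\<close> undoes the reordering sign in
        \<open>?v * ?w\<close>.\<close>
      let ?v = "gmono (gsign B C * c) B :: 'k grassmann" and ?w = "gmono 1 C :: 'k grassmann"
      have v: "?v \<in> gfilt n 3" "?v \<in> span_on ({1..n} - {k, i})"
        using B C k less.prems(1) by (auto intro!: gfilt_gmono supported_gmono)
      have w: "?w \<in> gfilt n 2" "?w \<in> span_on ({1..n} - {k, i})"
        using cC C k less.prems(1) by (auto intro!: gfilt_gmono supported_gmono)
      have vw: "?v * ?w = gmono c A" using B C by (simp add: gmono_times)
      have kw: "gvar k * ?w = gmono (gsign {k} C) (insert k C)" using C by (simp add: gvar_times_gmono)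
      have "sigma n k ?v \<in> G" using B k less.prems(1) by (intro sig) auto
      moreover have "sigma n i (gvar k * ?w) \<in> G"
        unfolding kw using C cC k less.prems 5 by (intro less.hyps) auto
      ultimately show ?thesis
        using subgroup_commutator[OF G h] sigma_sigma_commutator[OF k(1) i k(3) v w] by (simp only: vw)
    next
      case False
      then have A: "{1..n} = insert i A" using i less.prems(1) by auto
      \<comment> \<open>\<open>A\<close> contains every index except \<open>i\<close>, so its odd
        cardinality is \<open>n - 1\<close>.\<close>
      have "n = card {1..n}" by simp
      also have "\<dots> = Suc (card A)" unfolding A using less.prems(1) fin by (subst card_insert_disjoint) auto
      finally have "even n" using less.prems(2) by presburger
      then obtain d :: 'k where d: "2 * d = 1" using half by blast
      obtain B where B: "B \<subseteq> A" "card B = 2" "finite B"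
        using obtain_subset_with_card_n[of 2 A] less.prems(3) by (metis Suc_leD eval_nat_numeral(3))
      have "card (A - B) = card A - 2" using B fin by (simp add: card_Diff_subset)
      then have "A - B \<noteq> {}" using 5 by (intro notI) (simp only: card.empty)
      then obtain p where p: "p \<in> A" "p \<notin> B" by blast
      \<comment> \<open>\<open>A\<close> is split into \<open>p\<close>, \<open>B\<close> and
        \<open>C\<close>: the pair \<open>B\<close> carries a \<open>rho\<close> of lowest degree,
        and \<open>insert p C\<close> is smaller than \<open>A\<close> by two.\<close>
      define C where "C = A - insert p B"
      have C: "finite C" "card C = card A - 3" "B \<inter> C = {}" "insert p C \<union> B = A" "p \<notin> C" "C \<subseteq> A"
        using B fin p by (auto simp: C_def card_Diff_subset)
      have cC: "even (card C)" "2 \<le> card C" using C(2) 5 less.prems(2) by auto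
      have pi: "p \<in> {1..n}" "p \<noteq> i" using p less.prems(1) by auto
      \<comment> \<open>The half \<open>d\<close> in \<open>?w\<close> cancels the factor two of the
        commutator; the signs in \<open>?u\<close> undo the reordering of \<open>p\<close>,
        \<open>C\<close> and \<open>B\<close>.\<close>
      let ?u = "gmono (gsign {p} C * gsign (insert p C) B * c) B :: 'k grassmann" and ?w = "gmono d C :: 'k grassmann"
      have u: "?u \<in> square_zero_off n {p, i}"
        using B p less.prems(1) by (intro square_zero_off_gmono) auto
      have w: "?w \<in> gfilt n 2" "?w \<in> span_on ({1..n} - {p, i})"
        using cC C p less.prems(1) by (auto intro!: gfilt_gmono supported_gmono)
      have pw: "gvar p * ?w = gmono (gsign {p} C * d) (insert p C)" using C by (simp add: gvar_times_gmono)
      have "insert p C \<inter> B = {}" using C p by auto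
      moreover have "2 * (gsign {p} C * (d * (gsign {p} C * c))) = (2 * d) * (gsign {p} C * (gsign {p} C * c))"
        by (simp only: mult_ac)
      ultimately have e: "2 * (gvar p * ?w * ?u) = gmono c A"
        unfolding pw using B C d by (simp add: gmono_times gmono_numeral2 mult_ac)
      have "rho n p i ?u \<in> G" using B p pi i less.prems(1) by (intro rho) auto
      moreover have "sigma n i (gvar p * ?w) \<in> G"
        unfolding pw using C cC p less.prems 5 by (intro less.hyps) auto
      ultimately show ?thesis
        using subgroup_commutator[OF G h] rho_sigma_commutator[OF pi(1) i pi(2) u w] by (simp only: e)
    qed
  qed
qed

text \<open>Each of \<open>p\<close> and \<open>q\<close> is the spare index for the other, so a
  single commutator of two maps \<open>sigma\<close> suffices; by \<open>sig\<close> these are at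
  hand in every odd degree.\<close>

lemma rho_generated:
  fixes G :: "'k::comm_ring_1 gmap set"
  assumes G: "subgroup G (BijGroup (Lambda n))"
    and sig: "\<And>i A c. i \<in> {1..n} \<Longrightarrow> A \<subseteq> {1..n} - {i} \<Longrightarrow> odd (card A) \<Longrightarrow> 3 \<le> card A \<Longrightarrow> sigma n i (gmono c A) \<in> G"
    and rho: "\<And>p q A c. p \<in> {1..n} \<Longrightarrow> q \<in> {1..n} \<Longrightarrow> p \<noteq> q \<Longrightarrow> A \<subseteq> {1..n} - {p, q} \<Longrightarrow> card A = 2
      \<Longrightarrow> rho n p q (gmono c A) \<in> G"
    and p: "p \<in> {1..n}" and q: "q \<in> {1..n}" and pq: "p \<noteq> q"
    and A: "A \<subseteq> {1..n} - {p, q}" "even (card A)" "2 \<le> card A"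
  shows "rho n p q (gmono c A) \<in> G"
proof (cases "card A = 2")
  case True
  then show ?thesis using rho p q pq A by blast
next
  case False
  then have 4: "4 \<le> card A" using A(2,3) by (auto elim!: evenE)
  have fin: "finite A" using A(1) by (rule finite_subset) simp
  obtain B where B: "B \<subseteq> A" "card B = 2" "finite B"
    using obtain_subset_with_card_n[of 2 A] A(3) by metis
  define C where "C = A - B"
  have C: "finite C" "card C = card A - 2" "B \<inter> C = {}" "B \<union> C = A" "C \<subseteq> A"
    using B fin by (auto simp: C_def card_Diff_subset)
  have cC: "even (card C)" "2 \<le> card C" using C(2) 4 A(2) by auto
  have nin: "p \<notin> A" "q \<notin> A" "p \<notin> B" "q \<notin> B" "p \<notin> C" "q \<notin> C" using A(1) B(1) C(5) by auto
  let ?u = "gmono (gsign B C * c) B :: 'k grassmann" and ?w = "gmono 1 C :: 'k grassmann"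
  \<comment> \<open>\<open>sigma_sigma_commutator_rho\<close> produces \<open>rho\<close> with its
    two indices exchanged, so it is applied to \<open>q\<close> and \<open>p\<close> in this
    order.\<close>
  have u: "?u \<in> square_zero_off n {q, p}" using B A(1) by (intro square_zero_off_gmono) auto
  have w: "?w \<in> square_zero_off n {q, p}" using C cC A(1) by (intro square_zero_off_gmono) auto
  have uw: "?u * ?w = gmono c A" using B C by (simp add: gmono_times)
  have pu: "gvar p * ?u = gmono (gsign {p} B * (gsign B C * c)) (insert p B)"
    and qw: "gvar q * ?w = gmono (gsign {q} C) (insert q C)"
    using B C nin by (simp_all add: gvar_times_gmono)
  have 1: "sigma n q (gvar p * ?u) \<in> G"
    unfolding pu using p q pq A(1) B nin by (intro sig) auto
  have 2: "sigma n p (gvar q * ?w) \<in> G"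
    unfolding qw using p q pq A(1) C cC nin by (intro sig) auto
  have h: "rho n p q (gmono c A) \<in> Bij (Lambda n)"
    using rho_Gamma[OF p q pq square_zero_off_gmono[OF A]] by (rule Gamma_Bij)
  show ?thesis
    using subgroup_commutator[OF G h 1 2] sigma_sigma_commutator_rho[OF q p pq[symmetric] u w] by (simp only: uw)
qed

section \<open>Clearing leading terms\<close>

lemma coeff_gvar: "card A \<noteq> 1 \<Longrightarrow> coeff (gvar k) A = 0"
  by (auto simp: gvar_def coeff_gmono)

text \<open>\<open>s\<close> changes the correction \<open>t (gvar i) - gvar i\<close> only in
  degrees from \<open>card A + 2\<close> on. Hence only \<open>t\<close> has to be at this level,
  while \<open>s\<close> is any element of \<open>Gamma_group n\<close>.\<close>

lemma coeff_compose_leading: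
  assumes s: "s \<in> Gamma_group n" and t: "t \<in> Gamma_group n"
    and lev: "t (gvar i) - gvar i \<in> gfilt n (card A)" and "3 \<le> card A" "i \<in> {1..n}"
  shows "coeff (compose (Lambda n) s t (gvar i)) A = coeff (s (gvar i)) A + coeff (t (gvar i)) A"
proof -
  let ?c = "t (gvar i) - gvar i"
  note g = Lambda_gvar[OF assms(5), where 'a = 'a]
  have "s (t (gvar i)) = s (gvar i + ?c)" by simp
  also have "\<dots> = s (gvar i) + s ?c"
    using g gfilt_Lambda[OF lev] by (rule ghom_add[OF Gamma_ghom[OF s]])
  finally have e: "s (t (gvar i)) = s (gvar i) + s ?c" .
  have "coeff (s ?c - ?c) A = 0"
    using gfilt_coeff[OF Gamma_diff_gfilt[OF s lev], of A] by simp
  then show ?thesis using g assms(4) by (simp add: compose_eq e coeff_gvar)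
qed

lemma compose_level:
  assumes s: "s \<in> Gamma_group n" and t: "t \<in> Gamma_group n" and i: "i \<in> {1..n}"
    and "s (gvar i) - gvar i \<in> gfilt n d" "t (gvar i) - gvar i \<in> gfilt n d"
  shows "compose (Lambda n) s t (gvar i) - gvar i \<in> gfilt n d"
proof -
  let ?c = "t (gvar i) - gvar i"
  note g = Lambda_gvar[OF i, where 'a = 'a]
  have "s (t (gvar i)) = s (gvar i + ?c)" by simp
  also have "\<dots> = s (gvar i) + s ?c"
    using g gfilt_Lambda[OF assms(5)] by (rule ghom_add[OF Gamma_ghom[OF s]])
  finally have "s (t (gvar i)) - gvar i = (s (gvar i) - gvar i) + s ?c" by simp
  then show ?thesis using gfilt_add[OF assms(4) Gamma_gfilt[OF s assms(5)]] by (simp only: compose_eq g)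
qed

text \<open>For \<open>d \<ge> 3\<close> the summand \<open>gvar i\<close> does not contribute, so
  these index the corrections in degree \<open>d\<close>. Their number is the measure of the inner
  induction.\<close>

definition leading_terms :: "nat \<Rightarrow> nat \<Rightarrow> 'k::comm_ring_1 gmap \<Rightarrow> (nat \<times> nat set) set"
  where "leading_terms n d s = {(i, A). i \<in> {1..n} \<and> A \<subseteq> {1..n} \<and> card A = d \<and> coeff (s (gvar i)) A \<noteq> 0}"

lemma finite_leading_terms: "finite (leading_terms n d s)"
  by (rule finite_subset[of _ "{1..n} \<times> Pow {1..n}"]) (auto simp: leading_terms_def)

lemma Sigma_generated_level:
  fixes G :: "'k::comm_ring_1 gmap set"
  assumes G: "subgroup G (BijGroup (Lambda n))"
    and sig: "\<And>i A c. i \<in> {1..n} \<Longrightarrow> A \<subseteq> {1..n} - {i} \<Longrightarrow> odd (card A) \<Longrightarrow> 3 \<le> card A \<Longrightarrow> sigma n i (gmono c A) \<in> G"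
    and rho: "\<And>p q A c. p \<in> {1..n} \<Longrightarrow> q \<in> {1..n} \<Longrightarrow> p \<noteq> q \<Longrightarrow> A \<subseteq> {1..n} - {p, q} \<Longrightarrow> even (card A)
      \<Longrightarrow> 2 \<le> card A \<Longrightarrow> rho n p q (gmono c A) \<in> G"
    and "odd d" "3 \<le> d" "s \<in> Sigma_group n" "\<And>i. i \<in> {1..n} \<Longrightarrow> s (gvar i) - gvar i \<in> gfilt n d"
  shows "s \<in> G"
  using assms(4-)
proof (induction "Suc n - d" arbitrary: d s rule: less_induct)
  case outer: less
  note d = \<open>odd d\<close> \<open>3 \<le> d\<close>
  show ?case
  \<comment> \<open>Above degree \<open>n\<close> there is nothing left to correct; up to
    \<open>n\<close> the truncated difference \<open>Suc n - d\<close> drops strictly when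
    \<open>d\<close> grows.\<close>
  proof (cases "n < d")
    case True
    have hs: "ghom n s" by (intro Gamma_ghom Sigma_Gamma outer.prems)
    have id: "ghom n (\<lambda>a\<in>Lambda n. a :: 'k grassmann)"
      by (auto simp: ghom_def Lambda_1 Lambda_add Lambda_mult Lambda_scale)
    have "s = (\<lambda>a\<in>Lambda n. a)"
      using gfilt_trivial[OF True outer.prems(4)] by (intro ghom_eqI[OF hs id]) (simp add: Lambda_gvar)
    then show ?thesis using subgroup.one_closed[OF G] by (simp add: BijGroup_def)
  next
    case False
    from outer.prems(3,4) show ?thesis
    proof (induction "card (leading_terms n d s)" arbitrary: s rule: less_induct)
      case inner: less
      note sS = \<open>s \<in> Sigma_group n\<close>
      have s: "s \<in> Gamma_group n" using sS by (rule Sigma_Gamma)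
      \<comment> \<open>Right multiplication by \<open>g\<close> must cancel the term at
        \<open>(i, A)\<close> and may alter other terms only where one is already present; then the
        number of leading terms drops.\<close>
      have reduce: "s \<in> G" if g: "g \<in> G" "g \<in> Sigma_group n" "\<And>k. k \<in> {1..n} \<Longrightarrow> g (gvar k) - gvar k \<in> gfilt n d"
        and iA: "(i, A) \<in> leading_terms n d s" "coeff (g (gvar i)) A = - coeff (s (gvar i)) A"
        and other: "\<And>k B. k \<in> {1..n} \<Longrightarrow> B \<subseteq> {1..n} \<Longrightarrow> card B = d \<Longrightarrow> coeff (s (gvar k)) B = 0 \<Longrightarrow> coeff (g (gvar k)) B = 0"
        for g i A
      proof -
        let ?t = "compose (Lambda n) s g"
        have co: "coeff (?t (gvar k)) B = coeff (s (gvar k)) B + coeff (g (gvar k)) B"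
          if "k \<in> {1..n}" "card B = d" for k B
          using that g d by (intro coeff_compose_leading s Sigma_Gamma) auto
        have "leading_terms n d ?t \<subseteq> leading_terms n d s - {(i, A)}"
        proof
          fix x assume x: "x \<in> leading_terms n d ?t"
          obtain k B where kB: "x = (k, B)" by (cases x)
          then have k: "k \<in> {1..n}" "B \<subseteq> {1..n}" "card B = d" "coeff (s (gvar k)) B + coeff (g (gvar k)) B \<noteq> 0"
            using x co[of k B] by (auto simp: leading_terms_def)
          then have "coeff (s (gvar k)) B \<noteq> 0" using other[of k B] by auto
          moreover have "(k, B) \<noteq> (i, A)" using k(4) iA(2) by auto
          ultimately show "x \<in> leading_terms n d s - {(i, A)}" using k kB by (simp add: leading_terms_def)
        qed
        then have "leading_terms n d ?t \<subset> leading_terms n d s" using iA(1) by blast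
        then have "card (leading_terms n d ?t) < card (leading_terms n d s)"
          by (intro psubset_card_mono finite_leading_terms)
        moreover have "?t \<in> Sigma_group n" using sS g(2) by (rule Sigma_compose)
        moreover have "?t (gvar k) - gvar k \<in> gfilt n d" if "k \<in> {1..n}" for k
          using that inner.prems(2) g by (intro compose_level s Sigma_Gamma)
        ultimately have "?t \<in> G" by (rule inner.hyps)
        then show ?thesis using subgroup_cancel[OF G Gamma_Bij[OF s] g(1)] by blast
      qed
      show ?case
      proof (cases "leading_terms n d s = {}")
        case True
        \<comment> \<open>Degree \<open>d\<close> is empty, and parity excludes degree
          \<open>d + 1\<close>.\<close>
        have "s (gvar i) - gvar i \<in> gfilt n (d + 2)" if i: "i \<in> {1..n}" for i
          unfolding gfilt_def supported_def
        proof (intro CollectI allI impI)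
          fix A assume nz: "coeff (s (gvar i) - gvar i) A \<noteq> 0"
          have A: "A \<subseteq> {1..n}" "d \<le> card A" "even (card A + d)"
            using inner.prems(2)[OF i] nz by (auto simp: gfilt_def dest: supportedD)
          have "card A \<noteq> d" using True i A nz d coeff_gvar[of A i] by (auto simp: leading_terms_def)
          then show "A \<subseteq> {1..n} \<and> d + 2 \<le> card A \<and> even (card A + (d + 2))" using A by presburger
        qed
        then show ?thesis using d sS False by (intro outer.hyps[of "d + 2"]) auto
      next
        case False
        then obtain i A where iA: "(i, A) \<in> leading_terms n d s" by auto
        then have i: "i \<in> {1..n}" and A: "A \<subseteq> {1..n}" "card A = d" and nz: "coeff (s (gvar i)) A \<noteq> 0"
          by (auto simp: leading_terms_def)
        have fin: "finite A" using A(1) by (rule finite_subset) simp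
        show ?thesis
        proof (cases "i \<in> A")
          case False
          let ?u = "gmono (- coeff (s (gvar i)) A) A"
          have "A \<subseteq> {1..n} - {i}" using A False by auto
          note su = sigma_gmono_side[OF this, unfolded A(2), OF d, of "- coeff (s (gvar i)) A"]
          have "sigma n i ?u \<in> G" using i A d False by (intro sig) auto
          moreover have "?u \<in> gfilt n d" using A d by (intro gfilt_gmono) auto
          ultimately show ?thesis
            using iA d fin A i nz
            by (intro reduce[of "sigma n i ?u" i A] sigma_Sigma[OF i su])
              (auto simp: sigma_gvar[OF i su] coeff_gvar coeff_gmono split: if_splits)
        next
          case True
          define B where "B = A - {i}"
          have B: "insert i B = A" "i \<notin> B" "finite B" "card B = d - 1" "B \<subseteq> {1..n}"
            using True fin A by (auto simp: B_def)
          have eB: "even (card B)" "2 \<le> card B" using B(4) d by auto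
          let ?f = "\<lambda>k. coeff (pd k (s (gvar k) - gvar k)) B"
          have f: "?f k = (if k \<in> B then 0 else gsign {k} B * coeff (s (gvar k)) (insert k B))" for k
            using B eB by (auto simp: coeff_pd coeff_gvar)
          have "coeff (jacobian n s) B = (\<Sum>k=1..n. ?f k)"
            using inner.prems(2) B(4) d by (intro coeff_jacobian[of n s "d - 1"] Gamma_ghom s) auto
          moreover have "coeff (jacobian n s) B = 0"
            using sS eB by (auto simp: Sigma_group_def one_grassmann_def coeff_gmono)
          ultimately have "?f i + (\<Sum>k\<in>{1..n} - {i}. ?f k) = 0"
            using i by (simp add: sum.remove[of "{1..n}" i])
          moreover have "?f i \<noteq> 0"
          proof
            assume "?f i = 0"
            then have "gsign {i} B * (gsign {i} B * coeff (s (gvar i)) A) = 0" using f[of i] B by simp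
            then show False using nz by (simp only: gsign_square')
          qed
          ultimately have "(\<Sum>k\<in>{1..n} - {i}. ?f k) \<noteq> 0" by auto
          \<comment> \<open>The coefficient of the divergence at \<open>B\<close> is zero but its
            \<open>i\<close>-th summand is not, so some other \<open>k\<close> has a leading term at
            \<open>insert k B\<close>. In degree \<open>d\<close> the map
            \<open>rho n i k ?u\<close> touches only this term and the one at \<open>A\<close>, so
            no new leading term arises.\<close>
          then obtain k where k: "k \<in> {1..n} - {i}" "?f k \<noteq> 0"
            by (rule sum.not_neutral_contains_not_neutral)
          then have k': "k \<in> {1..n}" "i \<noteq> k" "k \<notin> B" "coeff (s (gvar k)) (insert k B) \<noteq> 0"
            using f[of k] by (auto split: if_splits)
          \<comment> \<open>\<open>gvar i\<close> times the monomial of \<open>B\<close> carries the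
            sign \<open>gsign {i} B\<close>, which this choice absorbs.\<close>
          let ?c = "- (gsign {i} B * coeff (s (gvar i)) A)"
          let ?u = "gmono ?c B"
          have sub: "B \<subseteq> {1..n} - {i, k}" using B k' by auto
          note su = square_zero_off_gmono[OF sub eB, of ?c]
          have gu: "gvar l * ?u = gmono (gsign {l} B * ?c) (insert l B)" if "l \<notin> B" for l
            using that B by (simp add: gvar_times_gmono)
          have gd: "gvar l * ?u \<in> gfilt n d" if "l \<in> {1..n}" "l \<notin> B" for l
            unfolding gu[OF that(2)] using that B d by (intro gfilt_gmono) auto
          have "rho n i k ?u \<in> G" using i k' sub eB by (intro rho) auto
          moreover have "rho n i k ?u (gvar l) - gvar l \<in> gfilt n d" if "l \<in> {1..n}" for l
            using that gd i k' B(2)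
            by (auto simp: rho_gvar[OF i k'(1,2) su] distrib_left right_diff_distrib gfilt_uminus)
          moreover have "coeff (rho n i k ?u (gvar i)) A = - coeff (s (gvar i)) A"
            using i A d B fin by (simp add: rho_gvar[OF i k'(1,2) su] distrib_left coeff_gvar gu coeff_gmono)
          moreover have "coeff (rho n i k ?u (gvar l)) C = 0"
            if "l \<in> {1..n}" "card C = d" "coeff (s (gvar l)) C = 0" for l C
          proof -
            have "C \<noteq> insert i B" if "l = i" using that \<open>coeff (s (gvar l)) C = 0\<close> nz B(1) by auto
            moreover have "C \<noteq> insert k B" if "l = k" using that \<open>coeff (s (gvar l)) C = 0\<close> k'(4) by auto
            ultimately show ?thesis using that d k'(3) B(2)
              by (auto simp: rho_gvar[OF i k'(1,2) su] distrib_left right_diff_distrib coeff_gvar gu coeff_gmono)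
          qed
          ultimately show ?thesis
            using iA by (intro reduce[of "rho n i k ?u" i A] rho_Sigma[OF i k'(1,2) su]) auto
        qed
      qed
    qed
  qed
qed

section \<open>The generating families\<close>

lemma gvar_triple:
  assumes "j < k" "k < l"
  shows "gvar j * gvar k * gvar l = gmono 1 {j, k, l}"
proof -
  have "gvar k * gvar l = (gmono 1 {k, l} :: 'a grassmann)"
    using assms gvar_times_gmono[of "{l}" k "1 :: 'a"] by (simp add: gsign_singletons gvar_def)
  moreover have "(gsign {j} {k, l} :: 'a) = 1" using assms by (intro gsign_min) auto
  ultimately show ?thesis using assms by (simp add: mult.assoc gvar_times_gmono)
qed

lemma sigma_family_gmono:
  "(i, j, k, l) \<in> sigma_index n \<Longrightarrow> sigma_family n (i, j, k, l) c = sigma n i (gmono c {j, k, l})"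
  by (simp add: sigma_index_def gvar_triple)

lemma sigma_index_side:
  assumes "(i, j, k, l) \<in> sigma_index n"
  shows "i \<in> {1..n}" "{j, k, l} \<subseteq> {1..n} - {i}" "card {j, k, l} = 3"
  using assms by (auto simp: sigma_index_def)

lemma sigma_index_exhaust:
  assumes "i \<in> {1..n}" "A \<subseteq> {1..n} - {i}" "card A = 3"
  obtains j k l where "(i, j, k, l) \<in> sigma_index n" "A = {j, k, l}"
proof -
  have fin: "finite A" using assms(2) by (rule finite_subset) simp
  have "length (sorted_list_of_set A) = Suc (Suc (Suc 0))" using assms(3) by simp
  then obtain j k l where e: "sorted_list_of_set A = [j, k, l]"
    unfolding length_Suc_conv length_0_conv by blast
  have "sorted_wrt (<) (sorted_list_of_set A)" by simp
  then have o: "j < k" "k < l" by (simp_all add: e)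
  have "A = {j, k, l}" using set_sorted_list_of_set[OF fin] by (simp add: e)
  then show ?thesis using that[of j k l] o assms by (auto simp: sigma_index_def)
qed

text \<open>Minimum, maximum and sum of the set determine the three entries.\<close>

lemma ordered_triple_inject:
  fixes j k l :: nat
  assumes "{j, k, l} = {j', k', l'}" "j < k" "k < l" "j' < k'" "k' < l'"
  shows "j = j'" "k = k'" "l = l'"
proof -
  have "Min {j, k, l} = j" "Min {j', k', l'} = j'" "Max {j, k, l} = l" "Max {j', k', l'} = l'"
    "\<Sum>{j, k, l} = j + k + l" "\<Sum>{j', k', l'} = j' + k' + l'"
    using assms(2-) by (auto simp: min_def max_def)
  then have "j = j'" "l = l'" "j + k + l = j' + k' + l'" unfolding assms(1) by (simp_all only:)
  then show "j = j'" "k = k'" "l = l'" by simp_all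
qed

lemma rho_index_side:
  assumes "avoidance n jf" "(i, \<alpha>) \<in> rho_index n"
  shows "i \<in> {1..n}" "jf i \<alpha> \<in> {1..n}" "i < jf i \<alpha>" "\<alpha> \<subseteq> {1..n} - {i, jf i \<alpha>}" "card \<alpha> = 2" "finite \<alpha>"
proof -
  have i: "i \<in> {1..n - 1}" and S: "\<alpha> \<in> S1' n i" using assms(2) by (simp_all add: rho_index_def)
  then have "jf i \<alpha> \<in> {i + 1..n} - \<alpha>" using assms(1) unfolding avoidance_def by blast
  moreover have "\<alpha> \<subseteq> {1..n} - {i}" "card \<alpha> = 2" using S by (simp_all add: S1'_def)
  ultimately show "i \<in> {1..n}" "jf i \<alpha> \<in> {1..n}" "i < jf i \<alpha>" "\<alpha> \<subseteq> {1..n} - {i, jf i \<alpha>}" "card \<alpha> = 2"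
    using i by auto
  then show "finite \<alpha>" using finite_subset by blast
qed

lemma rho_family_gmono:
  "finite \<alpha> \<Longrightarrow> rho_family n jf (i, \<alpha>) c = rho n i (jf i \<alpha>) (gmono c \<alpha>)"
  by (simp add: xpow_eq)

section \<open>The one-parameter subgroups\<close>

lemma one_parameter_subgroupI:
  fixes \<phi> :: "'k::comm_ring_1 \<Rightarrow> 'k gmap"
  assumes "\<And>c. \<phi> c \<in> Sigma_group n" "\<And>a b. compose (Lambda n) (\<phi> a) (\<phi> b) = \<phi> (a + b)" "inj \<phi>"
  shows "one_parameter_subgroup n \<phi>"
proof -
  have bij: "\<phi> c \<in> Bij (Lambda n)" for c using assms(1) by (intro Gamma_Bij Sigma_Gamma)
  have add: "group (additive_group :: 'k monoid)"
    by (rule groupI) (auto simp: additive_group_def add.assoc intro: exI[of _ "- x" for x])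
  have hom: "\<phi> \<in> hom additive_group (BijGroup (Lambda n))"
    using bij assms(2) by (auto simp: hom_def additive_group_def BijGroup_def)
  have "group_hom additive_group (BijGroup (Lambda n)) \<phi>"
    using add group_BijGroup hom by (simp add: group_hom_def group_hom_axioms_def)
  then have "subgroup (\<phi> ` carrier additive_group) (BijGroup (Lambda n))" by (rule group_hom.img_is_subgroup)
  then have "subgroup (range \<phi>) (BijGroup (Lambda n))" by (simp add: additive_group_def)
  moreover have "\<phi> \<in> iso additive_group (BijGroup (Lambda n)\<lparr>carrier := range \<phi>\<rparr>)"
    using hom assms(3) by (auto simp: iso_def hom_def additive_group_def bij_betw_def)
  ultimately show ?thesis using assms(1) by (auto simp: one_parameter_subgroup_def)
qed

lemma sigma_one_parameter:
  assumes "i \<in> {1..n}" "A \<subseteq> {1..n} - {i}" "odd (card A)" "3 \<le> card A"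
  shows "one_parameter_subgroup n (\<lambda>c :: 'k::comm_ring_1. sigma n i (gmono c A))"
proof (rule one_parameter_subgroupI)
  note S = sigma_gmono_side[OF assms(2-4)]
  show "sigma n i (gmono c A) \<in> Sigma_group n" for c :: 'k by (rule sigma_Sigma[OF assms(1) S])
  show "compose (Lambda n) (sigma n i (gmono a A)) (sigma n i (gmono b A)) = sigma n i (gmono (a + b) A)" for a b :: 'k
    unfolding gmono_add by (rule sigma_add[OF assms(1) S S])
  have fin: "finite A" using assms(2) by (rule finite_subset) simp
  show "inj (\<lambda>c :: 'k. sigma n i (gmono c A))"
  proof (rule injI)
    fix c d :: 'k assume "sigma n i (gmono c A) = sigma n i (gmono d A)"
    then have "sigma n i (gmono c A) (gvar i) = sigma n i (gmono d A) (gvar i)" by (rule fun_cong)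
    then have "gvar i + gmono c A = gvar i + gmono d A"
      by (simp only: sigma_gvar[OF assms(1) S assms(1)] if_True simp_thms)
    then have "gmono c A = gmono d A" by (rule add_left_imp_eq)
    then have "coeff (gmono c A) A = coeff (gmono d A) A" by (rule arg_cong)
    then show "c = d" using fin by (simp add: coeff_gmono)
  qed
qed

lemma rho_one_parameter:
  assumes "p \<in> {1..n}" "q \<in> {1..n}" "p \<noteq> q" "A \<subseteq> {1..n} - {p, q}" "even (card A)" "2 \<le> card A"
  shows "one_parameter_subgroup n (\<lambda>c :: 'k::comm_ring_1. rho n p q (gmono c A))"
proof (rule one_parameter_subgroupI)
  note S = square_zero_off_gmono[OF assms(4-6)] and pq = assms(1-3)
  have fin: "finite A" "A \<noteq> {}" "p \<notin> A" using assms(4,6) finite_subset[OF assms(4)] by auto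
  show "rho n p q (gmono c A) \<in> Sigma_group n" for c :: 'k by (rule rho_Sigma[OF pq S])
  show "compose (Lambda n) (rho n p q (gmono a A)) (rho n p q (gmono b A)) = rho n p q (gmono (a + b) A)" for a b :: 'k
    unfolding gmono_add by (rule rho_add[OF pq S S]) (use fin in \<open>simp add: gmono_times\<close>)
  show "inj (\<lambda>c :: 'k. rho n p q (gmono c A))"
  proof (rule injI)
    fix c d :: 'k assume "rho n p q (gmono c A) = rho n p q (gmono d A)"
    then have "rho n p q (gmono c A) (gvar p) = rho n p q (gmono d A) (gvar p)" by (rule fun_cong)
    then have "gvar p * (1 + gmono c A) = gvar p * (1 + gmono d A)"
      by (simp only: rho_gvar[OF pq S assms(1)] if_True simp_thms)
    then have "gvar p * gmono c A = gvar p * gmono d A" by (simp add: distrib_left)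
    then have "coeff (gvar p * gmono c A) (insert p A) = coeff (gvar p * gmono d A) (insert p A)"
      by (rule arg_cong)
    then have "gsign {p} A * (gsign {p} A * c) = gsign {p} A * (gsign {p} A * d)"
      using fin by (simp add: gvar_times_gmono coeff_gmono)
    then show "c = d" by (simp only: gsign_square')
  qed
qed

section \<open>All pairs of indices from the avoidance functions\<close>

lemma rho_swap: "i \<noteq> j \<Longrightarrow> rho n i j u = rho n j i (- u)"
  unfolding rho_def by (rule arg_cong[where f = "aut_of n"]) auto

text \<open>Following the avoidance function upwards from \<open>p\<close> ends at the largest index outside \<open>A\<close>.\<close>

lemma rho_avoidance_generated:
  fixes G :: "'k::comm_ring_1 gmap set"
  assumes jf: "avoidance n jf" and G: "subgroup G (BijGroup (Lambda n))"
    and rho: "\<And>i \<alpha> c. (i, \<alpha>) \<in> rho_index n \<Longrightarrow> rho n i (jf i \<alpha>) (gmono c \<alpha>) \<in> G"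
    and p: "p \<in> {1..n}" and q: "q \<in> {1..n}" and pq: "p \<noteq> q"
    and A: "A \<subseteq> {1..n} - {p, q}" "card A = 2"
  shows "rho n p q (gmono c A) \<in> G"
proof -
  define m where "m = Max ({1..n} - A)"
  have "p \<in> {1..n} - A" using p A by auto
  then have m: "m \<in> {1..n} - A" unfolding m_def by (intro Max_in) auto
  have le_m: "k \<le> m" if "k \<in> {1..n} - A" for k unfolding m_def using that by (intro Max_ge) auto
  have sq: "gmono d A \<in> square_zero_off n I" if "A \<subseteq> {1..n} - I" for d :: 'k and I
    using that A(2) by (intro square_zero_off_gmono) auto
  have to_m: "rho n k m (gmono d A) \<in> G" if "k \<in> {1..n} - A" "k \<noteq> m" for k d
    using that
  proof (induction "m - k" arbitrary: k rule: less_induct)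
    case less
    have km: "k < m" using le_m[OF less.prems(1)] less.prems(2) by simp
    \<comment> \<open>\<open>m\<close> lies above \<open>k\<close> and outside \<open>A\<close>,
      which is exactly what puts \<open>A\<close> into \<open>S1' n k\<close>, where the avoidance
      function is constrained.\<close>
    have "m \<in> {k + 1..n}" "m \<notin> A" using km m by auto
    then have "\<not> {k + 1..n} \<subseteq> A" by blast
    then have idx: "(k, A) \<in> rho_index n"
      using km m less.prems A by (auto simp: rho_index_def S1'_def)
    define j where "j = jf k A"
    have j: "j \<in> {1..n} - A" "k < j" using rho_index_side[OF jf idx] by (auto simp: j_def)
    have kj: "rho n k j (gmono d A) \<in> G" using rho[OF idx] by (simp add: j_def)
    show ?case
    proof (cases "j = m")
      case False
      then have "rho n j m (gmono d A) \<in> G" using j le_m[OF j(1)] km by (intro less.hyps) auto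
      then have "compose (Lambda n) (rho n k j (gmono d A)) (rho n j m (gmono d A)) \<in> G"
        using kj subgroup_compose[OF G] by blast
      also have "compose (Lambda n) (rho n k j (gmono d A)) (rho n j m (gmono d A)) = rho n k m (gmono d A)"
        using less.prems j m False A by (intro rho_chain sq) auto
      finally show ?thesis .
    qed (use kj in simp)
  qed
  have pA: "p \<in> {1..n} - A" "q \<in> {1..n} - A" using p q A by auto
  consider "q = m" | "p = m" | "p \<noteq> m" "q \<noteq> m" by blast
  then show ?thesis
  proof cases
    case 1
    then show ?thesis using to_m[OF pA(1)] pq by auto
  next
    case 2
    \<comment> \<open>Exchanging the indices of \<open>rho\<close> negates its parameter, so the
      case \<open>p = m\<close> is the previous one with \<open>- c\<close>.\<close>
    have "- gmono c A = gmono (- c) A" by (rule grassmann_eqI) (simp add: coeff_gmono)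
    then have "rho n p q (gmono c A) = rho n q m (gmono (- c) A)"
      unfolding rho_swap[OF pq] by (simp only: 2)
    then show ?thesis using to_m[OF pA(2), of "- c"] pq 2 by simp
  next
    case 3
    \<comment> \<open>In terms of differences, \<open>p - q\<close> is \<open>p - m\<close> minus
      \<open>q - m\<close>; the subtraction is a cancellation in \<open>G\<close>.\<close>
    have "compose (Lambda n) (rho n p q (gmono c A)) (rho n q m (gmono c A)) = rho n p m (gmono c A)"
      using p q m 3 pq A by (intro rho_chain sq) auto
    also have "\<dots> \<in> G" using to_m[OF pA(1)] 3 by blast
    finally show ?thesis
      by (rule subgroup_cancel[OF G Gamma_Bij[OF rho_Gamma[OF p q pq sq[OF A(1)]]] to_m[OF pA(2) 3(2)]])
  qed
qed

section \<open>Bounds for generated subgroups and separating linear forms\<close>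

lemma id_Sigma: "1 \<le> n \<Longrightarrow> (\<lambda>a\<in>Lambda n. a) \<in> Sigma_group n"
proof -
  assume "1 \<le> n"
  then have s: "1 \<in> {1..n}" by simp
  note S = s gfilt_0 supported_0
  have id: "ghom n (\<lambda>a\<in>Lambda n. a :: 'a grassmann)"
    by (auto simp: ghom_def Lambda_1 Lambda_add Lambda_mult Lambda_scale)
  have "(\<lambda>a\<in>Lambda n. a :: 'a grassmann) = sigma n 1 0"
    by (rule ghom_eqI[OF id Gamma_ghom[OF sigma_Gamma[OF S]]]) (simp add: sigma_gvar[OF S] Lambda_gvar)
  then show ?thesis using sigma_Sigma[OF S] by (simp only:)
qed

text \<open>The generators come in whole one-parameter subgroups, so their inverses lie in
  \<open>H\<close> as well and closure under composition is enough.\<close>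

lemma generate_subset:
  assumes X: "\<And>x. x \<in> X \<Longrightarrow> \<exists>\<phi>. one_parameter_subgroup n \<phi> \<and> x \<in> range \<phi> \<and> range \<phi> \<subseteq> H"
    and one: "(\<lambda>a\<in>Lambda n. a) \<in> H" and H: "\<And>s. s \<in> H \<Longrightarrow> s \<in> Bij (Lambda n)"
    and closed: "\<And>s t. s \<in> H \<Longrightarrow> t \<in> H \<Longrightarrow> compose (Lambda n) s t \<in> H"
  shows "generate (BijGroup (Lambda n)) X \<subseteq> H"
proof
  fix s assume "s \<in> generate (BijGroup (Lambda n)) X"
  then show "s \<in> H"
  proof induction
    case one
    then show ?case using assms(2) by (simp add: BijGroup_def restrict_def)
  next
    case (incl x)
    then show ?case using X by blast
  next
    case (inv x)
    then obtain \<phi> where \<phi>: "one_parameter_subgroup n \<phi>" "x \<in> range \<phi>" "range \<phi> \<subseteq> H" using X by blast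
    then have "inv\<^bsub>BijGroup (Lambda n)\<^esub> x \<in> range \<phi>"
      unfolding one_parameter_subgroup_def using subgroup.m_inv_closed by fast
    then show ?case using \<phi>(3) by blast
  next
    case (eng s t)
    then show ?case using closed H by (simp add: BijGroup_mult)
  qed
qed

text \<open>The point is that \<open>f\<close>, a linear form in the coefficients of degree three, is additive on \<open>\<Gamma>\<close>.\<close>

lemma not_generated:
  fixes f :: "'k::comm_ring_1 gmap \<Rightarrow> 'k" and v :: "nat \<Rightarrow> 'k"
  assumes f_def: "\<And>s. f s = (\<Sum>k=1..n. v k * coeff (s (gvar k)) (B k))"
    and B: "\<And>k. k \<in> {1..n} \<Longrightarrow> v k \<noteq> 0 \<Longrightarrow> card (B k) = 3" and "1 \<le> n"
    and X: "\<And>x. x \<in> X \<Longrightarrow> \<exists>\<phi>. one_parameter_subgroup n \<phi> \<and> x \<in> range \<phi> \<and> (\<forall>c. f (\<phi> c) = 0)"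
    and g: "g \<in> Sigma_group n" "f g \<noteq> 0"
  shows "Sigma_group n \<noteq> generate (BijGroup (Lambda n)) X"
proof -
  let ?H = "{s \<in> Sigma_group n. f s = 0}"
  have "generate (BijGroup (Lambda n)) X \<subseteq> ?H"
  proof (rule generate_subset)
    fix x assume "x \<in> X"
    then obtain \<phi> where "one_parameter_subgroup n \<phi>" "x \<in> range \<phi>" "\<And>c. f (\<phi> c) = 0" using X by blast
    then show "\<exists>\<phi>. one_parameter_subgroup n \<phi> \<and> x \<in> range \<phi> \<and> range \<phi> \<subseteq> ?H"
      unfolding one_parameter_subgroup_def by blast
  next
    have "f (\<lambda>a\<in>Lambda n. a) = 0"
      unfolding f_def using B by (intro sum.neutral ballI) (force simp: Lambda_gvar coeff_gvar)
    then show "(\<lambda>a\<in>Lambda n. a) \<in> ?H" using id_Sigma[OF \<open>1 \<le> n\<close>] by simp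
  next
    fix s t assume st: "s \<in> ?H" "t \<in> ?H"
    then have s: "s \<in> Gamma_group n" and t: "t \<in> Gamma_group n" by (auto intro: Sigma_Gamma)
    have "v k * coeff (compose (Lambda n) s t (gvar k)) (B k) =
        v k * coeff (s (gvar k)) (B k) + v k * coeff (t (gvar k)) (B k)" if k: "k \<in> {1..n}" for k
    proof (cases "v k = 0")
      case False
      then have "card (B k) = 3" using B k by blast
      \<comment> \<open>Corrections in \<open>Gamma_group n\<close> start in degree three, so
        \<open>coeff_compose_leading\<close> applies to all \<open>s\<close> and
        \<open>t\<close>.\<close>
      then have "coeff (compose (Lambda n) s t (gvar k)) (B k) = coeff (s (gvar k)) (B k) + coeff (t (gvar k)) (B k)"
        using Gamma_gvar_diff[OF t k] k by (intro coeff_compose_leading s t) auto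
      then show ?thesis by (simp add: distrib_left)
    qed simp
    then have "f (compose (Lambda n) s t) = f s + f t"
      unfolding f_def sum.distrib[symmetric] by (intro sum.cong) auto
    then show "compose (Lambda n) s t \<in> ?H" using st Sigma_compose by auto
  qed (auto intro: Gamma_Bij Sigma_Gamma)
  then show ?thesis using g by blast
qed

text \<open>\<open>D\<close> consists of the vertices from which \<open>i\<close> is reached along
  the edges from \<open>k\<close> to \<open>j k\<close>. Since \<open>k \<noteq> i\<close> has only
  one outgoing edge, it reaches \<open>i\<close> exactly if \<open>j k\<close> does; the edge at
  \<open>i\<close> leaves \<open>D\<close> because edges go upwards.\<close>

lemma avoidance_weight:
  fixes j :: "nat \<Rightarrow> nat"
  assumes "\<And>k. k \<in> S \<Longrightarrow> k < j k" and "i \<in> S"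
  obtains D where "i \<in> D" "j i \<notin> D" "\<And>k. k \<in> S \<Longrightarrow> k \<noteq> i \<Longrightarrow> k \<in> D \<longleftrightarrow> j k \<in> D"
proof -
  define R where "R = {(k, j k) | k. k \<in> S}"
  have le: "a \<le> b" if "(a, b) \<in> R\<^sup>*" for a b
    using that by (induction rule: rtrancl_induct) (use assms(1) in \<open>force simp: R_def\<close>)+
  show ?thesis
  proof (rule that[of "{k. (k, i) \<in> R\<^sup>*}"])
    show "j i \<notin> {k. (k, i) \<in> R\<^sup>*}" using le[of "j i" i] assms(1)[OF assms(2)] by auto
    fix k assume "k \<in> S" "k \<noteq> i"
    then have "(k, i) \<in> R\<^sup>* \<longleftrightarrow> (j k, i) \<in> R\<^sup>*"
      by (auto simp: R_def elim: converse_rtranclE intro: converse_rtrancl_into_rtrancl)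
    then show "k \<in> {k. (k, i) \<in> R\<^sup>*} \<longleftrightarrow> j k \<in> {k. (k, i) \<in> R\<^sup>*}" by simp
  qed simp
qed

theorem theorem6p1:
  fixes n :: nat and jf :: "nat \<Rightarrow> nat set \<Rightarrow> nat"
  assumes "n \<ge> 7"
    and "avoidance n jf"
    and "odd n \<or> (even n \<and> (\<exists>h :: 'k::comm_ring_1. 2 * h = 1))"
  shows "(Sigma_group n :: 'k gmap set)
        = generate (BijGroup (Lambda n))
            ((\<Union>p\<in>rho_index n. rho_subgroup n jf p) \<union> (\<Union>q\<in>sigma_index n. sigma_subgroup n q))
    \<and> (\<forall>p\<in>rho_index n. one_parameter_subgroup n (rho_family n jf p :: 'k \<Rightarrow> 'k gmap))
    \<and> (\<forall>q\<in>sigma_index n. one_parameter_subgroup n (sigma_family n q :: 'k \<Rightarrow> 'k gmap))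
    \<and> (\<forall>p\<in>rho_index n. (Sigma_group n :: 'k gmap set)
        \<noteq> generate (BijGroup (Lambda n))
            ((\<Union>p'\<in>rho_index n - {p}. rho_subgroup n jf p') \<union> (\<Union>q\<in>sigma_index n. sigma_subgroup n q)))
    \<and> (\<forall>q\<in>sigma_index n. (Sigma_group n :: 'k gmap set)
        \<noteq> generate (BijGroup (Lambda n))
            ((\<Union>p\<in>rho_index n. rho_subgroup n jf p) \<union> (\<Union>q'\<in>sigma_index n - {q}. sigma_subgroup n q')))"
proof -
  note jf = \<open>avoidance n jf\<close>
  have n1: "1 \<le> n" using assms(1) by simp
  let ?rf = "rho_family n jf :: _ \<Rightarrow> 'k \<Rightarrow> 'k gmap" and ?sf = "sigma_family n :: _ \<Rightarrow> 'k \<Rightarrow> 'k gmap"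
  have rf: "?rf p = (\<lambda>c. rho n (fst p) (jf (fst p) (snd p)) (gmono c (snd p)))" if "p \<in> rho_index n" for p
    using rho_index_side(6)[OF jf, of "fst p" "snd p"] that
    by (cases p) (auto simp: rho_family_gmono simp del: rho_family.simps)
  have rho1: "one_parameter_subgroup n (?rf p)" if "p \<in> rho_index n" for p
    unfolding rf[OF that] using rho_index_side[OF jf, of "fst p" "snd p"] that
    by (intro rho_one_parameter) auto
  have sigma1: "one_parameter_subgroup n (?sf q)" if "q \<in> sigma_index n" for q
  proof -
    obtain i j k l where q: "q = (i, j, k, l)" by (cases q)
    have "?sf q = (\<lambda>c. sigma n i (gmono c {j, k, l}))"
      using that unfolding q by (intro ext sigma_family_gmono)
    moreover have "one_parameter_subgroup n (\<lambda>c. sigma n i (gmono c {j, k, l}) :: 'k gmap)"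
      using sigma_index_side[of i j k l n] that unfolding q by (intro sigma_one_parameter) auto
    ultimately show ?thesis by simp
  qed
  let ?X = "(\<Union>p\<in>rho_index n. range (?rf p)) \<union> (\<Union>q\<in>sigma_index n. range (?sf q))"
  have X: "\<exists>\<phi>. one_parameter_subgroup n \<phi> \<and> x \<in> range \<phi> \<and> range \<phi> \<subseteq> ?X" if "x \<in> ?X" for x
    using that rho1 sigma1 by blast
  have XS: "?X \<subseteq> Sigma_group n"
    using rho1 sigma1 unfolding one_parameter_subgroup_def by blast
  have "generate (BijGroup (Lambda n)) ?X = Sigma_group n"
  proof
    show "generate (BijGroup (Lambda n)) ?X \<subseteq> Sigma_group n"
    proof (rule generate_subset)
      show "\<exists>\<phi>. one_parameter_subgroup n \<phi> \<and> x \<in> range \<phi> \<and> range \<phi> \<subseteq> Sigma_group n" if "x \<in> ?X" for x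
        using X[OF that] XS by blast
    qed (auto intro: id_Sigma n1 Gamma_Bij Sigma_Gamma Sigma_compose)
    let ?G = "generate (BijGroup (Lambda n)) ?X"
    have "?X \<subseteq> carrier (BijGroup (Lambda n))"
      using XS Gamma_Bij Sigma_Gamma by (fastforce simp: BijGroup_def)
    then have G: "subgroup ?G (BijGroup (Lambda n))" by (intro group.generate_is_subgroup group_BijGroup)
    have rho_base: "rho n i (jf i \<alpha>) (gmono c \<alpha>) \<in> ?G" if "(i, \<alpha>) \<in> rho_index n" for i \<alpha> c
    proof -
      have "rho n i (jf i \<alpha>) (gmono c \<alpha>) \<in> range (?rf (i, \<alpha>))"
        using rangeI[of "?rf (i, \<alpha>)" c] by (simp only: rf[OF that] fst_conv snd_conv)
      then show ?thesis using that by (intro generate.incl) blast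
    qed
    have rho2: "rho n p q (gmono c A) \<in> ?G"
      if "p \<in> {1..n}" "q \<in> {1..n}" "p \<noteq> q" "A \<subseteq> {1..n} - {p, q}" "card A = 2" for p q A c
      using that by (intro rho_avoidance_generated[OF jf G rho_base])
    have sigma3: "sigma n i (gmono c A) \<in> ?G" if iA: "i \<in> {1..n}" "A \<subseteq> {1..n} - {i}" "card A = 3" for i A c
    proof -
      obtain j k l where q: "(i, j, k, l) \<in> sigma_index n" and A: "A = {j, k, l}"
        by (rule sigma_index_exhaust[OF iA])
      have "sigma n i (gmono c A) \<in> range (?sf (i, j, k, l))"
        unfolding A sigma_family_gmono[OF q, symmetric] by (rule rangeI)
      then show ?thesis using q by (intro generate.incl) blast
    qed
    have half: "odd n \<or> (\<exists>h :: 'k. 2 * h = 1)" using assms(3) by blast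
    have sig: "sigma n i (gmono c A) \<in> ?G"
      if "i \<in> {1..n}" "A \<subseteq> {1..n} - {i}" "odd (card A)" "3 \<le> card A" for i A c
      by (rule sigma_generated[OF G sigma3 rho2 half that])
    have rho: "rho n p q (gmono c A) \<in> ?G"
      if "p \<in> {1..n}" "q \<in> {1..n}" "p \<noteq> q" "A \<subseteq> {1..n} - {p, q}" "even (card A)" "2 \<le> card A" for p q A c
      by (rule rho_generated[OF G sig rho2 that])
    show "Sigma_group n \<subseteq> ?G"
    proof
      fix s :: "'k gmap" assume s: "s \<in> Sigma_group n"
      show "s \<in> ?G"
        by (rule Sigma_generated_level[OF G sig rho, of 3])
          (use s Gamma_gvar_diff[OF Sigma_Gamma[OF s]] in auto)
    qed
  qed
  moreover have "Sigma_group n \<noteq> generate (BijGroup (Lambda n))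
      ((\<Union>p'\<in>rho_index n - {p}. range (?rf p')) \<union> (\<Union>q\<in>sigma_index n. range (?sf q)))"
    if p: "p \<in> rho_index n" for p
  proof -
    obtain i \<alpha> where p': "p = (i, \<alpha>)" by (cases p)
    \<comment> \<open>The starting points of the edges from \<open>k\<close> to
      \<open>jf k \<alpha>\<close> given by the generators with monomial
      \<open>\<alpha>\<close>.\<close>
    define S where "S = {k. (k, \<alpha>) \<in> rho_index n}"
    have lt: "k < jf k \<alpha>" if "k \<in> S" for k using rho_index_side(3)[OF jf] that by (simp add: S_def)
    have iS: "i \<in> S" using p p' by (simp add: S_def)
    obtain D where D: "i \<in> D" "jf i \<alpha> \<notin> D" "\<And>k. k \<in> S \<Longrightarrow> k \<noteq> i \<Longrightarrow> k \<in> D \<longleftrightarrow> jf k \<alpha> \<in> D"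
      using avoidance_weight[of S "\<lambda>k. jf k \<alpha>", OF lt iS] by blast
    note side = rho_index_side[OF jf p[unfolded p']]
    \<comment> \<open>The sign turns the coefficient at \<open>insert k \<alpha>\<close> into that
      of \<open>gvar k * xpow \<alpha>\<close>; the condition \<open>k \<notin> \<alpha>\<close>
      keeps this set in degree three.\<close>
    define v :: "nat \<Rightarrow> 'k" where "v k = (if k \<in> D \<and> k \<notin> \<alpha> then gsign {k} \<alpha> else 0)" for k
    define f :: "'k gmap \<Rightarrow> 'k" where "f s = (\<Sum>k=1..n. v k * coeff (s (gvar k)) (insert k \<alpha>))" for s
    have B: "card (insert k \<alpha>) = 3" if "v k \<noteq> 0" for k
      using that side(5,6) by (auto simp: v_def split: if_splits)
    have v0: "v k * coeff (gvar k) (insert k \<alpha>) = 0" for k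
      using B[of k] by (cases "v k = 0") (auto simp: coeff_gvar)
    \<comment> \<open>For \<open>\<beta> = \<alpha>\<close> the value is \<open>c\<close> times the
      difference of the indicator of \<open>D\<close> at the two ends of the edge, so the choice of
      \<open>D\<close> makes it vanish on every family but the one at
      \<open>(i, \<alpha>)\<close>.\<close>
    have f_rho: "f (?rf (r, \<beta>) c) = (if \<beta> = \<alpha> then (if r \<in> D then c else 0) - (if jf r \<alpha> \<in> D then c else 0) else 0)"
      if r: "(r, \<beta>) \<in> rho_index n" for r \<beta> c
    proof -
      let ?j = "jf r \<beta>"
      note R = rho_index_side[OF jf r]
      have rj: "r \<noteq> ?j" using R(3) by simp
      have sq: "gmono c \<beta> \<in> square_zero_off n {r, ?j}" using R by (intro square_zero_off_gmono) auto
      have nin: "r \<notin> \<beta>" "?j \<notin> \<beta>" using R(4) by auto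
      have e: "insert k \<beta> = insert k \<alpha> \<longleftrightarrow> \<beta> = \<alpha>" if "k \<notin> \<beta>" "k \<notin> \<alpha>" for k using that by (rule insert_ident)
      have m: "v k * coeff (gvar k * gmono c \<beta>) (insert k \<alpha>) = (if \<beta> = \<alpha> \<and> k \<in> D then c else 0)" if "k \<notin> \<beta>" for k
        using that R(6) e[of k] by (auto simp: v_def gvar_times_gmono coeff_gmono)
      have pm: "v k * coeff (gvar k * (1 + gmono c \<beta>)) (insert k \<alpha>) = (if \<beta> = \<alpha> \<and> k \<in> D then c else 0)"
          "v k * coeff (gvar k * (1 - gmono c \<beta>)) (insert k \<alpha>) = (if \<beta> = \<alpha> \<and> k \<in> D then - c else 0)"
        if "k \<notin> \<beta>" for k
        using v0[of k] m[OF that] by (simp_all add: distrib_left right_diff_distrib)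
      have "v k * coeff (rho n r ?j (gmono c \<beta>) (gvar k)) (insert k \<alpha>) =
          (if k = r then (if \<beta> = \<alpha> \<and> r \<in> D then c else 0) else 0) - (if k = ?j then (if \<beta> = \<alpha> \<and> ?j \<in> D then c else 0) else 0)"
        if k: "k \<in> {1..n}" for k
        unfolding rho_gvar[OF R(1,2) rj sq k]
        using rj nin by (auto simp: pm v0)
      then have "f (?rf (r, \<beta>) c) = (\<Sum>k=1..n. (if k = r then (if \<beta> = \<alpha> \<and> r \<in> D then c else 0) else 0)
          - (if k = ?j then (if \<beta> = \<alpha> \<and> ?j \<in> D then c else 0) else 0))"
        unfolding f_def rf[OF r] by (intro sum.cong) auto
      also have "\<dots> = (if \<beta> = \<alpha> \<and> r \<in> D then c else 0) - (if \<beta> = \<alpha> \<and> ?j \<in> D then c else 0)"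
        using R(1,2) unfolding sum_subtractf by simp
      finally show ?thesis by simp
    qed
    have f_sigma: "f (?sf (r, j, k, l) c) = 0" if r: "(r, j, k, l) \<in> sigma_index n" for r j k l c
    proof -
      note R = sigma_index_side[OF r]
      have S: "gmono c {j, k, l} \<in> gfilt n 3" "gmono c {j, k, l} \<in> span_on ({1..n} - {r})"
        using sigma_gmono_side[OF R(2), of c] by (simp_all only: R(3)) simp_all
      \<comment> \<open>The correction occurs only for \<open>m = r\<close>; there
        \<open>insert m \<alpha>\<close> contains \<open>r\<close>, which the parameter of
        \<open>sigma\<close> avoids.\<close>
      have "v m * coeff (sigma n r (gmono c {j, k, l}) (gvar m)) (insert m \<alpha>) = 0" if m: "m \<in> {1..n}" for m
        unfolding sigma_gvar[OF R(1) S m] using v0[of m] R(2) by (auto simp: distrib_left coeff_gmono)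
      then show ?thesis unfolding f_def sigma_family_gmono[OF r] by (intro sum.neutral) auto
    qed
    show ?thesis
    proof (rule not_generated[OF f_def])
      show "?rf (i, \<alpha>) 1 \<in> Sigma_group n" using XS p p' by blast
      show "f (?rf (i, \<alpha>) 1) \<noteq> 0" using f_rho[of i \<alpha> 1] p p' D(1,2) by simp
      fix x assume "x \<in> (\<Union>p'\<in>rho_index n - {p}. range (?rf p')) \<union> (\<Union>q\<in>sigma_index n. range (?sf q))"
      then consider w where "w \<in> rho_index n" "w \<noteq> p" "x \<in> range (?rf w)"
        | w where "w \<in> sigma_index n" "x \<in> range (?sf w)"
        by blast
      then show "\<exists>\<phi>. one_parameter_subgroup n \<phi> \<and> x \<in> range \<phi> \<and> (\<forall>c. f (\<phi> c) = 0)"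
      proof cases
        case 1
        obtain r \<beta> where w: "w = (r, \<beta>)" by (cases w)
        have "f (?rf w c) = 0" for c
          using f_rho[OF 1(1)[unfolded w], of c] D(3)[of r] 1(1,2) unfolding w p' by (auto simp: S_def)
        then show ?thesis using rho1[OF 1(1)] 1(3) by blast
      next
        case 2
        obtain r j k l where w: "w = (r, j, k, l)" by (cases w)
        have "f (?sf w c) = 0" for c using f_sigma[OF 2(1)[unfolded w], of c] unfolding w .
        then show ?thesis using sigma1[OF 2(1)] 2(2) by blast
      qed
    qed (use B n1 in auto)
  qed
  moreover have "Sigma_group n \<noteq> generate (BijGroup (Lambda n))
      ((\<Union>p\<in>rho_index n. range (?rf p)) \<union> (\<Union>q'\<in>sigma_index n - {q}. range (?sf q')))"
    if q: "q \<in> sigma_index n" for q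
  proof -
    obtain i j k l where q': "q = (i, j, k, l)" by (cases q)
    note Q = sigma_index_side[OF q[unfolded q']]
    let ?T = "{j, k, l}"
    \<comment> \<open>A single coefficient separates here, that of \<open>?T\<close> in the image of
      \<open>gvar i\<close>; the weights cast it in the form that \<open>not_generated\<close>
      expects.\<close>
    define v :: "nat \<Rightarrow> 'k" where "v m = (if m = i then 1 else 0)" for m
    define f :: "'k gmap \<Rightarrow> 'k" where "f s = (\<Sum>m=1..n. v m * coeff (s (gvar m)) ?T)" for s
    have f: "f s = coeff (s (gvar i)) ?T" for s
    proof -
      have "f s = (\<Sum>m=1..n. if m = i then coeff (s (gvar i)) ?T else 0)"
        unfolding f_def v_def by (intro sum.cong) auto
      then show ?thesis using Q(1) by simp
    qed
    have g0: "coeff (gvar m) ?T = (0 :: 'k)" for m using Q(3) by (intro coeff_gvar) simp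
    have f_rho: "f (?rf (r, \<beta>) c) = 0" if r: "(r, \<beta>) \<in> rho_index n" for r \<beta> c
    proof -
      note R = rho_index_side[OF jf r]
      have rj: "r \<noteq> jf r \<beta>" using R(3) by simp
      have sq: "gmono c \<beta> \<in> square_zero_off n {r, jf r \<beta>}" using R by (intro square_zero_off_gmono) auto
      \<comment> \<open>All that \<open>rho\<close> can add to \<open>gvar i\<close> is a multiple
        of a monomial containing \<open>i\<close>, whereas \<open>?T\<close> avoids
        \<open>i\<close>.\<close>
      have "insert i \<beta> \<noteq> ?T" using Q(2) by blast
      then have "coeff (gvar i * gmono c \<beta>) ?T = 0" using R(6) by (auto simp: gvar_times_gmono coeff_gmono)
      then show ?thesis unfolding f rf[OF r] fst_conv snd_conv rho_gvar[OF R(1,2) rj sq Q(1)]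
        using g0 by (auto simp: distrib_left right_diff_distrib)
    qed
    have f_sigma: "f (?sf (r, a, b, d) c) = (if (r, a, b, d) = (i, j, k, l) then c else 0)"
      if r: "(r, a, b, d) \<in> sigma_index n" for r a b d c
    proof -
      note R = sigma_index_side[OF r]
      have S: "gmono c {a, b, d} \<in> gfilt n 3" "gmono c {a, b, d} \<in> span_on ({1..n} - {r})"
        using sigma_gmono_side[OF R(2), of c] by (simp_all only: R(3)) simp_all
      have o: "a < b" "b < d" "j < k" "k < l" using r q unfolding q' by (simp_all add: sigma_index_def)
      have "a = j \<and> b = k \<and> d = l" if "{a, b, d} = ?T" using ordered_triple_inject[OF that o] by simp
      then have "{a, b, d} = ?T \<longleftrightarrow> a = j \<and> b = k \<and> d = l" by auto
      then show ?thesis unfolding f sigma_family_gmono[OF r] sigma_gvar[OF R(1) S Q(1)]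
        using g0 by (auto simp: coeff_gmono)
    qed
    show ?thesis
    proof (rule not_generated[OF f_def])
      show "?sf (i, j, k, l) 1 \<in> Sigma_group n" using XS q q' by blast
      show "f (?sf (i, j, k, l) 1) \<noteq> 0" using f_sigma[of i j k l 1] q q' by simp
      fix x assume "x \<in> (\<Union>p\<in>rho_index n. range (?rf p)) \<union> (\<Union>q'\<in>sigma_index n - {q}. range (?sf q'))"
      then consider w where "w \<in> rho_index n" "x \<in> range (?rf w)"
        | w where "w \<in> sigma_index n" "w \<noteq> q" "x \<in> range (?sf w)"
        by blast
      then show "\<exists>\<phi>. one_parameter_subgroup n \<phi> \<and> x \<in> range \<phi> \<and> (\<forall>c. f (\<phi> c) = 0)"
      proof cases
        case 1
        have "f (?rf w c) = 0" for c using f_rho[of "fst w" "snd w" c] 1(1) by simp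
        then show ?thesis using rho1[OF 1(1)] 1(2) by blast
      next
        case 2
        obtain r a b d where w: "w = (r, a, b, d)" by (cases w)
        have "f (?sf w c) = 0" for c
          using f_sigma[OF 2(1)[unfolded w], of c] 2(2) unfolding w q' by (simp only: if_False)
        then show ?thesis using sigma1[OF 2(1)] 2(3) by blast
      qed
    qed (use Q n1 in auto)
  qed
  ultimately show ?thesis using rho1 sigma1 by blast
qed

end
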